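(* Let $(\mathfrak g,[\cdot,\cdot],\omega)$ be a symplectic Lie algebra such that $[\mathfrak g,\mathfrak g]$ is nondegenerate. Then $(\mathfrak g,[\cdot,\cdot])$ is unimodular, and therefore it is solvable. Moreover, if $(\mathfrak g,[\cdot,\cdot])$ is non-abelian, then it is non-nilpotent.
   Context: All Lie algebras are real and finite-dimensional. A symplectic Lie algebra $(\mathfrak g,[\cdot,\cdot],\omega)$ is a Lie algebra with a nondegenerate skew-symmetric bilinear form $\omega$ satisfying $\omega([x,y],z)+\omega([y,z],x)+\omega([z,x],y)=0$ for all $x,y,z\in\mathfrak g$. For a subspace $\mathfrak m\subseteq\mathfrak g$, $\mathfrak m^\perp=\{x\in\mathfrak g:\omega(x,y)=0\ \forall y\in\mathfrak m\}$; $\mathfrak m$ is nondegenerate if $\mathfrak m\cap\mathfrak m^\perp=\{0\}$. A Lie algebra is unimodular if $\mathrm{tr}(\mathrm{ad}_x)=0$ for all $x$. *)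

theory Defs
  imports "HOL-Analysis.Analysis"
begin

text \<open>
  The underlying vector space of a Lie algebra is a whole type of class
  \<^class>\<open>real_vector\<close>. Finite-dimensionality is a locale assumption rather than the
  class \<^class>\<open>euclidean_space\<close>, so that no inner product is singled out and dimension 0
  is allowed.
\<close>

locale real_lie_algebra =
  fixes br :: "'a::real_vector \<Rightarrow> 'a \<Rightarrow> 'a"
  assumes finite_dimensional: "\<exists>B :: 'a set. finite B \<and> span B = UNIV"
    and bilinear_bracket: "bilinear br"
    and alternating: "br x x = 0"
    and jacobi: "br x (br y z) + br y (br z x) + br z (br x y) = 0"

definition symp_orth :: "('a \<Rightarrow> 'a \<Rightarrow> real) \<Rightarrow> 'a set \<Rightarrow> 'a::real_vector set" where
  "symp_orth \<omega> M = {x. \<forall>y\<in>M. \<omega> x y = 0}"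

definition nondegenerate_subspace :: "('a \<Rightarrow> 'a \<Rightarrow> real) \<Rightarrow> 'a::real_vector set \<Rightarrow> bool" where
  "nondegenerate_subspace \<omega> M \<longleftrightarrow> M \<inter> symp_orth \<omega> M = {0}"

locale symplectic_lie_algebra = real_lie_algebra br
  for br :: "'a::real_vector \<Rightarrow> 'a \<Rightarrow> 'a" +
  fixes \<omega> :: "'a \<Rightarrow> 'a \<Rightarrow> real"
  assumes bilinear_form: "bilinear \<omega>"
    and skew_symmetric: "\<omega> x y = - \<omega> y x"
    and nondegenerate: "(\<And>y. \<omega> x y = 0) \<Longrightarrow> x = 0"
    and closed_form: "\<omega> (br x y) z + \<omega> (br y z) x + \<omega> (br z x) y = 0"

definition bracket_space :: "('a \<Rightarrow> 'a \<Rightarrow> 'a) \<Rightarrow> 'a set \<Rightarrow> 'a set \<Rightarrow> 'a::real_vector set" where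
  "bracket_space br A B = span {br x y | x y. x \<in> A \<and> y \<in> B}"

text \<open>
  On a finite-dimensional space, \<open>extend_basis {}\<close> is an arbitrary basis; by
  \<open>endo_trace_eq\<close> below the choice is irrelevant.
\<close>

definition endo_trace :: "('a::real_vector \<Rightarrow> 'a) \<Rightarrow> real" where
  "endo_trace f = (\<Sum>b\<in>extend_basis {}. representation (extend_basis {}) (f b) b)"

lemma endo_trace_eq:
  fixes f :: "'a::real_vector \<Rightarrow> 'a"
  assumes f: "linear f" and C: "finite C" "independent C" "span C = UNIV"
  shows "endo_trace f = (\<Sum>c\<in>C. representation C (f c) c)"
proof -
  define B :: "'a set" where "B = extend_basis {}"
  have B: "independent B" "span B = UNIV"
    unfolding B_def by (auto simp: real_vector.independent_extend_basis real_vector.independent_empty)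
  have finB: "finite B"
    using real_vector.independent_span_bound[of C B] C B by auto
  have 1: "representation B (f b) b = (\<Sum>c\<in>C. representation C b c * representation B (f c) b)" for b
  proof -
    have "f b = f (\<Sum>c\<in>C. representation C b c *\<^sub>R c)"
      using C by (subst real_vector.sum_representation_eq) auto
    also have "\<dots> = (\<Sum>c\<in>C. representation C b c *\<^sub>R f c)"
      using f by (simp add: linear_sum linear_scale)
    finally show ?thesis
      using B by (simp add: real_vector.representation_sum real_vector.representation_scale)
  qed
  have 2: "representation C (f c) c = (\<Sum>b\<in>B. representation B (f c) b * representation C b c)" for c
  proof -
    have "f c = (\<Sum>b\<in>B. representation B (f c) b *\<^sub>R b)"
      using B finB by (subst real_vector.sum_representation_eq) auto
    then have "representation C (f c) c = representation C (\<Sum>b\<in>B. representation B (f c) b *\<^sub>R b) c"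
      by simp
    then show ?thesis
      using C by (simp add: real_vector.representation_sum real_vector.representation_scale)
  qed
  have "endo_trace f = (\<Sum>b\<in>B. \<Sum>c\<in>C. representation C b c * representation B (f c) b)"
    by (simp add: endo_trace_def B_def[symmetric] 1)
  also have "\<dots> = (\<Sum>c\<in>C. \<Sum>b\<in>B. representation B (f c) b * representation C b c)"
    by (subst sum.swap) (simp add: mult.commute)
  finally show ?thesis by (simp add: 2)
qed

definition lie_unimodular :: "('a::real_vector \<Rightarrow> 'a \<Rightarrow> 'a) \<Rightarrow> bool" where
  "lie_unimodular br \<longleftrightarrow> (\<forall>x. endo_trace (br x) = 0)"

definition lie_abelian :: "('a::real_vector \<Rightarrow> 'a \<Rightarrow> 'a) \<Rightarrow> bool" where
  "lie_abelian br \<longleftrightarrow> (\<forall>x y. br x y = 0)"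

primrec derived_series :: "('a::real_vector \<Rightarrow> 'a \<Rightarrow> 'a) \<Rightarrow> nat \<Rightarrow> 'a set" where
  "derived_series br 0 = UNIV"
| "derived_series br (Suc k) = bracket_space br (derived_series br k) (derived_series br k)"

primrec lower_central_series :: "('a::real_vector \<Rightarrow> 'a \<Rightarrow> 'a) \<Rightarrow> nat \<Rightarrow> 'a set" where
  "lower_central_series br 0 = UNIV"
| "lower_central_series br (Suc k) = bracket_space br UNIV (lower_central_series br k)"

definition lie_solvable :: "('a::real_vector \<Rightarrow> 'a \<Rightarrow> 'a) \<Rightarrow> bool" where
  "lie_solvable br \<longleftrightarrow> (\<exists>k. derived_series br k = {0})"

definition lie_nilpotent :: "('a::real_vector \<Rightarrow> 'a \<Rightarrow> 'a) \<Rightarrow> bool" where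
  "lie_nilpotent br \<longleftrightarrow> (\<exists>k. lower_central_series br k = {0})"

end

theory Submission
  imports Defs "HOL-Computational_Algebra.Fundamental_Theorem_Algebra"
begin

text \<open>
  Unimodularity: \<open>x \<mapsto> tr (ad x)\<close> vanishes on \<open>D = [g, g]\<close>, and on its symplectic complement because
  closedness of \<open>\<omega>\<close> makes \<open>ad a\<close> skew-adjoint for \<open>a\<close> orthogonal to \<open>D\<close>; so the vector representing this
  functional lies in \<open>D\<close> and is orthogonal to \<open>D\<close>.

  Solvability: the left-symmetric product \<open>\<omega> (x \<bullet> y) z = - \<omega> y [x, z]\<close> has right multiplications \<open>R v\<close> with
  \<open>R (w \<bullet> v) = R v \<circ> R w + [L w, R v]\<close>. Unimodularity gives \<open>tr (R w) = 0\<close>, hence all powers of \<open>R v\<close> have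
  trace 0 and \<open>R v\<close> is nilpotent. Consequently no \<open>e \<noteq> 0\<close> satisfies \<open>\<omega> e (centralizer of e) = 0\<close>, since
  then \<open>R v e = - e\<close> for some \<open>v\<close>. A complex Lie algebra that is not solvable does contain \<open>h\<close> and
  \<open>e \<noteq> 0\<close> with \<open>[h, e] = 2 e\<close> such that \<open>ad h\<close> has no eigenvalue \<open>-2\<close> on the centralizer of \<open>e\<close>, and
  closedness of \<open>\<omega>\<close> forces \<open>\<omega> e\<close> to vanish there.
\<close>

text \<open>The weight -2 enters because, on the centralizer of \<open>e\<close>, closedness lets
  \<open>\<omega>\<close> pair \<open>e\<close>, of weight 2 under \<open>ad h\<close>, only with
  weight -2. The obstacle is to have \<open>h\<close> and \<open>e\<close> in the algebra itself.
  Trace form arguments live in a perfect ideal \<open>p\<close>, the stationary term of the derived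
  series, and give sl2 relations only modulo \<open>J\<close>, the radical of the Killing form on
  \<open>p\<close>. The error is pushed down the lower central series of \<open>J\<close>, which
  ends at zero because \<open>J\<close> acts nilpotently. Each correction solves a linear equation
  one level down; its solvability and the absence of weight -2 both reduce to computations with
  operators that satisfy sl2 relations exactly. Such operators exist on the associated graded space:
  \<open>J\<close> acts there as zero, while traces are those of the original operators. Complex
  scalars provide generalized eigenspaces and the conjugates of eigenvalues; unimodularity and the
  derived series carry over from the real algebra.\<close>

section \<open>Linear algebra in finite dimension\<close>

text \<open>Scalar multiplication is a parameter because the results serve real scalars on the
  original type as well as complex scalars on pairs, through \<open>cscale\<close>.\<close>

locale fin_dim_space = finite_dimensional_vector_space scale Basis
  for scale :: "'a::field \<Rightarrow> 'b::ab_group_add \<Rightarrow> 'b" (infixr \<open>\<cdot>\<close> 75) and Basis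
begin

abbreviation lin :: "('b \<Rightarrow> 'b) \<Rightarrow> bool" where
  "lin f \<equiv> Vector_Spaces.linear scale scale f"

abbreviation linform :: "('b \<Rightarrow> 'a) \<Rightarrow> bool" where
  "linform f \<equiv> Vector_Spaces.linear scale (*) f"

lemma linI: "(\<And>x y. f (x + y) = f x + f y) \<Longrightarrow> (\<And>c x. f (c \<cdot> x) = c \<cdot> f x) \<Longrightarrow> lin f"
  by (simp add: Vector_Spaces.linear_iff vector_space_axioms)

lemma lin_add: "lin f \<Longrightarrow> f (x + y) = f x + f y"
  and lin_scale: "lin f \<Longrightarrow> f (c \<cdot> x) = c \<cdot> f x"
  by (simp_all add: Vector_Spaces.linear_iff)

lemma lin_0: "lin f \<Longrightarrow> f 0 = 0"
  by (metis lin_scale scale_zero_left)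

lemma lin_neg: "lin f \<Longrightarrow> f (- x) = - f x"
  by (metis lin_0 lin_add add.right_inverse add_eq_0_iff)

lemma lin_diff: "lin f \<Longrightarrow> f (x - y) = f x - f y"
  by (metis lin_add lin_neg diff_conv_add_uminus)

lemma lin_sum: "lin f \<Longrightarrow> f (sum g A) = (\<Sum>x\<in>A. f (g x))"
  by (induction A rule: infinite_finite_induct) (simp_all add: lin_add lin_0)

lemma linformI: "(\<And>x y. f (x + y) = f x + f y) \<Longrightarrow> (\<And>c x. f (c \<cdot> x) = c * f x) \<Longrightarrow> linform f"
  by (simp add: Vector_Spaces.linear_iff vector_space_axioms vector_space_over_itself.vector_space_axioms)

lemma linform_add: "linform f \<Longrightarrow> f (x + y) = f x + f y"
  and linform_scale: "linform f \<Longrightarrow> f (c \<cdot> x) = c * f x"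
  by (simp_all add: Vector_Spaces.linear_iff)

lemma linform_0: "linform f \<Longrightarrow> f 0 = 0"
  by (metis linform_scale mult_zero_left scale_zero_left)

lemma linform_sum: "linform f \<Longrightarrow> f (sum g A) = (\<Sum>x\<in>A. f (g x))"
  by (induction A rule: infinite_finite_induct) (simp_all add: linform_add linform_0)

lemma lin_comp: "lin f \<Longrightarrow> lin g \<Longrightarrow> lin (\<lambda>x. f (g x))"
  and lin_plus: "lin f \<Longrightarrow> lin g \<Longrightarrow> lin (\<lambda>x. f x + g x)"
  and lin_minus: "lin f \<Longrightarrow> lin g \<Longrightarrow> lin (\<lambda>x. f x - g x)"
  and lin_smult: "lin f \<Longrightarrow> lin (\<lambda>x. c \<cdot> f x)"
  and lin_ident: "lin (\<lambda>x. x)"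
  and lin_zero: "lin (\<lambda>x. 0)"
  by (auto intro!: linI simp: lin_add lin_scale lin_diff algebra_simps)

lemma lin_setsum: "(\<And>i. i \<in> I \<Longrightarrow> lin (f i)) \<Longrightarrow> lin (\<lambda>x. \<Sum>i\<in>I. f i x)"
  by (intro linI) (simp_all add: lin_add lin_scale sum.distrib scale_sum_right)

lemma lin_funpow: "lin f \<Longrightarrow> lin (f ^^ k)"
  by (induction k) (auto simp: o_def id_def intro: lin_comp lin_ident)

lemmas lin_intros = lin_comp lin_plus lin_minus lin_smult lin_ident lin_zero lin_setsum lin_funpow

lemma span_lin_image: "x \<in> span S \<Longrightarrow> lin f \<Longrightarrow> (\<And>y. y \<in> S \<Longrightarrow> f y \<in> T) \<Longrightarrow> subspace T \<Longrightarrow> f x \<in> T"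
  by (induction x rule: span_induct_alt)
    (simp_all add: lin_0 lin_add lin_scale subspace_0 subspace_add subspace_scale)

lemma span_in: "x \<in> span S \<Longrightarrow> S \<subseteq> T \<Longrightarrow> subspace T \<Longrightarrow> x \<in> T"
  using span_minimal by blast

lemma lin_eq_on_span: "x \<in> span S \<Longrightarrow> lin f \<Longrightarrow> lin g \<Longrightarrow> (\<And>b. b \<in> S \<Longrightarrow> f b = g b) \<Longrightarrow> f x = g x"
  by (induction x rule: span_induct_alt) (simp_all add: lin_0 lin_add lin_scale)

lemma linform_eq_on_span: "x \<in> span S \<Longrightarrow> linform f \<Longrightarrow> linform g \<Longrightarrow> (\<And>b. b \<in> S \<Longrightarrow> f b = g b) \<Longrightarrow> f x = g x"
  by (induction x rule: span_induct_alt) (simp_all add: linform_0 linform_add linform_scale)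

lemma lin_on_basis:
  assumes "independent B"
  shows "\<exists>g. lin g \<and> (\<forall>b\<in>B. g b = f b)"
proof -
  interpret vector_space_pair scale scale ..
  show ?thesis
    using linear_independent_extend[OF assms] by blast
qed

lemma linform_on_basis:
  assumes "independent B"
  shows "\<exists>g. linform g \<and> (\<forall>b\<in>B. g b = f b)"
proof -
  interpret vector_space_pair scale "(*)" ..
  show ?thesis
    using linear_independent_extend[OF assms] by blast
qed

lemma linform_separating:
  assumes W: "subspace W" and e: "e \<notin> W"
  shows "\<exists>\<phi>. linform \<phi> \<and> \<phi> e = 1 \<and> (\<forall>w\<in>W. \<phi> w = 0)"
proof -
  obtain B where B: "independent B" "span B = W"
    using basis_subspace_exists[OF W] by metis
  have "independent (insert e B)"
    using B e by (simp add: independent_insertI)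
  then obtain \<phi> where \<phi>: "linform \<phi>" "\<forall>b\<in>insert e B. \<phi> b = (if b = e then 1 else 0)"
    using linform_on_basis[of "insert e B" "\<lambda>b. if b = e then 1 else 0"] by blast
  have "e \<notin> B" using B e span_base by blast
  have "\<phi> w = 0" if "w \<in> W" for w
  proof (rule linform_eq_on_span[of w B \<phi> "\<lambda>_. 0"])
    show "w \<in> span B" using that B by simp
    show "\<phi> b = 0" if "b \<in> B" for b
      using \<phi>(2) that \<open>e \<notin> B\<close> by auto
  qed (auto intro: \<phi> linformI)
  then show ?thesis using \<phi> by auto
qed

text \<open>The functional is \<open>\<phi>\<close> composed with a linear section of
  \<open>f\<close> over its range; two preimages of a point differ by an element of the kernel,
  where \<open>\<phi>\<close> vanishes.\<close>

lemma linform_factor: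
  assumes f: "lin f" and \<phi>: "linform \<phi>" and ker: "\<And>z. f z = 0 \<Longrightarrow> \<phi> z = 0"
  shows "\<exists>\<psi>. linform \<psi> \<and> (\<forall>z. \<psi> (f z) = \<phi> z)"
proof -
  interpret vector_space_pair scale scale ..
  have sr: "subspace (range f)"
    using f by (intro linear_subspace_image subspace_UNIV)
  obtain B where B: "independent B" "span B = range f" "B \<subseteq> range f"
    using basis_subspace_exists[OF sr] by metis
  define s where "s b = (SOME z. f z = b)" for b
  have s: "f (s b) = b" if "b \<in> B" for b
    using B(3) that unfolding s_def by (metis (mono_tags, lifting) imageE someI subsetD)
  obtain g where g: "lin g" "\<And>b. b \<in> B \<Longrightarrow> g b = s b"
    using lin_on_basis[OF B(1), of s] by auto
  have fg: "f (g y) = y" if "y \<in> range f" for y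
    by (rule lin_eq_on_span[of y B "\<lambda>y. f (g y)" "\<lambda>y. y"])
      (use that B g s f in \<open>auto intro: lin_intros\<close>)
  have "\<phi> (g (f z)) = \<phi> z" for z
  proof -
    have "f (g (f z) - z) = 0" using fg by (simp add: lin_diff f)
    then have "\<phi> (g (f z) - z) = 0" by (rule ker)
    then show ?thesis
      by (metis \<phi> linform_add add.commute add_0 diff_add_cancel)
  qed
  moreover have "linform (\<lambda>y. \<phi> (g y))"
    by (intro linformI) (simp_all add: g \<phi> lin_add lin_scale linform_add linform_scale)
  ultimately show ?thesis by blast
qed

lemma inj_on_subspace_surj:
  assumes f: "lin f" and S: "subspace S" "\<And>x. x \<in> S \<Longrightarrow> f x \<in> S"
    and inj: "\<And>x. x \<in> S \<Longrightarrow> f x = 0 \<Longrightarrow> x = 0"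
  shows "f ` S = S"
proof -
  interpret finite_dimensional_vector_space_pair_1 scale Basis scale ..
  have "inj_on f (span S)"
  proof (rule inj_onI)
    fix x y assume "x \<in> span S" "y \<in> span S" "f x = f y"
    then show "x = y"
      using inj[of "x - y"] S(1) by (metis f lin_diff eq_iff_diff_eq_0 span_eq_iff subspace_diff)
  qed
  then have "dim (f ` S) = dim S"
    by (rule dim_image_eq[OF f])
  moreover have "subspace (f ` S)"
    using f S(1) by (rule linear_subspace_image)
  ultimately show ?thesis
    using S by (intro subspace_dim_equal) auto
qed

text \<open>\<open>F\<close> turns the values of \<open>\<beta> z\<close> on a basis of
  \<open>S\<close> into coordinates; nondegeneracy makes it injective on \<open>S\<close>, hence
  onto. The version for a subspace serves the Killing form on a complement of its radical.\<close>

lemma form_represents: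
  assumes lin1: "\<And>y. linform (\<lambda>x. \<beta> x y)" and lin2: "\<And>x. linform (\<beta> x)"
    and S: "subspace S" and nd: "\<And>z. z \<in> S \<Longrightarrow> (\<And>y. y \<in> S \<Longrightarrow> \<beta> z y = 0) \<Longrightarrow> z = 0"
    and \<phi>: "linform \<phi>"
  shows "\<exists>z\<in>S. \<forall>y\<in>S. \<beta> z y = \<phi> y"
proof -
  obtain B where B: "finite B" "B \<subseteq> S" "independent B" "span B = S"
    using basis_subspace_exists[OF S] by metis
  define F where "F z = (\<Sum>b\<in>B. \<beta> z b \<cdot> b)" for z
  have "lin F"
    unfolding F_def
    by (intro linI)
      (simp_all add: linform_add[OF lin1] linform_scale[OF lin1] scale_left_distrib sum.distrib scale_sum_right)
  have coeff: "c b = d b" if "(\<Sum>b\<in>B. c b \<cdot> b) = (\<Sum>b\<in>B. d b \<cdot> b)" "b \<in> B" for c d b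
  proof -
    have "(\<Sum>b\<in>B. (c b - d b) \<cdot> b) = 0"
      using that by (simp add: scale_left_diff_distrib sum_subtractf)
    then show ?thesis
      using independentD[OF B(3,1) subset_refl, of "\<lambda>b. c b - d b" b] that(2) by simp
  qed
  have ext: "\<beta> z y = \<psi> y" if "linform \<psi>" "\<And>b. b \<in> B \<Longrightarrow> \<beta> z b = \<psi> b" "y \<in> S" for z y \<psi>
    by (rule linform_eq_on_span[of y B "\<beta> z" \<psi>]) (use that lin2 B in auto)
  have "F ` S = S"
  proof (rule inj_on_subspace_surj)
    fix x assume "x \<in> S" and F0: "F x = 0"
    have "\<beta> x b = 0" if "b \<in> B" for b
      using independentD[OF B(3,1) subset_refl, of "\<beta> x" b] that F0 by (simp add: F_def)
    then have "\<beta> x y = 0" if "y \<in> S" for y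
      using ext[of "\<lambda>_. 0" x y] that by (simp add: linformI)
    then show "x = 0" using nd \<open>x \<in> S\<close> by blast
  next
    show "F x \<in> S" for x
      unfolding F_def using B(2) S by (intro subspace_sum) (auto intro: subspace_scale)
  qed (fact \<open>lin F\<close> S)+
  moreover have "(\<Sum>b\<in>B. \<phi> b \<cdot> b) \<in> S"
    using B(2) S by (intro subspace_sum) (auto intro: subspace_scale)
  ultimately obtain z where z: "z \<in> S" "F z = (\<Sum>b\<in>B. \<phi> b \<cdot> b)"
    by (metis imageE)
  then have "\<beta> z b = \<phi> b" if "b \<in> B" for b
    using coeff[of "\<beta> z" \<phi> b] that by (simp add: F_def)
  then show ?thesis using z ext[OF \<phi>] by blast
qed

section \<open>Traces, filtrations and nilpotent operators\<close>

definition trace :: "('b \<Rightarrow> 'b) \<Rightarrow> 'a" where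
  "trace f = (\<Sum>b\<in>Basis. representation Basis (f b) b)"

lemma trace_basis:
  assumes f: "lin f" and C: "independent C" "span C = UNIV"
  shows "trace f = (\<Sum>c\<in>C. representation C (f c) c)"
proof -
  have finC: "finite C" using C finiteI_independent by blast
  have 1: "representation Basis (f b) b = (\<Sum>c\<in>C. representation C b c * representation Basis (f c) b)" for b
  proof -
    have "f b = f (\<Sum>c\<in>C. representation C b c \<cdot> c)"
      using C finC by (subst sum_representation_eq) auto
    then show ?thesis
      using independent_Basis span_Basis
      by (simp add: lin_sum[OF f] lin_scale[OF f] representation_sum representation_scale)
  qed
  have 2: "representation C (f c) c = (\<Sum>b\<in>Basis. representation Basis (f c) b * representation C b c)" for c
  proof -
    have "f c = (\<Sum>b\<in>Basis. representation Basis (f c) b \<cdot> b)"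
      using independent_Basis span_Basis finite_Basis by (subst sum_representation_eq) auto
    then have "representation C (f c) c = representation C (\<Sum>b\<in>Basis. representation Basis (f c) b \<cdot> b) c"
      by simp
    then show ?thesis
      using C by (simp add: representation_sum representation_scale)
  qed
  show ?thesis
    unfolding trace_def 1 2
    by (subst sum.swap) (simp add: mult.commute)
qed

lemma trace_add: "trace (\<lambda>x. f x + g x) = trace f + trace g"
  by (simp add: trace_def representation_add independent_Basis span_Basis sum.distrib)

lemma trace_scale: "trace (\<lambda>x. c \<cdot> f x) = c * trace f"
  by (simp add: trace_def representation_scale independent_Basis span_Basis sum_distrib_left)

lemma trace_0: "trace (\<lambda>x. 0) = 0"
  by (simp add: trace_def representation_zero)

lemma trace_diff: "trace (\<lambda>x. f x - g x) = trace f - trace g"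
  by (simp add: trace_def representation_diff independent_Basis span_Basis sum_subtractf)

lemma trace_sum: "trace (\<lambda>x. \<Sum>i\<in>I. f i x) = (\<Sum>i\<in>I. trace (f i))"
  by (induction I rule: infinite_finite_induct) (simp_all add: trace_0 trace_add)

lemma trace_commute:
  assumes f: "lin f" and g: "lin g"
  shows "trace (\<lambda>x. f (g x)) = trace (\<lambda>x. g (f x))"
proof -
  have rep: "representation Basis (f (g b)) b
    = (\<Sum>c\<in>Basis. representation Basis (g b) c * representation Basis (f c) b)"
    if "lin f" for f g and b :: 'b
  proof -
    have "f (g b) = f (\<Sum>c\<in>Basis. representation Basis (g b) c \<cdot> c)"
      using finite_Basis independent_Basis span_Basis by (subst sum_representation_eq) auto
    then show ?thesis
      using independent_Basis span_Basis
      by (simp add: lin_sum[OF that] lin_scale[OF that] representation_sum representation_scale)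
  qed
  have tr: "trace (\<lambda>x. f (g x))
    = (\<Sum>b\<in>Basis. \<Sum>c\<in>Basis. representation Basis (g b) c * representation Basis (f c) b)"
    if "lin f" for f g
    unfolding trace_def using that by (intro sum.cong refl rep)
  show ?thesis
    unfolding tr[OF f, of g] tr[OF g, of f]
    by (subst sum.swap) (simp add: mult.commute)
qed

text \<open>\<open>l b\<close> is the last level that contains \<open>b\<close>. The induction
  hypothesis is applied to the filtration shifted by one; the vectors that extend its basis to
  \<open>F 0\<close> get level 0.\<close>

lemma adapted_basis:
  assumes "\<And>i. subspace (F i)" "\<And>i. F (Suc i) \<subseteq> F i" "F n = {0}"
  shows "\<exists>B (l :: 'b \<Rightarrow> nat). independent B \<and> (\<forall>i. F i = span {b\<in>B. i \<le> l b})"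
  using assms
proof (induction n arbitrary: F)
  case 0
  have "F i \<subseteq> F 0" for i
    by (rule lift_Suc_antimono_le) (use 0 in auto)
  then have "F i = {0}" for i
    using 0 by (metis subset_singletonD subspace_0 empty_iff)
  then show ?case using independent_empty by (intro exI[of _ "{}"]) simp
next
  case (Suc n)
  obtain B' l' where B': "independent B'" "\<And>i. F (Suc i) = span {b\<in>B'. i \<le> (l' b :: nat)}"
    using Suc.IH[of "\<lambda>i. F (Suc i)"] Suc.prems by blast
  have s1: "F 1 = span B'" using B'(2)[of 0] by simp
  then have "B' \<subseteq> F 0"
    using Suc.prems(2)[of 0] span_superset by auto
  then obtain B where B: "B' \<subseteq> B" "B \<subseteq> F 0" "independent B" "F 0 \<subseteq> span B"
    using maximal_independent_subset_extend[of B' "F 0"] B'(1) by blast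
  define l where "l b = (if b \<in> B' then Suc (l' b) else 0)" for b
  have "{b\<in>B. Suc i \<le> l b} = {b\<in>B'. i \<le> l' b}" for i
    using B(1) by (auto simp: l_def)
  moreover have "F 0 = span B"
    using B Suc.prems(1) span_minimal by blast
  ultimately have "F i = span {b\<in>B. i \<le> l b}" for i
    using B'(2) by (cases i) auto
  then show ?case using B(3) by blast
qed

text \<open>Splitting of a filtration: \<open>P i\<close> projects onto a complement of \<open>F (Suc i)\<close> in \<open>F i\<close>.\<close>

lemma filtration_splitting:
  assumes "\<And>i. subspace (F i)" "\<And>i. F (Suc i) \<subseteq> F i" "F n = {0}" "F 0 = UNIV"
  shows "\<exists>P. (\<forall>i. lin (P i)) \<and> (\<forall>v. (\<Sum>i<n. P i v) = v) \<and> (\<forall>i j v. P i (P j v) = (if i = j then P i v else 0))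
    \<and> (\<forall>i v. P i v \<in> F i) \<and> (\<forall>i v. v \<in> F i \<longrightarrow> v - P i v \<in> F (Suc i)) \<and> (\<forall>i j v. i < j \<longrightarrow> v \<in> F j \<longrightarrow> P i v = 0)"
proof -
  obtain B :: "'b set" and l :: "'b \<Rightarrow> nat" where B: "independent B" and F: "\<And>i. F i = span {b\<in>B. i \<le> l b}"
    using adapted_basis[of F n] assms by blast
  have spB: "span B = UNIV" using F[of 0] assms(4) by simp
  have "\<exists>g. lin g \<and> (\<forall>b\<in>B. g b = (if l b = i then b else 0))" for i
    by (rule lin_on_basis[OF B])
  then obtain P where P: "\<And>i. lin (P i)" "\<And>i b. b \<in> B \<Longrightarrow> P i b = (if l b = i then b else 0)"
    by metis
  have ext: "f v = g v" if "lin f" "lin g" "\<And>b. b \<in> B \<Longrightarrow> f b = g b" for f g v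
    using lin_eq_on_span[of v B f g] that spB by auto
  have ln: "l b < n" if "b \<in> B" for b
  proof (rule ccontr)
    assume "\<not> l b < n"
    then have "b \<in> F n" using that F by (auto intro: span_base)
    then have "b = 0" using assms(3) by auto
    then show False using that B dependent_zero[of B] by simp
  qed
  have P0: "P i 0 = 0" for i using P(1) lin_0 by blast
  have 1: "(\<Sum>i<n. P i v) = v" for v
    by (rule ext[of "\<lambda>v. \<Sum>i<n. P i v" "\<lambda>v. v"])
      (simp_all add: lin_setsum P(1) lin_ident P(2) ln sum.delta)
  have 2: "P i (P j v) = (if i = j then P i v else 0)" for i j v
  proof (rule ext[of "\<lambda>v. P i (P j v)" "\<lambda>v. if i = j then P i v else 0"])
    show "lin (\<lambda>v. if i = j then P i v else 0)"
      by (cases "i = j") (simp_all add: P(1) lin_zero)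
  qed (simp_all add: lin_comp[OF P(1) P(1)] P P0)
  have 3: "P i v \<in> F i" for i v
    by (rule span_lin_image[of v B "P i"])
      (auto simp: P spB assms(1) F span_zero intro: span_base)
  have 4: "v - P i v \<in> F (Suc i)" if "v \<in> F i" for i v
    by (rule span_lin_image[of v "{b\<in>B. i \<le> l b}" "\<lambda>v. v - P i v"])
      (use that in \<open>auto simp: P assms(1) F span_zero intro!: lin_minus lin_ident span_base\<close>)
  have 5: "P i v = 0" if "i < j" "v \<in> F j" for i j v
  proof -
    have "P i v \<in> {0}"
      by (rule span_lin_image[of v "{b\<in>B. j \<le> l b}" "P i"]) (use that F P in auto)
    then show ?thesis by simp
  qed
  show ?thesis
    using P(1) 1 2 3 4 5 by (intro exI[of _ P]) blast
qed

text \<open>In an adapted basis \<open>f b\<close> involves only vectors of level above that of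
  \<open>b\<close>, so the diagonal is zero.\<close>

lemma trace_strictly_filtered:
  assumes "\<And>i. subspace (F i)" "\<And>i. F (Suc i) \<subseteq> F i" "F n = {0}" "F 0 = UNIV"
    and f: "lin f" "\<And>i v. v \<in> F i \<Longrightarrow> f v \<in> F (Suc i)"
  shows "trace f = 0"
proof -
  obtain B :: "'b set" and l :: "'b \<Rightarrow> nat" where B: "independent B" and F: "\<And>i. F i = span {b\<in>B. i \<le> l b}"
    using adapted_basis[of F n] assms(1-3) by blast
  have spB: "span B = UNIV" using F[of 0] assms(4) by simp
  have "representation B (f b) b = 0" if "b \<in> B" for b
  proof -
    let ?C = "{c\<in>B. Suc (l b) \<le> l c}"
    have "b \<in> F (l b)" using that F by (auto intro: span_base)
    then have "f b \<in> span ?C" using f(2) F by blast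
    then have "representation B (f b) = representation ?C (f b)"
      by (intro representation_extend) (use B in auto)
    moreover have "representation ?C (f b) b = 0"
      using representation_ne_zero[of ?C "f b" b] by auto
    ultimately show ?thesis by simp
  qed
  then show ?thesis using trace_basis[OF f(1) B spB] by simp
qed

lemma funpow_lin_0: "lin f \<Longrightarrow> (f ^^ k) 0 = 0"
  by (simp add: lin_0 lin_funpow)

lemma subspace_ker: "lin f \<Longrightarrow> subspace {v. f v = 0}"
  by (intro subspaceI) (simp_all add: lin_0 lin_add lin_scale)

lemma trace_nilpotent:
  assumes f: "lin f" and n: "\<And>v. (f ^^ n) v = 0"
  shows "trace f = 0"
\<comment> \<open>From index \<open>n\<close> on, truncated subtraction makes this the kernel of the
  identity, so the filtration stays at zero.\<close>
proof (rule trace_strictly_filtered[of "\<lambda>i. {v. (f ^^ (n - i)) v = 0}" n])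
  show "subspace {v. (f ^^ (n - i)) v = 0}" for i
    by (intro subspace_ker lin_funpow f)
  have step: "(f ^^ (n - Suc i)) (f v) = 0" if v: "(f ^^ (n - i)) v = 0" for i v
  proof (cases "i < n")
    case True
    then show ?thesis
      using v by (metis Suc_diff_Suc comp_apply funpow_Suc_right)
  next
    case False
    then show ?thesis using v by (simp add: f lin_0)
  qed
  then show "f v \<in> {v. (f ^^ (n - Suc i)) v = 0}" if "v \<in> {v. (f ^^ (n - i)) v = 0}" for i v
    using that by simp
  show "{v. (f ^^ (n - Suc i)) v = 0} \<subseteq> {v. (f ^^ (n - i)) v = 0}" for i
  proof (cases "i < n")
    case True
    then have "(f ^^ (n - i)) v = f ((f ^^ (n - Suc i)) v)" for v
      by (metis Suc_diff_Suc comp_apply funpow.simps(2))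
    then show ?thesis by (auto simp: f lin_0)
  qed simp
qed (use f n in auto)

lemma funpow_invariant: "(\<And>x. x \<in> U \<Longrightarrow> f x \<in> U) \<Longrightarrow> x \<in> U \<Longrightarrow> (f ^^ k) x \<in> U"
  by (induction k) simp_all

lemma subspace_eventually_in:
  assumes f: "lin f" and U: "subspace U" "\<And>x. x \<in> U \<Longrightarrow> f x \<in> U"
  shows "subspace {v. \<exists>k. (f ^^ k) v \<in> U}"
proof (rule subspaceI)
  show "0 \<in> {v. \<exists>k. (f ^^ k) v \<in> U}" using U by (auto simp: funpow_lin_0 f subspace_0)
next
  fix x y assume "x \<in> {v. \<exists>k. (f ^^ k) v \<in> U}" "y \<in> {v. \<exists>k. (f ^^ k) v \<in> U}"
  then obtain m n where mn: "(f ^^ m) x \<in> U" "(f ^^ n) y \<in> U" by auto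
  have "(f ^^ (n + m)) x \<in> U" "(f ^^ (m + n)) y \<in> U"
    using funpow_invariant[of U f, OF U(2) mn(1), of n] funpow_invariant[of U f, OF U(2) mn(2), of m]
    by (simp_all add: funpow_add)
  then have "(f ^^ (m + n)) x \<in> U" "(f ^^ (m + n)) y \<in> U"
    by (simp_all add: add.commute)
  then have "(f ^^ (m + n)) (x + y) \<in> U"
    using U by (simp add: lin_add lin_funpow f subspace_add)
  then show "x + y \<in> {v. \<exists>k. (f ^^ k) v \<in> U}" by blast
next
  fix c x assume "x \<in> {v. \<exists>k. (f ^^ k) v \<in> U}"
  then obtain m where "(f ^^ m) x \<in> U" by auto
  then have "(f ^^ m) (c \<cdot> x) \<in> U"
    using U by (simp add: lin_scale lin_funpow f subspace_scale)
  then show "c \<cdot> x \<in> {v. \<exists>k. (f ^^ k) v \<in> U}" by blast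
qed

lemma eventually_in_uniform:
  assumes f: "lin f" and U: "subspace U" "\<And>x. x \<in> U \<Longrightarrow> f x \<in> U" and T: "subspace T"
    and k: "\<And>v. v \<in> T \<Longrightarrow> \<exists>k. (f ^^ k) v \<in> U"
  shows "\<exists>k. \<forall>v\<in>T. (f ^^ k) v \<in> U"
proof -
  obtain B where B: "finite B" "B \<subseteq> T" "span B = T"
    using basis_subspace_exists[OF T] by metis
  obtain k where k: "\<And>v. v \<in> T \<Longrightarrow> (f ^^ k v) v \<in> U" using k by metis
  define N where "N = Max (k ` B \<union> {0})"
  have "(f ^^ N) b \<in> U" if "b \<in> B" for b
  proof -
    have "k b \<le> N" unfolding N_def using that B by (intro Max_ge) auto
    then have "(f ^^ N) b = (f ^^ (N - k b)) ((f ^^ k b) b)"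
      by (metis comp_apply funpow_add le_add_diff_inverse2)
    then show ?thesis using funpow_invariant[of U f, OF U(2)] k B that by auto
  qed
  then have "(f ^^ N) v \<in> U" if "v \<in> T" for v
    using span_lin_image[of v B "f ^^ N" U] that B U lin_funpow[OF f] by auto
  then show ?thesis by blast
qed

lemma nilpotent_uniform:
  assumes "lin f" "\<And>v. \<exists>k. (f ^^ k) v = 0"
  shows "\<exists>k. \<forall>v. (f ^^ k) v = 0"
  using eventually_in_uniform[of f "{0}" UNIV] assms by (simp add: lin_0)

lemma subspace_complement:
  assumes J: "subspace J" and p: "subspace p" and Jp: "J \<subseteq> p"
  shows "\<exists>C. subspace C \<and> C \<subseteq> p \<and> C \<inter> J = {0} \<and> (\<forall>y\<in>p. \<exists>j\<in>J. y - j \<in> C)"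
proof -
  obtain A where A: "independent A" "span A = J" "A \<subseteq> J"
    using basis_subspace_exists[OF J] by metis
  have "A \<subseteq> p" using A(3) Jp by blast
  then obtain B where B: "A \<subseteq> B" "B \<subseteq> p" "independent B" "p \<subseteq> span B"
    using maximal_independent_subset_extend[of A p] A(1) by metis
  obtain g where g: "lin g" "\<forall>b\<in>B. g b = (if b \<in> A then b else 0)"
    using lin_on_basis[OF B(3), of "\<lambda>b. if b \<in> A then b else 0"] by blast
  have gJ: "g y = y" if "y \<in> J" for y
    by (rule lin_eq_on_span[of y A g "\<lambda>y. y"]) (use that A B g lin_ident in auto)
  have gp: "g y \<in> J" if "y \<in> p" for y
    by (rule span_lin_image[of y B g J]) (use that A B g J in \<open>auto simp: subspace_0\<close>)
  have "subspace {y. g y = 0}" by (rule subspace_ker[OF g(1)])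
  then have "subspace ({y. g y = 0} \<inter> p)" using p by (rule subspace_inter)
  moreover have "({y. g y = 0} \<inter> p) \<inter> J = {0}"
    using gJ subspace_0[OF J] Jp by (auto simp: lin_0 g)
  moreover have "y - g y \<in> {y. g y = 0} \<inter> p" if "y \<in> p" for y
    using that gp[OF that] gJ Jp p by (auto simp: lin_diff g intro: subspace_diff)
  ultimately show ?thesis
    using gp by (intro exI[of _ "{y. g y = 0} \<inter> p"]) auto
qed

lemma trace_idempotent:
  assumes f: "lin f" and idem: "\<And>v. f (f v) = f v"
  shows "trace f = of_nat (dim (range f))"
proof -
  interpret vector_space_pair scale scale ..
  have sr: "subspace (range f)"
    using f by (intro linear_subspace_image subspace_UNIV)
  obtain B where B: "independent B" "span B = range f" "B \<subseteq> range f" "card B = dim (range f)"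
    using basis_subspace_exists[OF sr] by metis
  obtain C where C: "B \<subseteq> C" "independent C" "span C = UNIV"
    by (rule maximal_independent_subset_extend[OF subset_UNIV B(1)]) auto
  have "finite C" using C(2) by (rule finiteI_independent)
  have "representation C (f c) c = (if c \<in> B then 1 else 0)" if "c \<in> C" for c
  proof (cases "c \<in> B")
    case True
    then have "f c = c" using B(3) idem by auto
    then show ?thesis using True that C representation_basis by auto
  next
    case False
    have "f c \<in> span B" using B by auto
    then have "representation C (f c) = representation B (f c)"
      by (intro representation_extend) (use C in auto)
    moreover have "representation B (f c) c = 0"
      using representation_ne_zero[of B "f c" c] False by auto
    ultimately show ?thesis using False by simp
  qed
  then have "trace f = (\<Sum>c\<in>C. if c \<in> B then 1 else 0)"
    using trace_basis[OF f C(2,3)] by simp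
  also have "\<dots> = of_nat (card B)"
    using \<open>finite C\<close> C(1) by (simp add: sum.If_cases Int_absorb1)
  finally show ?thesis using B by simp
qed

text \<open>\<open>\<Phi>\<close> and \<open>\<Psi>\<close> identify the space with its dual by
  means of the form. Conjugated by them, \<open>g\<close> becomes the transpose of \<open>f\<close>
  and has the same diagonal entries.\<close>

lemma trace_adjoint:
  assumes lin1: "\<And>y. linform (\<lambda>x. \<beta> x y)" and lin2: "\<And>x. linform (\<beta> x)"
    and nd: "\<And>z. (\<And>y. \<beta> z y = 0) \<Longrightarrow> z = 0"
    and f: "lin f" and g: "lin g" and adj: "\<And>y z. \<beta> (g y) z = \<beta> y (f z)"
  shows "trace g = trace f"
proof -
  have B: "independent Basis" "span Basis = UNIV" "finite Basis"
    using independent_Basis span_Basis finite_Basis by auto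
  have lin_rep: "linform (\<lambda>y. representation Basis y b)" for b
    using B by (intro linformI) (simp_all add: representation_add representation_scale)
  have "\<exists>z. \<forall>y. \<beta> z y = representation Basis y b" for b
    using form_represents[OF lin1 lin2 subspace_UNIV _ lin_rep, of b] nd by auto
  then obtain d where d: "\<And>b y. \<beta> (d b) y = representation Basis y b" by metis
  obtain \<Psi> where \<Psi>: "lin \<Psi>" "\<And>b. b \<in> Basis \<Longrightarrow> \<Psi> b = d b"
    using lin_on_basis[OF B(1), of d] by auto
  define \<Phi> where "\<Phi> v = (\<Sum>b\<in>Basis. \<beta> v b \<cdot> b)" for v
  have \<Phi>: "lin \<Phi>"
    unfolding \<Phi>_def
    by (intro linI)
      (simp_all add: linform_add[OF lin1] linform_scale[OF lin1] scale_left_distrib sum.distrib scale_sum_right)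
  have eqI: "u = v" if "\<And>c. c \<in> Basis \<Longrightarrow> \<beta> u c = \<beta> v c" for u v
  proof -
    have "\<beta> (u - v) y = 0" for y
    proof (rule linform_eq_on_span[of y Basis "\<beta> (u - v)" "\<lambda>_. 0"])
      show "\<beta> (u - v) b = 0" if "b \<in> Basis" for b
        using linform_add[OF lin1, of "u - v" v b] \<open>\<And>c. c \<in> Basis \<Longrightarrow> \<beta> u c = \<beta> v c\<close>[OF that] by simp
    qed (use lin2 B in \<open>auto intro: linformI\<close>)
    then show ?thesis using nd[of "u - v"] by simp
  qed
  have rep_basis: "representation Basis b c = (if b = c then 1 else 0)" if "b \<in> Basis" for b c
    using representation_basis[OF B(1) that] by auto
  have "\<Psi> (\<Phi> v) = v" for v
  proof (rule eqI)
    fix c assume c: "c \<in> Basis"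
    have "\<Psi> (\<Phi> v) = (\<Sum>b\<in>Basis. \<beta> v b \<cdot> d b)"
      by (simp add: \<Phi>_def lin_sum[OF \<Psi>(1)] lin_scale[OF \<Psi>(1)] \<Psi>(2))
    then have "\<beta> (\<Psi> (\<Phi> v)) c = (\<Sum>b\<in>Basis. \<beta> v b * (if c = b then 1 else 0))"
      by (simp add: linform_sum[OF lin1] linform_scale[OF lin1] d rep_basis[OF c])
    also have "\<dots> = \<beta> v c" using c B(3) by (simp add: if_distrib cong: if_cong)
    finally show "\<beta> (\<Psi> (\<Phi> v)) c = \<beta> v c" .
  qed
  then have "trace g = trace (\<lambda>x. \<Psi> (\<Phi> (g x)))" by simp
  also have "\<dots> = trace (\<lambda>x. \<Phi> (g (\<Psi> x)))"
    using trace_commute[OF \<Psi>(1) lin_comp[OF \<Phi> g]] .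
  also have "\<dots> = trace f"
    unfolding trace_def
  proof (rule sum.cong[OF refl])
    fix c assume c: "c \<in> Basis"
    have "representation Basis (\<Phi> u) c = \<beta> u c" for u
      using B c by (simp add: \<Phi>_def representation_sum representation_scale span_base rep_basis if_distrib cong: if_cong)
    then show "representation Basis (\<Phi> (g (\<Psi> c))) c = representation Basis (f c) c"
      by (simp add: adj \<Psi>(2)[OF c] d)
  qed
  finally show ?thesis .
qed

end

section \<open>Generalized eigenspaces\<close>

locale complex_space = fin_dim_space scale Basis
  for scale :: "complex \<Rightarrow> 'b::ab_group_add \<Rightarrow> 'b" (infixr \<open>\<cdot>\<close> 75) and Basis
begin

section \<open>Polynomials in an operator\<close>

definition opoly :: "('b \<Rightarrow> 'b) \<Rightarrow> complex poly \<Rightarrow> 'b \<Rightarrow> 'b" where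
  "opoly f p v = (\<Sum>i\<le>degree p. coeff p i \<cdot> (f ^^ i) v)"

lemma opoly_bound: "degree p \<le> n \<Longrightarrow> opoly f p v = (\<Sum>i\<le>n. coeff p i \<cdot> (f ^^ i) v)"
  unfolding opoly_def
  by (rule sum.mono_neutral_left) (auto simp: coeff_eq_0)

lemma opoly_0 [simp]: "opoly f 0 v = 0"
  by (simp add: opoly_def)

lemma opoly_add: "opoly f (p + q) v = opoly f p v + opoly f q v"
proof -
  let ?n = "max (degree p) (degree q)"
  have "degree (p + q) \<le> ?n" by (rule degree_add_le_max)
  then show ?thesis
    by (simp add: opoly_bound[of _ ?n] scale_left_distrib sum.distrib)
qed

lemma opoly_smult: "opoly f (smult c p) v = c \<cdot> opoly f p v"
  using degree_smult_le[of c p]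
  by (simp add: opoly_bound[of _ "degree p"] scale_sum_right)

lemma opoly_diff: "opoly f (p - q) v = opoly f p v - opoly f q v"
  using opoly_add[of f "p - q" q v] by simp

lemma opoly_sum: "opoly f (\<Sum>i\<in>I. p i) v = (\<Sum>i\<in>I. opoly f (p i) v)"
  by (induction I rule: infinite_finite_induct) (simp_all add: opoly_add)

lemma opoly_pCons:
  assumes f: "lin f"
  shows "opoly f (pCons a p) v = a \<cdot> v + f (opoly f p v)"
proof -
  have "opoly f (pCons a p) v = (\<Sum>i\<le>Suc (degree p). coeff (pCons a p) i \<cdot> (f ^^ i) v)"
    by (rule opoly_bound) (rule degree_pCons_le)
  also have "\<dots> = a \<cdot> v + (\<Sum>i\<le>degree p. coeff p i \<cdot> (f ^^ Suc i) v)"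
    by (simp add: sum.atMost_Suc_shift del: sum.atMost_Suc)
  also have "\<dots> = a \<cdot> v + f (opoly f p v)"
    by (simp add: opoly_def lin_sum[OF f] lin_scale[OF f])
  finally show ?thesis .
qed

lemma opoly_1 [simp]: "opoly f 1 v = v"
  by (simp add: opoly_def)

lemma lin_opoly: "lin f \<Longrightarrow> lin (opoly f p)"
  unfolding opoly_def by (intro lin_setsum lin_smult lin_funpow)

lemma opoly_mult: "lin f \<Longrightarrow> opoly f (p * q) v = opoly f p (opoly f q v)"
proof (induction p)
  case (pCons a p)
  then show ?case
    by (simp add: mult_pCons_left opoly_add opoly_smult opoly_pCons)
qed simp

lemma opoly_monom: "lin f \<Longrightarrow> opoly f (monom c k) v = c \<cdot> (f ^^ k) v"
  by (induction k) (simp_all add: monom_0 monom_Suc opoly_pCons lin_scale lin_0)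

lemma span_image_coeffs:
  assumes "x \<in> span (g ` A)" "finite A"
  shows "\<exists>u. x = (\<Sum>i\<in>A. u i \<cdot> g i)"
  using assms(1)
proof (induction rule: span_induct_alt)
  case base
  then show ?case by (intro exI[of _ "\<lambda>_. 0"]) simp
next
  case (step c x y)
  then obtain i u where i: "i \<in> A" "x = g i" and u: "y = (\<Sum>i\<in>A. u i \<cdot> g i)" by blast
  have "(\<Sum>j\<in>A. (u j + (if j = i then c else 0)) \<cdot> g j) = y + (\<Sum>j\<in>A. if j = i then c \<cdot> g j else 0)"
    unfolding u sum.distrib[symmetric]
    by (intro sum.cong refl) (auto simp: scale_left_distrib)
  also have "\<dots> = c \<cdot> x + y"
    using i assms(2) by (simp add: sum.delta)
  finally show ?case by metis
qed

text \<open>The iterates of \<open>v\<close> cannot stay independent beyond the dimension; a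
  dependence on earlier iterates gives a monic polynomial.\<close>

lemma vector_annihilator:
  assumes f: "lin f"
  shows "\<exists>p. p \<noteq> 0 \<and> opoly f p v = 0"
proof -
  let ?S = "\<lambda>k. (\<lambda>i. (f ^^ i) v) ` {..<k}"
  have "\<exists>k. (f ^^ k) v \<in> span (?S k)"
  proof (rule ccontr)
    assume no: "\<nexists>k. (f ^^ k) v \<in> span (?S k)"
    have "independent (?S k) \<and> card (?S k) = k" for k
    proof (induction k)
      case (Suc k)
      have ins: "?S (Suc k) = insert ((f ^^ k) v) (?S k)"
        by (simp add: lessThan_Suc)
      have "(f ^^ k) v \<notin> ?S k" using no span_base[of "(f ^^ k) v" "?S k"] by metis
      then show ?case
        unfolding ins using Suc no by (simp add: independent_insertI)
    qed (simp add: independent_empty)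
    then have "k \<le> dimension" for k
      by (metis independent_card_le_dim subset_UNIV dim_UNIV dimension_def)
    then show False using not_less_eq_eq by blast
  qed
  then obtain k where "(f ^^ k) v \<in> span (?S k)" by blast
  then obtain u where u: "(f ^^ k) v = (\<Sum>i<k. u i \<cdot> (f ^^ i) v)"
    using span_image_coeffs[of "(f ^^ k) v" "\<lambda>i. (f ^^ i) v" "{..<k}"] by auto
  define p where "p = monom 1 k - (\<Sum>i<k. monom (u i) i)"
  have "coeff p k = 1" by (simp add: p_def coeff_sum)
  then have "p \<noteq> 0" by auto
  moreover have "opoly f p v = 0"
    by (simp add: p_def opoly_diff opoly_sum opoly_monom f u)
  ultimately show ?thesis by blast
qed

text \<open>Polynomials in \<open>f\<close> commute, so the product of annihilators of the basis
  vectors kills each of them.\<close>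

lemma annihilator:
  assumes f: "lin f"
  shows "\<exists>p. p \<noteq> 0 \<and> (\<forall>v. opoly f p v = 0)"
proof -
  obtain q where q: "\<And>v. q v \<noteq> 0" "\<And>v. opoly f (q v) v = 0"
    using vector_annihilator[OF f] by metis
  define p where "p = (\<Prod>b\<in>Basis. q b)"
  have "opoly f p b = 0" if "b \<in> Basis" for b
  proof -
    have "p = (\<Prod>b\<in>Basis - {b}. q b) * q b"
      unfolding p_def using that finite_Basis by (simp add: prod.remove mult.commute)
    then show ?thesis
      using q(2)[of b] f lin_opoly[OF f] by (simp add: opoly_mult lin_0)
  qed
  then have "opoly f p v = 0" for v
    using lin_eq_on_span[of v Basis "opoly f p" "\<lambda>_. 0"] lin_opoly[OF f] lin_zero span_Basis by simp
  moreover have "p \<noteq> 0" using q finite_Basis by (simp add: p_def)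
  ultimately show ?thesis by blast
qed

text \<open>
  A polynomial in \<open>f\<close> without constant term is the projection onto the part where \<open>f\<close> is
  invertible; its trace is the dimension of that part.
\<close>

lemma nilpotent_if_power_traces_0:
  assumes f: "lin f" and tr: "\<And>k. trace (f ^^ Suc k) = 0"
  shows "\<exists>n. \<forall>v. (f ^^ n) v = 0"
proof -
  obtain p where p: "p \<noteq> 0" "\<And>v. opoly f p v = 0"
    using annihilator[OF f] by blast
  define m where "m = order 0 p"
  obtain q where q: "p = [:0, 1:] ^ m * q" "\<not> [:0, 1:] dvd q"
    using order_decomp[OF p(1), of 0] by (auto simp: m_def)
  have q0: "poly q 0 \<noteq> 0"
    using q(2) poly_eq_0_iff_dvd[of q 0] by simp
  define q' where "q' = smult (inverse (poly q 0)) q"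
  have "poly (1 - q') 0 = 0" using q0 by (simp add: q'_def)
  then obtain r where r: "1 - q' = [:0, 1:] * r"
    using poly_eq_0_iff_dvd[of "1 - q'" 0] by (auto elim: dvdE)
  have ann: "opoly f ([:0, 1:] ^ m * q' * t) v = 0" for t v
  proof -
    have "[:0, 1:] ^ m * q' * t = smult (inverse (poly q 0)) t * p"
      by (simp add: q'_def q(1) mult_ac)
    then show ?thesis
      by (simp add: opoly_smult opoly_mult f p(2) lin_0[OF lin_opoly[OF f]])
  qed
  \<comment> \<open>\<open>Y\<close> is 0 modulo the \<open>m\<close>-th power of the variable and 1
    modulo \<open>q'\<close>, hence idempotent modulo \<open>p\<close>. The exponent is
    \<open>Suc m\<close> so that the constant term also vanishes when \<open>m = 0\<close>.\<close>
  define Y where "Y = ([:0, 1:] * r) ^ Suc m"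
  define t where "t = (\<Sum>i<Suc m. ([:0, 1:] * r) ^ i)"
  have Y1: "1 - Y = q' * t"
  proof -
    have "q' = 1 - [:0, 1:] * r" using r by (simp add: algebra_simps)
    then show ?thesis
      unfolding Y_def t_def by (metis one_diff_power_eq)
  qed
  have "Y * (1 - Y) = [:0, 1:] ^ m * q' * (t * ([:0, 1:] * r ^ Suc m))"
    unfolding Y1 by (simp only: Y_def power_mult_distrib power_Suc mult_ac)
  then have "opoly f (Y * (1 - Y)) v = 0" for v
    by (simp only: ann)
  then have "opoly f (Y - Y * Y) v = 0" for v
    by (simp add: right_diff_distrib)
  then have idem: "opoly f Y (opoly f Y v) = opoly f Y v" for v
    by (simp add: opoly_diff opoly_mult f)
  define y where "y = r * ([:0, 1:] * r) ^ m"
  have "Y = pCons 0 y" by (simp add: Y_def y_def)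
  then have "opoly f Y v = f (opoly f y v)" for v
    by (simp add: opoly_pCons f)
  then have Yy: "opoly f Y v = (\<Sum>i\<le>degree y. coeff y i \<cdot> (f ^^ Suc i) v)" for v
    by (simp add: opoly_def[of f y] lin_sum lin_scale f)
  have "trace (opoly f Y) = (\<Sum>i\<le>degree y. coeff y i * trace (f ^^ Suc i))"
    unfolding Yy[abs_def] trace_sum trace_scale ..
  then have "trace (opoly f Y) = 0" by (simp add: tr del: funpow.simps)
  then have "dim (range (opoly f Y)) = 0"
    using trace_idempotent[OF lin_opoly[OF f] idem] by (simp del: dim_eq_0)
  then have Y0: "opoly f Y v = 0" for v
    unfolding dim_eq_0 by blast
  \<comment> \<open>Modulo the annihilator the \<open>m\<close>-th power of the variable equals its
    product with \<open>Y\<close>, and \<open>Y\<close> evaluates to zero at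
    \<open>f\<close>.\<close>
  have "(f ^^ m) v = 0" for v
  proof -
    have "[:0, 1:] ^ m * q' * t = [:0, 1:] ^ m - [:0, 1:] ^ m * Y"
      by (simp add: mult.assoc Y1[symmetric] right_diff_distrib)
    then have "opoly f ([:0, 1:] ^ m) v = 0"
      using ann[of t v] by (simp add: opoly_diff opoly_mult f Y0 lin_0[OF lin_opoly[OF f]])
    moreover have "[:0, 1:] ^ m = monom (1::complex) m"
      by (simp add: monom_altdef)
    ultimately show ?thesis by (simp add: opoly_monom f)
  qed
  then show ?thesis by blast
qed

section \<open>Generalized eigenspaces and functions of the semisimple part\<close>

definition shift :: "('b \<Rightarrow> 'b) \<Rightarrow> complex \<Rightarrow> 'b \<Rightarrow> 'b" where
  "shift f c v = f v - c \<cdot> v"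

definition geig :: "('b \<Rightarrow> 'b) \<Rightarrow> complex \<Rightarrow> 'b set" where
  "geig f c = {v. \<exists>n. (shift f c ^^ n) v = 0}"

lemma shift_0: "shift f 0 = f"
  by (simp add: shift_def fun_eq_iff)

lemma lin_shift: "lin f \<Longrightarrow> lin (shift f c)"
  unfolding shift_def by (intro lin_minus lin_smult lin_ident)

lemma lin_shift_funpow: "lin f \<Longrightarrow> lin (shift f c ^^ n)"
  by (intro lin_funpow lin_shift)

lemma shift_funpow_mono: "lin f \<Longrightarrow> (shift f c ^^ n) v = 0 \<Longrightarrow> n \<le> k \<Longrightarrow> (shift f c ^^ k) v = 0"
  by (metis comp_apply funpow_add le_add_diff_inverse2 lin_0 lin_shift_funpow)

lemma subspace_geig:
  assumes f: "lin f"
  shows "subspace (geig f c)"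
proof (rule subspaceI)
  show "0 \<in> geig f c" by (auto simp: geig_def intro: exI[of _ 0])
next
  fix x y assume "x \<in> geig f c" "y \<in> geig f c"
  then obtain m n where "(shift f c ^^ m) x = 0" "(shift f c ^^ n) y = 0"
    by (auto simp: geig_def)
  then have "(shift f c ^^ max m n) x = 0" "(shift f c ^^ max m n) y = 0"
    using shift_funpow_mono[OF f] max.cobounded1 max.cobounded2 by blast+
  then have "(shift f c ^^ max m n) (x + y) = 0"
    by (simp add: lin_add[OF lin_shift_funpow[OF f]])
  then show "x + y \<in> geig f c" unfolding geig_def by blast
next
  fix a x assume "x \<in> geig f c"
  then show "a \<cdot> x \<in> geig f c"
    by (auto simp: geig_def lin_scale[OF lin_shift_funpow[OF f]])
qed

lemma shift_in_geig_iff: "shift f c v \<in> geig f c \<longleftrightarrow> v \<in> geig f c" if f: "lin f"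
proof
  assume "shift f c v \<in> geig f c"
  then obtain n where "(shift f c ^^ Suc n) v = 0"
    by (auto simp: geig_def funpow_Suc_right simp del: funpow.simps)
  then show "v \<in> geig f c" unfolding geig_def by blast
next
  assume "v \<in> geig f c"
  then obtain n where "(shift f c ^^ n) v = 0" by (auto simp: geig_def)
  then have "(shift f c ^^ n) (shift f c v) = 0"
    by (metis f funpow_swap1 lin_0 lin_shift)
  then show "shift f c v \<in> geig f c" unfolding geig_def by blast
qed

text \<open>There \<open>shift f c\<close> is the nonzero scalar \<open>\<mu> - c\<close> plus a
  nilpotent operator. The preimage is a finite geometric series, built by recursion on the
  nilpotency exponent of \<open>u\<close>; every term stays in the invariant subspace
  \<open>W\<close>.\<close>

lemma shift_other_surj:
  assumes f: "lin f" and W: "subspace W" "\<And>x. x \<in> W \<Longrightarrow> f x \<in> W" and ne: "c \<noteq> \<mu>"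
    and u: "u \<in> geig f \<mu>" "u \<in> W"
  shows "\<exists>w\<in>geig f \<mu> \<inter> W. shift f c w = u"
proof -
  obtain n where "(shift f \<mu> ^^ n) u = 0" using u by (auto simp: geig_def)
  then show ?thesis using u(2)
  proof (induction n arbitrary: u)
    case 0
    then show ?case
      using W f by (intro bexI[of _ 0]) (auto simp: subspace_0 subspace_geig lin_0 lin_shift)
  next
    case (Suc n)
    define d where "d = inverse (\<mu> - c)"
    define u' where "u' = d \<cdot> shift f \<mu> u"
    have "shift f \<mu> u \<in> W"
      unfolding shift_def using Suc.prems W by (intro subspace_diff subspace_scale) auto
    then have "u' \<in> W" using W by (simp add: u'_def subspace_scale)
    moreover have "(shift f \<mu> ^^ n) u' = 0"
      using Suc.prems(1) unfolding u'_def
      by (simp add: lin_scale[OF lin_shift_funpow[OF f]] funpow_swap1)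
    ultimately obtain w' where w': "w' \<in> geig f \<mu> \<inter> W" "shift f c w' = u'"
      using Suc.IH by blast
    have "u \<in> geig f \<mu>" using Suc.prems(1) unfolding geig_def by blast
    then have "d \<cdot> u - w' \<in> geig f \<mu> \<inter> W"
      using w' Suc.prems(2) W(1) subspace_geig[OF f] by (auto intro!: subspace_diff subspace_scale)
    moreover have "shift f c (d \<cdot> u - w') = u"
    proof -
      have "shift f c (d \<cdot> u) = d \<cdot> (shift f \<mu> u + (\<mu> - c) \<cdot> u)"
        by (simp add: shift_def lin_scale[OF f] algebra_simps)
      also have "\<dots> = u' + u"
        using ne by (simp add: u'_def d_def scale_right_distrib)
      finally show ?thesis using w'(2) by (simp add: lin_diff lin_shift f)
    qed
    ultimately show ?case by blast
  qed
qed

text \<open>Induction on the degree of a polynomial annihilating \<open>v\<close>, splitting off a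
  root \<open>c\<close>. By induction \<open>shift f c v\<close> is a sum of generalized
  eigenvectors; those for other eigenvalues have preimages under \<open>shift f c\<close> of the
  same kind. Subtracting these preimages from \<open>v\<close> leaves a generalized eigenvector for
  \<open>c\<close>.\<close>

lemma geig_decomposition:
  assumes f: "lin f" and W: "subspace W" "\<And>x. x \<in> W \<Longrightarrow> f x \<in> W" and v: "v \<in> W"
  shows "v \<in> span (\<Union>c. geig f c \<inter> W)"
proof -
  let ?G = "\<Union>c. geig f c \<inter> W"
  have "v \<in> span ?G" if "p \<noteq> 0" "opoly f p v = 0" "v \<in> W" for p v
    using that
  proof (induction "degree p" arbitrary: p v)
    case 0
    then obtain a where "p = [:a:]" "a \<noteq> 0" by (metis degree_eq_zeroE pCons_0_0)
    then show ?case using 0 by (simp add: opoly_pCons f lin_0 span_zero)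
  next
    case (Suc n)
    then have "\<not> constant (poly p)" by (simp add: constant_degree)
    then obtain c where "poly p c = 0" using fundamental_theorem_of_algebra by blast
    then obtain q where q: "p = q * [:- c, 1:]"
      by (metis poly_eq_0_iff_dvd dvd_def mult.commute)
    then have "q \<noteq> 0" using Suc.prems(1) by auto
    moreover have "degree p = degree q + 1"
      unfolding q using \<open>q \<noteq> 0\<close> by (subst degree_mult_eq) auto
    ultimately have "q \<noteq> 0" "degree q = n" using Suc.hyps(2) by auto
    have sh: "opoly f [:- c, 1:] v = shift f c v" for v
      by (simp add: opoly_pCons f lin_0 shift_def)
    have "shift f c v \<in> span ?G"
    proof (rule Suc.hyps(1)[of q])
      show "opoly f q (shift f c v) = 0"
        using Suc.prems(2) unfolding q opoly_mult[OF f] sh .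
      show "shift f c v \<in> W"
        unfolding shift_def using Suc.prems W by (intro subspace_diff subspace_scale) auto
    qed (use \<open>q \<noteq> 0\<close> \<open>degree q = n\<close> in auto)
    then have "\<exists>v'\<in>span ?G. shift f c v - shift f c v' \<in> geig f c \<inter> W"
    proof (induction rule: span_induct_alt)
      case base
      then show ?case
        using f W by (intro bexI[of _ 0])
          (auto simp: lin_0 lin_shift subspace_0 subspace_geig span_zero)
    next
      case (step a x y)
      then obtain \<mu> where \<mu>: "x \<in> geig f \<mu>" "x \<in> W" by blast
      obtain x' where x': "x' \<in> span ?G" "x - shift f c x' \<in> geig f c \<inter> W"
      proof (cases "c = \<mu>")
        case True
        show ?thesis by (rule that[of 0]) (use True \<mu> f in \<open>auto simp: span_zero lin_0 lin_shift\<close>)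
      next
        case False
        then obtain w where "w \<in> geig f \<mu> \<inter> W" "shift f c w = x"
          using shift_other_surj[OF f W _ \<mu>] by blast
        then show ?thesis
          using f W(1) by (intro that[of w]) (auto intro!: span_base simp: subspace_0 subspace_geig)
      qed
      obtain y' where y': "y' \<in> span ?G" "y - shift f c y' \<in> geig f c \<inter> W" using step by blast
      have "a \<cdot> (x - shift f c x') + (y - shift f c y') \<in> geig f c \<inter> W"
        using x' y' W(1) subspace_geig[OF f] by (auto intro!: subspace_add subspace_scale)
      then show ?case
        using x' y' by (intro bexI[of _ "a \<cdot> x' + y'"])
          (auto simp: lin_add lin_scale lin_shift f algebra_simps intro!: span_add span_scale)
    qed
    then obtain v' where v': "v' \<in> span ?G" "shift f c (v - v') \<in> geig f c"
      by (auto simp: lin_diff lin_shift f)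
    have "v' \<in> W" using v'(1) W(1) by (auto dest: span_in)
    then have "v - v' \<in> ?G"
      using v' Suc.prems W(1) shift_in_geig_iff[OF f] by (auto intro: subspace_diff)
    then have "v - v' + v' \<in> span ?G" using v'(1) by (rule span_add[OF span_base])
    then show ?case by simp
  qed
  then show ?thesis using annihilator[OF f] v by blast
qed

text \<open>The induction reduces to a true eigenvector for \<open>a\<close>, on which every power
  of \<open>shift f b\<close> is a power of the nonzero scalar \<open>a - b\<close>.\<close>

lemma geig_disjoint:
  assumes f: "lin f" and x: "x \<in> geig f a" "x \<in> geig f b" and "a \<noteq> b"
  shows "x = 0"
proof -
  obtain n where "(shift f a ^^ n) x = 0" using x by (auto simp: geig_def)
  then show ?thesis using x(2)
  proof (induction n arbitrary: x)
    case (Suc n)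
    have ba: "shift f b v = shift f a v + (a - b) \<cdot> v" for v
      by (simp add: shift_def scale_left_diff_distrib)
    have "shift f a x = shift f b x - (a - b) \<cdot> x" by (simp add: ba)
    moreover have "\<dots> \<in> geig f b"
      using Suc.prems(2) shift_in_geig_iff[OF f] subspace_geig[OF f]
      by (intro subspace_diff subspace_scale) auto
    moreover have "(shift f a ^^ n) (shift f a x) = 0"
      using Suc.prems(1) by (simp add: funpow_swap1)
    ultimately have "shift f a x = 0"
      using Suc.IH by metis
    then have ev: "shift f b x = (a - b) \<cdot> x" by (simp add: ba)
    have "(shift f b ^^ k) x = (a - b) ^ k \<cdot> x" for k
      by (induction k) (simp_all add: ev lin_scale lin_shift f)
    then show ?case using Suc.prems(2) \<open>a \<noteq> b\<close> by (auto simp: geig_def)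
  qed simp
qed

lemma funpow_shift_in_geig: "lin f \<Longrightarrow> v \<in> geig f b \<Longrightarrow> (shift f a ^^ n) v \<in> geig f b"
proof (induction n)
  case (Suc n)
  have "shift f a w = shift f b w - (a - b) \<cdot> w" for w
    by (simp add: shift_def scale_left_diff_distrib)
  then show ?case
    using Suc shift_in_geig_iff[of f b] subspace_geig[of f b]
    by (auto intro!: subspace_diff subspace_scale)
qed simp

text \<open>A power of \<open>shift f a\<close> that kills \<open>x a\<close> leaves a shorter sum
  of the same kind. So it kills the other terms too, which puts them in two different generalized
  eigenspaces at once.\<close>

lemma geig_sum_0:
  assumes f: "lin f" and "finite S" "\<And>c. c \<in> S \<Longrightarrow> x c \<in> geig f c" "(\<Sum>c\<in>S. x c) = 0" "c \<in> S"
  shows "x c = 0"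
  using assms(2-)
proof (induction S arbitrary: x c rule: finite_induct)
  case (insert a S)
  obtain n where n: "(shift f a ^^ n) (x a) = 0"
    using insert.prems(1)[of a] by (auto simp: geig_def)
  have "(\<Sum>c\<in>S. (shift f a ^^ n) (x c)) = (shift f a ^^ n) (\<Sum>c\<in>insert a S. x c)"
    using insert.hyps n by (simp add: lin_sum lin_add lin_shift_funpow f)
  also have "\<dots> = 0" using insert.prems by (simp add: lin_0 lin_shift_funpow f)
  finally have "(shift f a ^^ n) (x c) = 0" if "c \<in> S" for c
    using insert.IH[of "\<lambda>c. (shift f a ^^ n) (x c)" c] that insert.prems(1) f
    by (auto intro: funpow_shift_in_geig)
  then have "x c \<in> geig f a" if "c \<in> S" for c
    using that unfolding geig_def by blast
  then have S: "x c = 0" if "c \<in> S" for c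
    using geig_disjoint[OF f, of "x c" a c] insert.prems(1)[of c] insert.hyps that by auto
  then have "x a = 0" using insert.prems(2) insert.hyps by simp
  then show ?case using S insert.prems(3) by auto
qed simp

lemma geig_basis:
  assumes f: "lin f"
  obtains B ev where "independent B" "span B = UNIV" "\<And>b. b \<in> B \<Longrightarrow> b \<in> geig f (ev b)"
proof -
  let ?G = "\<Union>c. geig f c"
  obtain B where B: "B \<subseteq> ?G" "independent B" "?G \<subseteq> span B"
    using maximal_independent_subset[of ?G] by blast
  have "span ?G = UNIV"
    using geig_decomposition[OF f subspace_UNIV] by auto
  then have "span B = UNIV" using B(3) span_minimal[of ?G "span B"] by auto
  moreover obtain ev where "\<And>b. b \<in> B \<Longrightarrow> b \<in> geig f (ev b)"
    using B(1) by (metis UN_E subsetD)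
  ultimately show thesis using that B(2) by blast
qed

text \<open>\<open>T\<close> is \<open>g\<close> of the semisimple part of \<open>f\<close>. It is
  prescribed on a basis of generalized eigenvectors; for it to act as \<open>g c\<close> on all of
  \<open>geig f c\<close>, the coordinates of \<open>v\<close> at other eigenvalues must add up to
  zero in each group, which is \<open>geig_sum_0\<close>.\<close>

lemma spectral_function:
  assumes f: "lin f"
  shows "\<exists>T. lin T \<and> (\<forall>c. \<forall>v\<in>geig f c. T v = g c \<cdot> v)"
proof -
  obtain B ev where B: "independent B" "span B = UNIV" and ev: "\<And>b. b \<in> B \<Longrightarrow> b \<in> geig f (ev b)"
    using geig_basis[OF f] by metis
  have finB: "finite B" using B finiteI_independent by blast
  obtain T where T: "lin T" "\<And>b. b \<in> B \<Longrightarrow> T b = g (ev b) \<cdot> b"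
    using lin_on_basis[OF B(1), of "\<lambda>b. g (ev b) \<cdot> b"] by auto
  have "T v = g c \<cdot> v" if v: "v \<in> geig f c" for c v
  proof -
    \<comment> \<open>\<open>c\<close> need not occur among the eigenvalues of the basis, yet
      \<open>v\<close> has to be compared with the group at \<open>c\<close>.\<close>
    define E where "E = insert c (ev ` B)"
    define w where "w a = (\<Sum>b\<in>{b\<in>B. ev b = a}. representation B v b \<cdot> b)" for a
    define x where "x a = w a - (if a = c then v else 0)" for a
    have finE: "finite E" using finB by (simp add: E_def)
    have grp: "(\<Sum>a\<in>E. \<Sum>b\<in>{b\<in>B. ev b = a}. h b) = sum h B" for h :: "'b \<Rightarrow> 'b"
      by (rule sum.group) (use finB in \<open>auto simp: E_def\<close>)
    have vB: "v = (\<Sum>b\<in>B. representation B v b \<cdot> b)"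
      using B finB by (subst sum_representation_eq) auto
    have "(\<Sum>a\<in>E. x a) = (\<Sum>a\<in>E. w a) - v"
      using finE by (simp add: x_def sum_subtractf E_def sum.delta)
    also have "\<dots> = 0" unfolding w_def grp using vB by simp
    finally have sum0: "(\<Sum>a\<in>E. x a) = 0" .
    have xg: "x a \<in> geig f a" for a
      unfolding x_def w_def using ev v subspace_geig[OF f]
      by (intro subspace_diff subspace_sum) (auto intro: subspace_scale subspace_0)
    have "x a = 0" if "a \<in> E" for a
      by (rule geig_sum_0[OF f finE _ sum0 that]) (rule xg)
    then have w: "w a = (if a = c then v else 0)" if "a \<in> E" for a
      using that by (auto simp: x_def split: if_splits)
    have "T v = (\<Sum>b\<in>B. g (ev b) \<cdot> (representation B v b \<cdot> b))"
      by (subst vB) (auto simp: lin_sum lin_scale T mult.commute intro!: sum.cong)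
    also have "\<dots> = (\<Sum>a\<in>E. \<Sum>b\<in>{b\<in>B. ev b = a}. g (ev b) \<cdot> (representation B v b \<cdot> b))"
      by (rule grp[symmetric])
    also have "\<dots> = (\<Sum>a\<in>E. g a \<cdot> w a)"
      unfolding w_def scale_sum_right by (intro sum.cong refl) auto
    also have "\<dots> = (\<Sum>a\<in>E. if a = c then g c \<cdot> v else 0)"
      by (intro sum.cong refl) (simp add: w)
    also have "\<dots> = g c \<cdot> v" using finE by (simp add: E_def)
    finally show ?thesis .
  qed
  then show ?thesis using T(1) by blast
qed

lemma nilpotent_iff_geig_0: "lin f \<Longrightarrow> (\<exists>n. \<forall>v. (f ^^ n) v = 0) \<longleftrightarrow> geig f 0 = UNIV"
  using nilpotent_uniform[of f] by (auto simp: geig_def shift_0 set_eq_iff)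

text \<open>With \<open>S\<close> the semisimple part of \<open>f\<close>, the operator
  \<open>T (f - S)\<close> is nilpotent, so the trace of \<open>T f\<close> equals that of
  \<open>T S\<close>, the sum of the squared moduli of the eigenvalues.\<close>

lemma nilpotent_if_trace_conjugate_0:
  assumes f: "lin f" and T: "lin T" "\<And>c v. v \<in> geig f c \<Longrightarrow> T v = cnj c \<cdot> v"
    and tr: "trace (\<lambda>x. T (f x)) = 0"
  shows "\<exists>n. \<forall>v. (f ^^ n) v = 0"
proof -
  obtain S where S: "lin S" "\<And>c v. v \<in> geig f c \<Longrightarrow> S v = c \<cdot> v"
    using spectral_function[OF f, of "\<lambda>c. c"] by blast
  obtain B ev where B: "independent B" "span B = UNIV" and ev: "\<And>b. b \<in> B \<Longrightarrow> b \<in> geig f (ev b)"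
    using geig_basis[OF f] by metis
  have finB: "finite B" using B finiteI_independent by blast
  define N where "N x = T (f x - S x)" for x
  have N: "lin N" unfolding N_def using f T S by (intro lin_comp[OF T(1)] lin_minus)
  have Npow: "(N ^^ k) v = cnj c ^ k \<cdot> (shift f c ^^ k) v" if v: "v \<in> geig f c" for c v k
  proof (induction k)
    case (Suc k)
    have g: "(shift f c ^^ k) v \<in> geig f c" using f v by (rule funpow_shift_in_geig)
    have gs: "shift f c w \<in> geig f c" if "w \<in> geig f c" for w
      using that shift_in_geig_iff[OF f] by blast
    have "N w = cnj c \<cdot> shift f c w" if "w \<in> geig f c" for w
    proof -
      have "f w - S w = shift f c w" using S(2)[OF that] by (simp add: shift_def)
      then show ?thesis using T(2)[OF gs[OF that]] by (simp add: N_def)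
    qed
    then show ?case using Suc g by (simp add: lin_scale N)
  qed simp
  have "v \<in> geig N 0" if v: "v \<in> geig f c" for c v
  proof -
    obtain k where "(shift f c ^^ k) v = 0" using v by (auto simp: geig_def)
    then have "(shift N 0 ^^ k) v = 0" using Npow[OF v, of k] by (simp add: shift_0)
    then show ?thesis unfolding geig_def by blast
  qed
  then have "span B \<subseteq> geig N 0"
    using ev subspace_geig[OF N] by (intro span_minimal) auto
  then obtain n where n: "\<And>v. (N ^^ n) v = 0"
    using nilpotent_iff_geig_0[OF N] B by auto
  have "trace (\<lambda>x. T (f x)) = trace (\<lambda>x. T (S x) + N x)"
    by (simp add: N_def lin_diff T)
  then have "trace (\<lambda>x. T (S x)) = 0"
    using tr trace_nilpotent[OF N n] by (simp add: trace_add)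
  moreover have "trace (\<lambda>x. T (S x)) = (\<Sum>b\<in>B. cnj (ev b) * ev b)"
  proof -
    have "representation B (T (S b)) b = cnj (ev b) * ev b" if "b \<in> B" for b
    proof -
      have "T (S b) = (cnj (ev b) * ev b) \<cdot> b"
        using S(2)[OF ev[OF that]] T(2)[OF ev[OF that]] by (simp add: lin_scale[OF T(1)])
      then show ?thesis
        using that B by (simp add: representation_scale representation_basis span_base)
    qed
    then show ?thesis
      using trace_basis[OF lin_comp[OF T(1) S(1)] B] by simp
  qed
  ultimately have "(\<Sum>b\<in>B. cnj (ev b) * ev b) = 0" by simp
  then have "Re (\<Sum>b\<in>B. cnj (ev b) * ev b) = 0" by simp
  moreover have "Re (cnj z * z) = (cmod z)\<^sup>2" for z
    by (simp add: cmod_power2) (simp add: power2_eq_square)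
  ultimately have "(\<Sum>b\<in>B. (cmod (ev b))\<^sup>2) = 0"
    unfolding Re_sum by simp
  then have "ev b = 0" if "b \<in> B" for b
    using finB that by (simp add: sum_nonneg_eq_0_iff)
  then have "span B \<subseteq> geig f 0"
    using ev subspace_geig[OF f] by (intro span_minimal) auto
  then show ?thesis using nilpotent_iff_geig_0[OF f] B by auto
qed

lemma geig_eigenvector:
  assumes f: "lin f" and v: "v \<in> geig f c" "v \<noteq> 0"
  shows "\<exists>u. u \<noteq> 0 \<and> f u = c \<cdot> u"
proof -
  obtain n where "(shift f c ^^ n) v = 0" using v by (auto simp: geig_def)
  then show ?thesis using v(2)
  proof (induction n arbitrary: v)
    case (Suc n)
    show ?case
    proof (cases "shift f c v = 0")
      case True
      then show ?thesis using Suc.prems by (auto simp: shift_def)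
    next
      case False
      then show ?thesis using Suc.IH[of "shift f c v"] Suc.prems by (simp add: funpow_swap1)
    qed
  qed simp
qed

text \<open>All of them are roots of one annihilating polynomial.\<close>

lemma finite_eigenvalues:
  assumes f: "lin f"
  shows "finite {c. \<exists>v\<in>geig f c. v \<noteq> 0}"
proof -
  obtain p where p: "p \<noteq> 0" "\<And>v. opoly f p v = 0"
    using annihilator[OF f] by blast
  have ev: "opoly f q u = poly q c \<cdot> u" if "f u = c \<cdot> u" for q u c
    by (induction q) (simp_all add: opoly_pCons[OF f] lin_scale[OF f] that scale_left_distrib mult.commute)
  have "poly p c = 0" if v: "v \<in> geig f c" "v \<noteq> 0" for c v
  proof -
    obtain u where "u \<noteq> 0" "f u = c \<cdot> u" using geig_eigenvector[OF f v] by blast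
    then show ?thesis using ev[of u c p] p(2)[of u] by simp
  qed
  then show ?thesis
    by (intro finite_subset[OF _ poly_roots_finite[OF p(1)]]) blast
qed

end

section \<open>Associated graded operators and sl2\<close>

context fin_dim_space
begin

definition filtered_ops :: "(nat \<Rightarrow> 'b set) \<Rightarrow> ('b \<Rightarrow> 'b) set" where
  "filtered_ops F = {T. lin T \<and> (\<forall>i. \<forall>v\<in>F i. T v \<in> F i)}"

text \<open>\<open>G\<close> maps a filtered operator to its associated graded, transported to the space itself by a splitting.\<close>

lemma graded_operators:
  assumes sub: "\<And>i. subspace (F i)" and dec: "\<And>i. F (Suc i) \<subseteq> F i" and "F n = {0}" "F 0 = UNIV"
  obtains G :: "('b \<Rightarrow> 'b) \<Rightarrow> 'b \<Rightarrow> 'b" where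
    "\<And>T. T \<in> filtered_ops F \<Longrightarrow> lin (G T)"
    "\<And>T. T \<in> filtered_ops F \<Longrightarrow> trace (G T) = trace T"
    "\<And>S T. S \<in> filtered_ops F \<Longrightarrow> T \<in> filtered_ops F \<Longrightarrow> G (\<lambda>x. S (T x)) = (\<lambda>x. G S (G T x))"
    "\<And>S T. G (\<lambda>x. S x + T x) = (\<lambda>x. G S x + G T x)"
    "\<And>c T. G (\<lambda>x. c \<cdot> T x) = (\<lambda>x. c \<cdot> G T x)"
    "G (\<lambda>x. x) = (\<lambda>x. x)"
    "\<And>T. \<forall>i. \<forall>v\<in>F i. T v \<in> F (Suc i) \<Longrightarrow> G T = (\<lambda>x. 0)"
    "\<And>z. z \<noteq> 0 \<Longrightarrow> \<exists>y. y \<noteq> 0 \<and> (\<forall>T\<in>filtered_ops F. \<forall>c. T z = c \<cdot> z \<longrightarrow> G T y = c \<cdot> y)"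
    "\<And>A B i w. A \<in> filtered_ops F \<Longrightarrow> B \<in> filtered_ops F \<Longrightarrow> \<forall>v. \<exists>a b. v = G A a + G B b \<Longrightarrow> w \<in> F i \<Longrightarrow>
      \<exists>a\<in>F i. \<exists>b\<in>F i. w - A a - B b \<in> F (Suc i)"
proof -
  define stab where "stab = filtered_ops F"
  obtain P where P: "\<And>i. lin (P i)" and P1: "\<And>v. (\<Sum>i<n. P i v) = v"
    and PP: "\<And>i j v. P i (P j v) = (if i = j then P i v else 0)" and PF: "\<And>i v. P i v \<in> F i"
    and Pd: "\<And>i v. v \<in> F i \<Longrightarrow> v - P i v \<in> F (Suc i)"
    and P0: "\<And>i j v. i < j \<Longrightarrow> v \<in> F j \<Longrightarrow> P i v = 0"
    using filtration_splitting[OF assms(1-4)] by metis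
  \<comment> \<open>The block diagonal part of \<open>T\<close>. A filtered operator is block
    triangular (\<open>PTP\<close>), so in the blocks of a product only the diagonal factors meet
    and \<open>G\<close> is multiplicative.\<close>
  define G where "G T v = (\<Sum>i<n. P i (T (P i v)))" for T v
  have stabD: "lin T" "\<And>i v. v \<in> F i \<Longrightarrow> T v \<in> F i" if "T \<in> stab" for T
    using that by (auto simp: stab_def filtered_ops_def)
  have PG: "P i (G T v) = (if i < n then P i (T (P i v)) else 0)" for i T v
    unfolding G_def lin_sum[OF P] PP by (simp add: sum.delta)
  have PTP: "P i (T (P j v)) = 0" if "T \<in> stab" "i < j" for T i j v
    using P0[OF that(2)] stabD[OF that(1)] PF by blast
  have linG: "lin (G T)" if "T \<in> stab" for T
    unfolding G_def using P stabD(1)[OF that]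
    by (intro lin_setsum) (rule lin_comp[of "P _"], simp, rule lin_comp[of T], simp_all)
  have trG: "trace (G T) = trace T" if "T \<in> stab" for T
  proof -
    have T: "lin T" by (rule stabD[OF that])
    have "trace (G T) = (\<Sum>i<n. trace (\<lambda>v. P i (T (P i v))))"
      unfolding G_def by (rule trace_sum)
    also have "\<dots> = (\<Sum>i<n. trace (\<lambda>v. T (P i v)))"
    proof (intro sum.cong refl)
      fix i
      have "trace (\<lambda>v. P i (T (P i v))) = trace (\<lambda>v. T (P i (P i v)))"
        by (rule trace_commute) (use P T in \<open>auto intro: lin_comp[of T]\<close>)
      then show "trace (\<lambda>v. P i (T (P i v))) = trace (\<lambda>v. T (P i v))" by (simp add: PP)
    qed
    also have "\<dots> = trace (\<lambda>v. \<Sum>i<n. T (P i v))" by (rule trace_sum[symmetric])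
    also have "\<dots> = trace T" by (simp add: lin_sum[OF T, symmetric] P1)
    finally show ?thesis .
  qed
  have multG: "G (\<lambda>x. S (T x)) v = G S (G T v)" if S: "S \<in> stab" and T: "T \<in> stab" for S T v
  proof -
    have "P i (S (T (P i v))) = P i (S (P i (T (P i v))))" if "i < n" for i
    proof -
      have "P i (S (T (P i v))) = P i (S (\<Sum>j<n. P j (T (P i v))))" by (simp add: P1)
      also have "\<dots> = (\<Sum>j<n. P i (S (P j (T (P i v)))))"
        by (simp add: lin_sum[OF stabD(1)[OF S]] lin_sum[OF P])
      also have "\<dots> = (\<Sum>j<n. if j = i then P i (S (P i (T (P i v)))) else 0)"
      proof (intro sum.cong refl)
        fix j
        show "P i (S (P j (T (P i v)))) = (if j = i then P i (S (P i (T (P i v)))) else 0)"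
          using PTP[OF S, of i j] PTP[OF T, of j i] lin_0[OF P] lin_0[OF stabD(1)[OF S]]
          by (cases j i rule: linorder_cases) auto
      qed
      finally show ?thesis using that by simp
    qed
    then show ?thesis
      unfolding G_def[of "\<lambda>x. S (T x)"] G_def[of S] PG by (intro sum.cong) auto
  qed
  have addG: "G (\<lambda>x. S x + T x) v = G S v + G T v" for S T v
    by (simp add: G_def lin_add[OF P] sum.distrib)
  have scaleG: "G (\<lambda>x. c \<cdot> T x) v = c \<cdot> G T v" for c T v
    by (simp add: G_def lin_scale[OF P] scale_sum_right)
  have idG: "G (\<lambda>x. x) v = v" for v by (simp add: G_def PP P1)
  have strictG: "G T v = 0" if "\<And>i v. v \<in> F i \<Longrightarrow> T v \<in> F (Suc i)" for T v
    unfolding G_def using P0[OF lessI] that PF by (simp add: sum.neutral)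
  have eigG: "\<exists>y. y \<noteq> 0 \<and> (\<forall>T\<in>stab. \<forall>c. T z = c \<cdot> z \<longrightarrow> G T y = c \<cdot> y)" if z: "z \<noteq> 0" for z
  proof -
    \<comment> \<open>The witness is the leading component of \<open>z\<close>, at the last level
      that contains \<open>z\<close>. It depends on \<open>z\<close> alone and therefore serves all
      operators at once.\<close>
    obtain m where m: "z \<notin> F m" "\<And>k. k < m \<Longrightarrow> z \<in> F k"
      using exists_least_iff[of "\<lambda>m. z \<notin> F m"] z assms(3) by auto
    have "m \<noteq> 0"
    proof
      assume "m = 0"
      then show False using m(1) assms(4) by simp
    qed
    then obtain i where i: "m = Suc i" by (cases m) auto
    have zi: "z \<in> F i" "z \<notin> F (Suc i)" using m i by auto
    have "F k \<subseteq> F n" if "n \<le> k" for k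
      by (rule lift_Suc_antimono_le[of F, OF dec that])
    then have "i < n" using zi z assms(3) by (metis linorder_not_less singletonD subsetD)
    have y0: "P i z \<noteq> 0" using Pd[OF zi(1)] zi(2) by auto
    have "G T (P i z) = c \<cdot> P i z" if T: "T \<in> stab" "T z = c \<cdot> z" for T c
    proof -
      have *: "P j (T (P j (P i z))) = (if j = i then P i (T (P i z)) else 0)" for j
        using lin_0[OF P] lin_0[OF stabD(1)[OF T(1)]] by (auto simp: PP)
      have "G T (P i z) = P i (T (P i z))"
        unfolding G_def * using \<open>i < n\<close> by simp
      moreover have "P i (T (z - P i z)) = 0"
        using P0[OF lessI] stabD(2)[OF T(1)] Pd[OF zi(1)] by blast
      ultimately show ?thesis
        using T(2) by (simp add: lin_diff[OF stabD(1)[OF T(1)]] lin_diff[OF P] lin_scale[OF P])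
    qed
    then show ?thesis using y0 by blast
  qed
  have surjG: "\<exists>a\<in>F i. \<exists>b\<in>F i. w - A a - B b \<in> F (Suc i)"
    if A: "A \<in> stab" and B: "B \<in> stab" and surj: "\<And>v. \<exists>a b. v = G A a + G B b" and w: "w \<in> F i" for A B i w
  proof -
    obtain a b where ab: "P i w = G A a + G B b" using surj by blast
    have "P i w = P i (P i w)" by (simp add: PP)
    also have "\<dots> = P i (A (P i a)) + P i (B (P i b))" if "i < n"
      unfolding ab using that by (simp add: lin_add[OF P] PG)
    moreover have "P i w = 0" "P i (A (P i a)) = 0" "P i (B (P i b)) = 0" if "\<not> i < n"
    proof -
      have "P i v = 0" for v
        using P1[of "P i v"] that by (simp add: PP)
      then show "P i w = 0" "P i (A (P i a)) = 0" "P i (B (P i b)) = 0" by auto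
    qed
    ultimately have "P i (w - A (P i a) - B (P i b)) = 0"
      by (cases "i < n") (simp_all add: lin_diff[OF P])
    moreover have "w - A (P i a) - B (P i b) \<in> F i"
      using w sub stabD(2)[OF A] stabD(2)[OF B] PF by (auto intro!: subspace_diff)
    ultimately have "w - A (P i a) - B (P i b) \<in> F (Suc i)"
      using Pd by fastforce
    then show ?thesis using PF by blast
  qed
  show thesis
  proof (rule that[of G, folded stab_def])
    show "G T = (\<lambda>x. 0)" if "\<forall>i. \<forall>v\<in>F i. T v \<in> F (Suc i)" for T
      using strictG[of T] that by blast
  qed (use surjG eigG in \<open>auto simp: fun_eq_iff linG trG multG addG scaleG idG\<close>)
qed

end

context complex_space
begin

lemma funpow_commute: "(\<And>x. f (g x) = g (f x)) \<Longrightarrow> (f ^^ k) (g x) = g ((f ^^ k) x)"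
  by (induction k) simp_all

text \<open>Powers of \<open>D\<close> are commutators of \<open>E\<close> with
  \<open>D^k Z\<close>, so \<open>D\<close> has only zero power traces and is nilpotent. On the
  kernel of \<open>E^(k+1)\<close>, the product \<open>E Z\<close> then acts modulo the kernel of
  \<open>E^k\<close> like \<open>(k+1) D\<close>, so \<open>E Z\<close> is nilpotent. In
  \<open>sl2_pair\<close> this rules out an obstruction to completing \<open>e\<close> to a
  triple.\<close>

lemma trace_product_0:
  assumes E: "lin E" and Z: "lin Z" and nil: "\<And>v. (E ^^ m) v = 0"
    and D: "\<And>x. D x = E (Z x) - Z (E x)" and ED: "\<And>x. E (D x) = D (E x)"
  shows "trace (\<lambda>x. E (Z x)) = 0"
proof -
  have linD: "lin D"
    unfolding D[abs_def] using E Z by (intro lin_minus lin_comp[OF E Z] lin_comp[OF Z E])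
  note Dk = lin_funpow[OF linD]
  have EDk: "E ((D ^^ k) x) = (D ^^ k) (E x)" for k x
    using funpow_commute[of D E k x] ED by simp
  have "trace (D ^^ Suc k) = 0" for k
  proof -
    have "(D ^^ Suc k) x = E ((D ^^ k) (Z x)) - (D ^^ k) (Z (E x))" for x
    proof -
      have "(D ^^ Suc k) x = (D ^^ k) (D x)" by (simp add: funpow_swap1)
      then show ?thesis by (simp add: D lin_diff[OF Dk] EDk)
    qed
    then have "D ^^ Suc k = (\<lambda>x. E ((D ^^ k) (Z x)) - (D ^^ k) (Z (E x)))" by (rule ext)
    then have "trace (D ^^ Suc k) = trace (\<lambda>x. E ((D ^^ k) (Z x))) - trace (\<lambda>x. (D ^^ k) (Z (E x)))"
      by (simp only: trace_diff)
    also have "\<dots> = 0"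
      using trace_commute[OF E lin_comp[OF Dk Z], of k] by simp
    finally show ?thesis .
  qed
  then obtain N where N: "\<And>v. (D ^^ N) v = 0"
    using nilpotent_if_power_traces_0[OF linD] by blast
  have comm: "(E ^^ Suc k) (Z v) = Z ((E ^^ Suc k) v) + of_nat (Suc k) \<cdot> D ((E ^^ k) v)" for k v
  proof (induction k)
    case 0
    then show ?case by (simp add: D)
  next
    case (Suc k)
    have EZ: "E (Z x) = Z (E x) + D x" for x by (simp add: D)
    have "(E ^^ Suc (Suc k)) (Z v) = E (Z ((E ^^ Suc k) v) + of_nat (Suc k) \<cdot> D ((E ^^ k) v))"
      using Suc by simp
    also have "\<dots> = Z ((E ^^ Suc (Suc k)) v) + D ((E ^^ Suc k) v) + of_nat (Suc k) \<cdot> D ((E ^^ Suc k) v)"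
      by (simp add: lin_add[OF E] lin_scale[OF E] EZ ED)
    also have "\<dots> = Z ((E ^^ Suc (Suc k)) v) + of_nat (Suc (Suc k)) \<cdot> D ((E ^^ Suc k) v)"
      by (simp only: of_nat_Suc[of "Suc k"] scale_left_distrib scale_one add_ac)
    finally show ?case .
  qed
  define X where "X x = E (Z x)" for x
  have X: "lin X" unfolding X_def by (rule lin_comp[OF E Z])
  have "\<exists>n. (X ^^ n) v = 0" if "(E ^^ k) v = 0" for k v
    using that
  proof (induction k arbitrary: v)
    case 0
    then show ?case by (auto intro: exI[of _ 0])
  next
    case (Suc k)
    have step: "(E ^^ k) (X u) = of_nat (Suc k) \<cdot> D ((E ^^ k) u)" if "(E ^^ Suc k) u = 0" for u
      using comm[of k u] that lin_0[OF Z] by (simp add: X_def funpow_swap1)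
    have "(E ^^ Suc k) ((X ^^ j) v) = 0 \<and> (E ^^ k) ((X ^^ j) v) = of_nat (Suc k) ^ j \<cdot> (D ^^ j) ((E ^^ k) v)" for j
    proof (induction j)
      case 0
      then show ?case using Suc.prems by simp
    next
      case (Suc j)
      let ?u = "(X ^^ j) v"
      have u: "(E ^^ k) (X ?u) = of_nat (Suc k) \<cdot> D ((E ^^ k) ?u)" using step Suc by blast
      have "(E ^^ Suc k) (X ?u) = of_nat (Suc k) \<cdot> D ((E ^^ Suc k) ?u)"
        using u by (simp add: lin_scale[OF E] ED)
      moreover have "(E ^^ Suc k) ?u = 0" using Suc by blast
      ultimately have "(E ^^ Suc k) (X ?u) = 0" by (simp only: lin_0[OF linD] scale_zero_right)
      moreover have "(E ^^ k) (X ?u) = of_nat (Suc k) ^ Suc j \<cdot> (D ^^ Suc j) ((E ^^ k) v)"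
        using u Suc by (simp add: lin_scale[OF linD])
      ultimately show ?case by simp
    qed
    then have "(E ^^ k) ((X ^^ N) v) = 0" by (simp add: N)
    then obtain n where "(X ^^ n) ((X ^^ N) v) = 0" using Suc.IH by blast
    then show ?case by (metis comp_apply funpow_add)
  qed
  then have "\<And>v. \<exists>n. (X ^^ n) v = 0" using nil by blast
  then obtain n where "\<And>v. (X ^^ n) v = 0" using nilpotent_uniform[OF X] by blast
  then have "trace X = 0" using trace_nilpotent[OF X] by blast
  then show ?thesis unfolding X_def[abs_def] .
qed

text \<open>These are the relations that \<open>sl2_pair\<close> obtains for
  \<open>\<rho> e\<close>, \<open>\<rho> h0\<close> and \<open>\<rho> f\<close>.\<close>

context
  fixes E H F :: "'b \<Rightarrow> 'b" and N :: nat
  assumes E: "lin E" and H: "lin H" and F: "lin F" and nil: "\<And>v. (E ^^ N) v = 0"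
    and EF: "\<And>x. E (F x) - F (E x) = H x" and HE: "\<And>x. H (E x) - E (H x) = 2 \<cdot> E x"
begin

lemma sl2_H_pow: "H ((E ^^ k) x) = (E ^^ k) (H x) + (2 * of_nat k) \<cdot> (E ^^ k) x"
proof (induction k)
  case (Suc k)
  have "H (E y) = E (H y) + 2 \<cdot> E y" for y using HE[of y] by (simp add: algebra_simps)
  then show ?case using Suc by (simp add: lin_add[OF E] lin_scale[OF E] algebra_simps)
qed simp

text \<open>The usual commutator of \<open>E^(k+1)\<close> with \<open>F\<close>, with
  \<open>H\<close> written to the right of \<open>E^k\<close>; on the left, \<open>k\<close> would
  become \<open>-k\<close>.\<close>

lemma sl2_pow_F: "(E ^^ Suc k) (F x)
  = F ((E ^^ Suc k) x) + of_nat (Suc k) \<cdot> ((E ^^ k) (H x) + of_nat k \<cdot> (E ^^ k) x)"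
proof (induction k)
  case 0
  then show ?case using EF[of x] by (simp add: algebra_simps)
next
  case (Suc k)
  have EF': "E (F y) = F (E y) + H y" for y using EF[of y] by (simp add: algebra_simps)
  let ?y = "(E ^^ Suc k) x" and ?z = "(E ^^ Suc k) (H x)" and ?c = "of_nat k :: complex"
  have "(E ^^ Suc (Suc k)) (F x)
    = E (F ?y + of_nat (Suc k) \<cdot> ((E ^^ k) (H x) + ?c \<cdot> (E ^^ k) x))"
    using Suc by simp
  also have "\<dots> = F (E ?y) + H ?y + of_nat (Suc k) \<cdot> (?z + ?c \<cdot> ?y)"
    by (simp add: lin_add[OF E] lin_scale[OF E] EF')
  also have "H ?y = ?z + (2 * of_nat (Suc k)) \<cdot> ?y" by (rule sl2_H_pow)
  finally have "(E ^^ Suc (Suc k)) (F x)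
    = F (E ?y) + (?z + (2 * of_nat (Suc k)) \<cdot> ?y) + of_nat (Suc k) \<cdot> (?z + ?c \<cdot> ?y)" .
  also have "\<dots> = F (E ?y) + ((1 + of_nat (Suc k)) \<cdot> ?z + (2 * of_nat (Suc k) + of_nat (Suc k) * ?c) \<cdot> ?y)"
    by (simp only: scale_left_distrib scale_right_distrib scale_scale scale_one add_ac)
  also have "(2 * of_nat (Suc k) + of_nat (Suc k) * ?c) = of_nat (Suc (Suc k)) * of_nat (Suc k)"
    by (simp add: algebra_simps)
  also have "1 + of_nat (Suc k) = (of_nat (Suc (Suc k)) :: complex)" by simp
  finally show ?case
    by (simp only: scale_right_distrib scale_scale funpow.simps comp_apply)
qed

text \<open>If \<open>v = E^k y\<close>, then \<open>E^(k+1) (F y)\<close> is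
  \<open>(k+1) (-2-k)\<close> times \<open>v\<close>, a nonzero multiple. So \<open>v\<close> lies
  in the image of every power of \<open>E\<close>, and nilpotency leaves only zero.\<close>

lemma sl2_kernel: "E v = 0 \<Longrightarrow> H v = (-2) \<cdot> v \<Longrightarrow> v = 0"
proof -
  assume v: "E v = 0" "H v = (-2) \<cdot> v"
  have "\<exists>y. v = (E ^^ k) y" for k
  proof (induction k)
    case (Suc k)
    then obtain y where y: "v = (E ^^ k) y" by blast
    have Hy: "(E ^^ k) (H y) = (-2 - 2 * of_nat k) \<cdot> v"
      using sl2_H_pow[of k y] v y by (simp add: algebra_simps)
    have "(E ^^ Suc k) y = 0" using v y by simp
    then have "(E ^^ Suc k) (F y) = of_nat (Suc k) \<cdot> ((-2 - 2 * of_nat k) \<cdot> v + of_nat k \<cdot> v)"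
      using sl2_pow_F[of k y] Hy y lin_0[OF F] by simp
    also have "\<dots> = (of_nat (Suc k) * (-2 - of_nat k)) \<cdot> v"
      by (simp only: scale_left_distrib[symmetric] scale_scale) (simp add: algebra_simps)
    finally have *: "(E ^^ Suc k) (F y) = (of_nat (Suc k) * (-2 - of_nat k)) \<cdot> v" .
    define c :: complex where "c = of_nat (Suc k) * (-2 - of_nat k)"
    have "c \<noteq> 0"
    proof
      assume "c = 0"
      then have "of_nat (k + 2) = (0 :: complex)" unfolding c_def
        by (metis add.inverse_inverse mult_eq_0_iff of_nat_add of_nat_eq_0_iff of_nat_numeral
            nat.distinct(1) diff_0 diff_diff_eq neg_equal_0_iff_equal diff_minus_eq_add add.commute
            uminus_add_conv_diff minus_diff_eq)
      then show False by (metis add_is_0 of_nat_eq_0_iff zero_neq_numeral)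
    qed
    moreover have "(E ^^ Suc k) (F y) = c \<cdot> v" using * by (simp only: c_def)
    ultimately have "v = (E ^^ Suc k) (inverse c \<cdot> F y)"
      by (simp add: lin_scale[OF lin_funpow[OF E]] del: funpow.simps)
    then show ?case by blast
  qed simp
  then show "v = 0" using nil by metis
qed

text \<open>The dual statement, by induction on the power of \<open>E\<close> that kills
  \<open>w\<close>. Modulo the subspace \<open>Q\<close> the term \<open>E (F w)\<close> vanishes
  and \<open>H w\<close> is \<open>2 w\<close>, so \<open>u\<close> is a nonzero multiple of
  \<open>w\<close>; by \<open>sl2_pow_F\<close> a smaller power of \<open>E\<close> kills
  \<open>u\<close>.\<close>

lemma sl2_cokernel: "\<exists>a b. w = (H a - 2 \<cdot> a) + E b"
proof -
  define Q where "Q = {(H a - 2 \<cdot> a) + E b | a b. True}"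
  have QI: "(H a - 2 \<cdot> a) + E b \<in> Q" for a b unfolding Q_def by blast
  have Qdiff: "x - c \<cdot> y \<in> Q" if "x \<in> Q" "y \<in> Q" for x y c
  proof -
    obtain a b a' b' where xy: "x = (H a - 2 \<cdot> a) + E b" "y = (H a' - 2 \<cdot> a') + E b'"
      using \<open>x \<in> Q\<close> \<open>y \<in> Q\<close> unfolding Q_def by blast
    have "x - c \<cdot> y = (H (a - c \<cdot> a') - 2 \<cdot> (a - c \<cdot> a')) + E (b - c \<cdot> b')"
      unfolding xy by (simp add: lin_diff[OF E] lin_diff[OF H] lin_scale[OF E] lin_scale[OF H] algebra_simps)
    then show ?thesis using QI by metis
  qed
  have "w \<in> Q" if "(E ^^ k) w = 0" for k w
    using that
  proof (induction k arbitrary: w)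
    case 0
    then have "w = (H 0 - 2 \<cdot> 0) + E 0" using lin_0[OF E] lin_0[OF H] by simp
    then show ?case using QI by metis
  next
    case (Suc k)
    let ?c = "of_nat (Suc k) :: complex"
    define u where "u = E (F w) - ?c \<cdot> (H w + of_nat k \<cdot> w)"
    have "(E ^^ k) u = (E ^^ Suc k) (F w) - ?c \<cdot> ((E ^^ k) (H w) + of_nat k \<cdot> (E ^^ k) w)"
      unfolding u_def
      by (simp add: lin_diff[OF lin_funpow[OF E]] lin_scale[OF lin_funpow[OF E]]
          lin_add[OF lin_funpow[OF E]] funpow_swap1 del: of_nat_Suc)
    also have "\<dots> = 0" unfolding sl2_pow_F using Suc.prems lin_0[OF F] by simp
    finally have uQ: "u \<in> Q" using Suc.IH by blast
    have eq: "(E (F w) - 1 \<cdot> u) - ?c \<cdot> (H w - 2 \<cdot> w) = (?c * of_nat (k + 2)) \<cdot> w"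
      unfolding u_def by (simp add: algebra_simps) (simp add: scale_left_distrib[symmetric])
    have "E (F w) \<in> Q" using QI[of 0 "F w"] lin_0[OF H] by simp
    moreover have "H w - 2 \<cdot> w \<in> Q" using QI[of w 0] lin_0[OF E] by simp
    ultimately have "(?c * of_nat (k + 2)) \<cdot> w \<in> Q"
      using Qdiff uQ unfolding eq[symmetric] by blast
    moreover have "0 \<in> Q" using QI[of 0 0] lin_0[OF E] lin_0[OF H] by simp
    moreover have nz: "?c * of_nat (k + 2) \<noteq> 0"
      by (metis mult_eq_0_iff of_nat_eq_0_iff add_is_0 nat.distinct(1) zero_neq_numeral)
    ultimately have "0 - (- inverse (?c * of_nat (k + 2))) \<cdot> ((?c * of_nat (k + 2)) \<cdot> w) \<in> Q"
      using Qdiff by blast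
    then show ?case
      using nz by (simp only: diff_0 mult_minus_left scale_minus_left minus_minus scale_scale left_inverse scale_one simp_thms)
  qed
  then have "w \<in> Q" using nil by blast
  then show ?thesis unfolding Q_def by blast
qed

end

end

section \<open>Engel's theorem\<close>

locale complex_lie = complex_space scale Basis
  for scale :: "complex \<Rightarrow> 'b::ab_group_add \<Rightarrow> 'b" (infixr \<open>\<cdot>\<close> 75) and Basis +
  fixes br :: "'b \<Rightarrow> 'b \<Rightarrow> 'b"
  assumes lin_br: "lin (br x)" and lin_br_left: "lin (\<lambda>x. br x y)"
    and br_self: "br x x = 0"
    and br_jacobi: "br x (br y z) + br y (br z x) + br z (br x y) = 0"
begin

lemmas br_add = lin_add[OF lin_br] lin_add[OF lin_br_left]
lemmas br_diff = lin_diff[OF lin_br] lin_diff[OF lin_br_left]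
lemmas br_scale = lin_scale[OF lin_br] lin_scale[OF lin_br_left]
lemmas br_zero [simp] = lin_0[OF lin_br] lin_0[OF lin_br_left]
lemmas br_neg = lin_neg[OF lin_br] lin_neg[OF lin_br_left]

lemma br_anti: "br x y = - br y x"
proof -
  have "br (x + y) (x + y) = 0" by (rule br_self)
  then have "br x x + br y x + (br x y + br y y) = 0" by (simp only: br_add)
  then have "br y x + br x y = 0" by (simp add: br_self)
  then show ?thesis by (metis add.commute eq_neg_iff_add_eq_0)
qed

lemma br_br: "br (br x y) z = br x (br y z) - br y (br x z)"
proof -
  have "br z (br x y) = - br (br x y) z" "br y (br z x) = - br y (br x z)"
    using br_anti[of z "br x y"] br_anti[of z x] by (simp_all add: br_neg)
  then show ?thesis using br_jacobi[of x y z] by (simp add: algebra_simps)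
qed

lemma br_derivation: "br x (br y z) = br (br x y) z + br y (br x z)"
  by (simp add: br_br)

lemma br_in: "subspace S \<Longrightarrow> br x y \<in> S \<Longrightarrow> br y x \<in> S"
  using br_anti[of y x] subspace_neg by simp

text \<open>The preimage in \<open>T\<close> of the descending series of the action of
  \<open>S\<close> on the quotient of \<open>T\<close> by \<open>U\<close>. Adding \<open>U\<close>
  at each step avoids a quotient type.\<close>

primrec tower :: "'b set \<Rightarrow> 'b set \<Rightarrow> 'b set \<Rightarrow> nat \<Rightarrow> 'b set" where
  "tower S U T 0 = T"
| "tower S U T (Suc i) = span ({br s t | s t. s \<in> S \<and> t \<in> tower S U T i} \<union> U)"

lemma subspace_tower: "subspace T \<Longrightarrow> subspace (tower S U T i)"
  by (cases i) simp_all

lemma br_in_tower: "s \<in> S \<Longrightarrow> t \<in> tower S U T i \<Longrightarrow> br s t \<in> tower S U T (Suc i)"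
  unfolding tower.simps(2) by (rule span_base) blast

lemma tower_base: "U \<subseteq> T \<Longrightarrow> U \<subseteq> tower S U T i"
  by (cases i) (auto intro: span_base)

lemma tower_Suc_least:
  "subspace X \<Longrightarrow> U \<subseteq> X \<Longrightarrow> (\<And>s t. s \<in> S \<Longrightarrow> t \<in> tower S U T i \<Longrightarrow> br s t \<in> X) \<Longrightarrow> tower S U T (Suc i) \<subseteq> X"
  unfolding tower.simps(2) by (rule span_minimal) auto

lemma tower_dec:
  assumes "subspace T" "U \<subseteq> T" "\<And>s t. s \<in> S \<Longrightarrow> t \<in> T \<Longrightarrow> br s t \<in> T"
  shows "tower S U T (Suc i) \<subseteq> tower S U T i"
proof (induction i)
  case 0
  show ?case using assms by (intro tower_Suc_least) auto
next
  case (Suc i)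
  show ?case
    using assms Suc tower_base[of U T S "Suc i"]
    by (intro tower_Suc_least subspace_tower) (auto intro!: br_in_tower simp del: tower.simps)
qed

lemma tower_subset:
  assumes "subspace T" "U \<subseteq> T" "\<And>s t. s \<in> S \<Longrightarrow> t \<in> T \<Longrightarrow> br s t \<in> T"
  shows "tower S U T i \<subseteq> T"
  using tower_dec[OF assms] by (induction i) (auto simp del: tower.simps(2))

lemma tower_invariant:
  assumes T: "subspace T" "U \<subseteq> T"
    and S: "\<And>s. s \<in> S \<Longrightarrow> br g s \<in> S" and gT: "\<And>t. t \<in> T \<Longrightarrow> br g t \<in> T"
    and gU: "\<And>t. t \<in> U \<Longrightarrow> br g t \<in> U"
  shows "t \<in> tower S U T i \<Longrightarrow> br g t \<in> tower S U T i"
proof (induction i arbitrary: t)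
  case (Suc i)
  let ?X = "{t. br g t \<in> tower S U T (Suc i)}"
  have "tower S U T (Suc i) \<subseteq> ?X"
  proof (rule tower_Suc_least)
    show "subspace ?X"
      using subspace_tower[OF T(1), of S U "Suc i"]
      by (auto simp: subspace_def br_add br_scale simp del: tower.simps)
    show "U \<subseteq> ?X" using tower_base[OF T(2), of S "Suc i"] gU by blast
    show "br s t \<in> ?X" if "s \<in> S" "t \<in> tower S U T i" for s t
      using that S Suc.IH subspace_tower[OF T(1), of S U "Suc i"] br_in_tower[of _ S _ U T i]
      by (simp add: br_derivation[of g s t] subspace_add del: tower.simps)
  qed
  then show ?case using Suc.prems by blast
qed (use gT in simp)

text \<open>
  Engel's theorem for the action of a subalgebra \<open>W\<close> on the quotient of \<open>T\<close> by \<open>U\<close>. A maximal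
  subalgebra \<open>S\<close> whose action is already strictly triangular must be \<open>W\<close>: otherwise it is
  normalized by some \<open>x\<close> outside \<open>S\<close>, and \<open>S\<close> together with \<open>x\<close> is again strictly triangular.
\<close>

theorem engel:
  assumes W: "subspace W" "\<And>x y. x \<in> W \<Longrightarrow> y \<in> W \<Longrightarrow> br x y \<in> W"
    and T: "subspace T" and U: "subspace U" and UT: "U \<subseteq> T"
    and WT: "\<And>x t. x \<in> W \<Longrightarrow> t \<in> T \<Longrightarrow> br x t \<in> T"
    and WU: "\<And>x t. x \<in> W \<Longrightarrow> t \<in> U \<Longrightarrow> br x t \<in> U"
    and nil: "\<And>x t. x \<in> W \<Longrightarrow> t \<in> T \<Longrightarrow> \<exists>n. (br x ^^ n) t \<in> U"
  shows "\<exists>n. tower W U T n \<subseteq> U"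
proof -
  \<comment> \<open>The kernel of the action. Since good subalgebras contain it, membership in
    \<open>S\<close> can be inferred from the action alone.\<close>
  define Z where "Z = {x \<in> W. \<forall>t\<in>T. br x t \<in> U}"
  define good where "good S \<longleftrightarrow> subspace S \<and> Z \<subseteq> S \<and> S \<subseteq> W \<and> (\<forall>x\<in>S. \<forall>y\<in>S. br x y \<in> S)
    \<and> (\<exists>n. tower S U T n \<subseteq> U)" for S
  have "good Z"
  proof -
    have "subspace Z" unfolding Z_def
      using W(1) U by (auto simp: subspace_def br_add br_scale)
    moreover have "br x y \<in> Z" if "x \<in> Z" "y \<in> Z" for x y
      using that W WU U by (auto simp: Z_def br_br intro!: subspace_diff)
    moreover have "tower Z U T 1 \<subseteq> U"
      unfolding One_nat_def by (rule tower_Suc_least) (use U in \<open>auto simp: Z_def\<close>)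
    ultimately show ?thesis unfolding good_def Z_def by blast
  qed
  moreover have "\<forall>S. good S \<longrightarrow> dim S \<le> dimension" using dim_subset_UNIV by blast
  ultimately have "\<exists>S. good S \<and> (\<forall>S'. good S' \<longrightarrow> dim S' \<le> dim S)"
    using ex_has_greatest_nat[of good Z dim "Suc dimension"] by (simp add: less_Suc_eq_le)
  then obtain S where S: "good S" and max: "\<And>S'. good S' \<Longrightarrow> dim S' \<le> dim S"
    by blast
  note sub = S[unfolded good_def]
  have ST: "br s t \<in> T" if "s \<in> S" "t \<in> T" for s t using that sub WT by blast
  obtain n where n: "tower S U T n \<subseteq> U" using sub by blast
  define Ti where "Ti i = tower S U T i" for i
  have Ti: "subspace (Ti i)" "Ti (Suc i) \<subseteq> Ti i" "U \<subseteq> Ti i" "Ti i \<subseteq> T" for i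
    unfolding Ti_def using subspace_tower[OF T] tower_dec[OF T UT ST] tower_base[OF UT] tower_subset[OF T UT ST]
    by auto
  have sTi: "br s t \<in> Ti (Suc i)" if "s \<in> S" "t \<in> Ti i" for s t i
    using that unfolding Ti_def by (rule br_in_tower)
  have Ti_anti: "Ti j \<subseteq> Ti i" if "i \<le> j" for i j
    by (rule lift_Suc_antimono_le[of Ti, OF Ti(2) that])
  have TiU: "Ti i \<subseteq> U" if "n \<le> i" for i
    using Ti_anti[OF that] n unfolding Ti_def by blast
  have "S = W"
  proof (rule ccontr)
    assume "S \<noteq> W"
    then have "\<not> W \<subseteq> S" using sub by blast
    have SW: "br s x \<in> W" if "s \<in> S" "x \<in> W" for s x using that sub W by blast
    have W0: "{0} \<subseteq> W" using W by (simp add: subspace_0)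
    \<comment> \<open>Bracketing \<open>k\<close> times with \<open>S\<close> raises the level by
      \<open>k\<close>. The one factor from \<open>W\<close> may lose up to \<open>n\<close> levels,
      no more, because it preserves both \<open>T\<close> and \<open>U\<close> and level
      \<open>n\<close> lies in \<open>U\<close>.\<close>
    have deg: "br x t \<in> Ti (i + k - n)" if "x \<in> tower S {0} W k" "t \<in> Ti i" for x t i k
      using that
    proof (induction k arbitrary: x t i)
      case 0
      then have x: "x \<in> W" by simp
      show ?case
      proof (cases "n \<le> i")
        case True
        then show ?thesis using WU[OF x] 0 TiU Ti(3) by blast
      next
        case False
        then show ?thesis using WT[OF x] 0 Ti(4) by (auto simp: Ti_def)
      qed
    next
      case (Suc k)
      let ?X = "{x. \<forall>i. \<forall>t\<in>Ti i. br x t \<in> Ti (i + Suc k - n)}"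
      have "tower S {0} W (Suc k) \<subseteq> ?X"
      proof (rule tower_Suc_least)
        show "subspace ?X"
          using Ti(1) by (auto simp: subspace_def br_add br_scale)
        show "{0} \<subseteq> ?X" using Ti(1) by (auto intro: subspace_0)
        show "br s y \<in> ?X" if s: "s \<in> S" and y: "y \<in> tower S {0} W k" for s y
        proof (clarify)
          fix i t assume t: "t \<in> Ti i"
          have "br s (br y t) \<in> Ti (Suc (i + k - n))" using sTi[OF s] Suc.IH[OF y t] by blast
          moreover have "Ti (Suc (i + k - n)) \<subseteq> Ti (i + Suc k - n)" by (rule Ti_anti) simp
          moreover have "br y (br s t) \<in> Ti (i + Suc k - n)"
            using Suc.IH[OF y sTi[OF s t]] by simp
          ultimately show "br (br s y) t \<in> Ti (i + Suc k - n)"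
            using Ti(1) unfolding br_br by (intro subspace_diff) auto
        qed
      qed
      then show ?case using Suc.prems by blast
    qed
    \<comment> \<open>With \<open>2 * n\<close> factors, \<open>n\<close> levels remain: elements of
      this term map \<open>T\<close> into \<open>U\<close> and so belong to
      \<open>Z\<close>.\<close>
    have twoN: "tower S {0} W (2 * n) \<subseteq> S"
    proof
      fix x assume x: "x \<in> tower S {0} W (2 * n)"
      have "br x t \<in> U" if "t \<in> T" for t
        using deg[OF x, of t 0] that TiU[of n] by (auto simp: Ti_def)
      moreover have "x \<in> W" using x tower_subset[OF W(1) W0 SW] by blast
      ultimately show "x \<in> S" using sub by (auto simp: Z_def)
    qed
    \<comment> \<open>Minimality of \<open>k\<close> gives an element outside \<open>S\<close>, one
      term earlier, that every element of \<open>S\<close> brackets into \<open>S\<close>.\<close>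
    obtain k where k: "tower S {0} W k \<subseteq> S" "\<And>j. j < k \<Longrightarrow> \<not> tower S {0} W j \<subseteq> S"
      using exists_least_iff[of "\<lambda>k. tower S {0} W k \<subseteq> S"] twoN by blast
    have "k \<noteq> 0" using k(1) \<open>\<not> W \<subseteq> S\<close> by (metis tower.simps(1))
    then obtain k' where k': "k = Suc k'" by (cases k) auto
    then obtain x where x: "x \<in> tower S {0} W k'" "x \<notin> S" using k(2)[of k'] by blast
    have xW: "x \<in> W" using x tower_subset[OF W(1) W0 SW] by blast
    have sx: "br s x \<in> S" if "s \<in> S" for s
      using br_in_tower[OF that x(1)] k(1) k' by blast
    have xs: "br x s \<in> S" if "s \<in> S" for s
      using sx[OF that] sub br_in by blast
    define S' where "S' = span (insert x S)"
    have spS: "span S = S" using sub by simp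
    have S'E: "\<exists>c s. s \<in> S \<and> y = s + c \<cdot> x" if y: "y \<in> S'" for y
    proof -
      obtain c where "y - c \<cdot> x \<in> S" using y spS by (auto simp: S'_def span_breakdown_eq)
      then show ?thesis by (intro exI[of _ c] exI[of _ "y - c \<cdot> x"]) simp
    qed
    have SS': "S \<subseteq> S'" "x \<in> S'" unfolding S'_def by (auto intro: span_base)
    have subS': "subspace S'" unfolding S'_def by simp
    have "x \<notin> span S" using x(2) unfolding spS .
    then have "dim S' = dim S + 1" by (simp add: S'_def dim_insert)
    moreover have "good S'"
    proof -
      have "br y z \<in> S'" if "y \<in> S'" "z \<in> S'" for y z
      proof -
        obtain c s where y: "s \<in> S" "y = s + c \<cdot> x" using S'E[OF \<open>y \<in> S'\<close>] by blast
        obtain c' s' where z: "s' \<in> S" "z = s' + c' \<cdot> x" using S'E[OF \<open>z \<in> S'\<close>] by blast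
        note * = y(1) z(1) y(2) z(2)
        have "br y z = br s s' + c' \<cdot> br s x + c \<cdot> br x s'"
          by (simp add: * br_add br_scale br_self algebra_simps)
        also have "\<dots> \<in> S"
        proof -
          have "br s s' \<in> S" "subspace S" using y(1) z(1) sub by blast+
          then show ?thesis
            using sx[OF y(1)] xs[OF z(1)] by (intro subspace_add subspace_scale)
        qed
        finally show ?thesis using SS' by blast
      qed
      moreover have "S' \<subseteq> W"
        unfolding S'_def using sub xW W(1) by (intro span_minimal) auto
      moreover have "\<exists>n. tower S' U T n \<subseteq> U"
      proof -
        obtain m where m: "\<And>t. t \<in> T \<Longrightarrow> (br x ^^ m) t \<in> U"
          using eventually_in_uniform[OF lin_br U WU[OF xW] T nil[OF xW]] by blast
        have xTi: "br x t \<in> Ti i" if "t \<in> Ti i" for t i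
          using that tower_invariant[OF T UT xs WT[OF xW] WU[OF xW]] unfolding Ti_def by blast
        have powTi: "(br x ^^ k) t \<in> Ti i" if "t \<in> Ti i" for t i k
          using that by (induction k) (auto intro: xTi)
        have "\<exists>j. tower S' U T j \<subseteq> Ti i" for i
        proof (induction i)
          case 0
          show ?case by (rule exI[of _ 0]) (simp add: Ti_def)
        next
          case (Suc i)
          then obtain j where j: "tower S' U T j \<subseteq> Ti i" by blast
          \<comment> \<open>A refinement between two consecutive levels: \<open>S\<close> sends each
            \<open>X k\<close> into the lower level, \<open>x\<close> sends \<open>X k\<close> to
            \<open>X (Suc k)\<close>, and nilpotency of \<open>x\<close> modulo \<open>U\<close>
            ends the chain.\<close>
          define X where "X k = span (Ti (Suc i) \<union> (br x ^^ k) ` Ti i)" for k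
          have XT: "Ti (Suc i) \<subseteq> X k" "subspace (X k)" for k
            unfolding X_def by (auto intro: span_base)
          have "tower S' U T (k + j) \<subseteq> X k" for k
          proof (induction k)
            case 0
            have "Ti i \<subseteq> X 0" unfolding X_def by (auto intro: span_base)
            then show ?case using j by auto
          next
            case (Suc k)
            have "br y t \<in> X (Suc k)" if y: "y \<in> S'" and t: "t \<in> X k" for y t
            proof -
              obtain c s where s: "s \<in> S" "y = s + c \<cdot> x" using S'E[OF y] by blast
              have "br y t \<in> X (Suc k)" if t: "t \<in> Ti (Suc i) \<union> (br x ^^ k) ` Ti i" for t
              proof -
                have tTi: "t \<in> Ti i" using t Ti(2) powTi by blast
                have "br s t \<in> X (Suc k)" using sTi[OF s(1) tTi] XT by blast
                moreover have "br x t \<in> X (Suc k)"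
                proof (cases "t \<in> Ti (Suc i)")
                  case True
                  then show ?thesis using xTi XT by blast
                next
                  case False
                  then obtain u where "u \<in> Ti i" "t = (br x ^^ k) u" using t by blast
                  then have "br x t \<in> (br x ^^ Suc k) ` Ti i" by auto
                  then show ?thesis unfolding X_def by (intro span_base) blast
                qed
                ultimately show ?thesis
                  using XT(2) by (simp add: s(2) br_add br_scale subspace_add subspace_scale)
              qed
              then show ?thesis
                using span_lin_image[of t _ "br y" "X (Suc k)"] t lin_br XT(2) unfolding X_def[of k] by blast
            qed
            moreover have "U \<subseteq> X (Suc k)" using Ti(3) XT(1) by blast
            ultimately show ?case
              using Suc XT(2) unfolding add_Suc by (intro tower_Suc_least) blast+
          qed
          moreover have "X m \<subseteq> Ti (Suc i)"
          proof -
            have "(br x ^^ m) ` Ti i \<subseteq> Ti (Suc i)" using m Ti(3) Ti(4) by blast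
            then show ?thesis unfolding X_def using Ti(1) by (intro span_minimal) auto
          qed
          ultimately show ?case by blast
        qed
        then show ?thesis using TiU[of n] by (metis order.refl order.trans)
      qed
      ultimately show ?thesis
        unfolding good_def using sub subS' SS' by blast
    qed
    ultimately show False using max[of S'] by simp
  qed
  then show ?thesis using n by blast
qed

text \<open>By the Leibniz rule, \<open>shift\<close> by \<open>c + d\<close> of the bracket is a
  sum of two brackets in which one factor needs a smaller exponent.\<close>

lemma geig_bracket:
  assumes a: "a \<in> geig (br x) c" and b: "b \<in> geig (br x) d"
  shows "br a b \<in> geig (br x) (c + d)"
proof -
  note L = lin_br[of x]
  have "br a b \<in> geig (br x) (c + d)"
    if "(shift (br x) c ^^ m) a = 0" "(shift (br x) d ^^ n) b = 0" for m n a b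
    using that
  proof (induction "m + n" arbitrary: m n a b rule: less_induct)
    case less
    show ?case
    proof (cases "m = 0 \<or> n = 0")
      case True
      then have "br a b = 0" using less.prems by auto
      then show ?thesis using subspace_0[OF subspace_geig[OF L]] by simp
    next
      case False
      then obtain m' n' where mn: "m = Suc m'" "n = Suc n'" by (metis not0_implies_Suc)
      have "br (shift (br x) c a) b \<in> geig (br x) (c + d)"
        using less.hyps[of m' n "shift (br x) c a" b] less.prems mn by (simp add: funpow_swap1)
      moreover have "br a (shift (br x) d b) \<in> geig (br x) (c + d)"
        using less.hyps[of m n' a "shift (br x) d b"] less.prems mn by (simp add: funpow_swap1)
      moreover have "shift (br x) (c + d) (br a b) = br (shift (br x) c a) b + br a (shift (br x) d b)"
        by (simp add: shift_def br_derivation[of x a b] br_diff br_scale algebra_simps)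
      ultimately have "shift (br x) (c + d) (br a b) \<in> geig (br x) (c + d)"
        using subspace_geig[OF L] by (simp add: subspace_add)
      then show ?thesis using shift_in_geig_iff[OF L] by blast
    qed
  qed
  then show ?thesis using a b by (auto simp: geig_def)
qed

end

section \<open>The Killing form on a perfect ideal\<close>

context complex_lie
begin

text \<open>\<open>br e\<close> moves generalized eigenvalues of \<open>br x\<close> by
  \<open>c\<close>, and there are only finitely many of them.\<close>

lemma nilpotent_geig:
  assumes e: "e \<in> geig (br x) c" and c: "c \<noteq> 0"
  shows "\<exists>n. \<forall>v. (br e ^^ n) v = 0"
proof -
  note L = lin_br[of x]
  have "\<exists>k. (br e ^^ k) v \<in> {0}" if v: "v \<in> geig (br x) d" for v d
  proof (rule ccontr)
    assume no: "\<nexists>k. (br e ^^ k) v \<in> {0}"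
    have g: "(br e ^^ k) v \<in> geig (br x) (d + of_nat k * c)" for k
    proof (induction k)
      case (Suc k)
      have "br e ((br e ^^ k) v) \<in> geig (br x) (c + (d + of_nat k * c))"
        by (rule geig_bracket[OF e Suc])
      then show ?case by (simp add: algebra_simps)
    qed (use v in simp)
    have "range (\<lambda>k. d + of_nat k * c) \<subseteq> {c. \<exists>v\<in>geig (br x) c. v \<noteq> 0}"
      using g no by auto
    then have "finite (range (\<lambda>k::nat. d + of_nat k * c))"
      using finite_eigenvalues[OF L] finite_subset by blast
    moreover have "inj (\<lambda>k::nat. d + of_nat k * c)"
      using c by (intro injI) simp
    ultimately show False using finite_imageD by blast
  qed
  then have "(\<Union>c. geig (br x) c \<inter> UNIV) \<subseteq> {v. \<exists>k. (br e ^^ k) v \<in> {0}}"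
    by blast
  moreover have "subspace {v. \<exists>k. (br e ^^ k) v \<in> {0}}"
    by (rule subspace_eventually_in[OF lin_br]) simp_all
  ultimately have "v \<in> {v. \<exists>k. (br e ^^ k) v \<in> {0}}" for v
    using geig_decomposition[OF L subspace_UNIV, of v] span_in by blast
  then show ?thesis using nilpotent_uniform[OF lin_br] by simp
qed

definition killing :: "'b \<Rightarrow> 'b \<Rightarrow> complex" where
  "killing x y = trace (\<lambda>v. br x (br y v))"

lemma killing_sym: "killing x y = killing y x"
  unfolding killing_def by (rule trace_commute[OF lin_br lin_br])

lemma linform_killing: "linform (killing x)"
  unfolding killing_def
  by (intro linformI) (simp_all add: br_add br_scale trace_add trace_scale)

lemma linform_killing_left: "linform (\<lambda>x. killing x y)"
  unfolding killing_sym[of _ y] by (rule linform_killing)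

lemma killing_br: "killing (br x y) z = killing x (br y z)"
proof -
  have "killing (br x y) z = trace (\<lambda>v. br x (br y (br z v))) - trace (\<lambda>v. br y (br x (br z v)))"
    unfolding killing_def br_br by (rule trace_diff)
  also have "trace (\<lambda>v. br y (br x (br z v))) = trace (\<lambda>v. br x (br z (br y v)))"
    by (rule trace_commute[OF lin_br lin_comp[OF lin_br lin_br]])
  also have "trace (\<lambda>v. br x (br y (br z v))) - \<dots> = killing x (br y z)"
    unfolding killing_def br_br br_diff by (rule trace_diff[symmetric])
  finally show ?thesis .
qed

end

text \<open>Instantiated in \<open>solvable\<close> by the stationary term of the derived series,
  assumed nonzero.\<close>

locale perfect_ideal = complex_lie scale Basis br
  for scale :: "complex \<Rightarrow> 'b::ab_group_add \<Rightarrow> 'b" (infixr \<open>\<cdot>\<close> 75) and Basis br +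
  fixes p :: "'b set"
  assumes subspace_p: "subspace p" and ideal_p: "y \<in> p \<Longrightarrow> br x y \<in> p"
    and perfect_p: "p \<subseteq> span {br a b | a b. a \<in> p \<and> b \<in> p}" and nontrivial_p: "p \<noteq> {0}"
begin

text \<open>The form is the Killing form of the whole algebra, not that of \<open>p\<close>. This
  yields nilpotency on the whole space in \<open>nilpotent_J\<close>.\<close>

definition J :: "'b set" where
  "J = {x \<in> p. \<forall>y\<in>p. killing x y = 0}"

lemma subspace_J: "subspace J"
  unfolding J_def using subspace_p
  by (auto simp: subspace_def linform_0[OF linform_killing_left]
      linform_add[OF linform_killing_left] linform_scale[OF linform_killing_left])

lemma J_p: "J \<subseteq> p"
  by (auto simp: J_def)

lemma ideal_J: "x \<in> J \<Longrightarrow> br g x \<in> J"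
proof -
  assume x: "x \<in> J"
  have "killing (br x g) y = 0" if "y \<in> p" for y
    using x ideal_p[OF that] by (simp add: killing_br J_def)
  moreover have "br x g \<in> p" using x J_p ideal_p br_in[OF subspace_p] by blast
  ultimately have "br x g \<in> J" by (simp add: J_def)
  then show ?thesis by (rule br_in[OF subspace_J])
qed

lemma ideal_J': "x \<in> J \<Longrightarrow> br x g \<in> J"
  by (rule br_in[OF subspace_J]) (rule ideal_J)

text \<open>
  Cartan's argument: \<open>T\<close>, which acts as the conjugate of the eigenvalue on each generalized
  eigenspace of \<open>br x\<close>, is a derivation.
\<close>

lemma nilpotent_J:
  assumes x: "x \<in> J"
  shows "\<exists>n. \<forall>v. (br x ^^ n) v = 0"
proof -
  note L = lin_br[of x]
  obtain T where T: "lin T" "\<And>c v. v \<in> geig (br x) c \<Longrightarrow> T v = cnj c \<cdot> v"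
    using spectral_function[OF L, of cnj] by blast
  \<comment> \<open>The goal is \<open>\<tau> x = 0\<close>. As \<open>x\<close> is a sum of
    brackets in \<open>p\<close>, it is enough to treat those brackets.\<close>
  define \<tau> where "\<tau> y = trace (\<lambda>v. T (br y v))" for y
  have \<tau>: "linform \<tau>"
    unfolding \<tau>_def
    by (intro linformI) (simp_all add: br_add br_scale lin_add[OF T(1)] lin_scale[OF T(1)] trace_add trace_scale)
  have der: "T (br a v) = cnj c \<cdot> br a v + br a (T v)" if a: "a \<in> geig (br x) c" for a c v
  proof (rule lin_eq_on_span[of v "\<Union>c. geig (br x) c \<inter> UNIV"])
    show "v \<in> span (\<Union>c. geig (br x) c \<inter> UNIV)"
      using geig_decomposition[OF L subspace_UNIV] by blast
    show "lin (\<lambda>v. T (br a v))" by (rule lin_comp[OF T(1) lin_br])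
    show "lin (\<lambda>v. cnj c \<cdot> br a v + br a (T v))"
      by (rule lin_plus[OF lin_smult[OF lin_br] lin_comp[OF lin_br T(1)]])
    show "T (br a b) = cnj c \<cdot> br a b + br a (T b)" if b: "b \<in> (\<Union>c. geig (br x) c \<inter> UNIV)" for b
    proof -
      obtain d where d: "b \<in> geig (br x) d" using b by blast
      show ?thesis
        using T(2)[OF geig_bracket[OF a d]] T(2)[OF d]
        by (simp add: br_scale scale_left_distrib)
    qed
  qed
  \<comment> \<open>The derivation property turns \<open>\<tau> (br a b)\<close> into
    \<open>cnj c * killing a b\<close>. Either \<open>c\<close> is zero, or \<open>br x\<close> is
    invertible on this part of \<open>p\<close>, so that \<open>a\<close> is a bracket with
    \<open>x\<close> and lies in \<open>J\<close>.\<close>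
  have \<tau>_geig: "\<tau> (br a b) = 0" if a: "a \<in> geig (br x) c" "a \<in> p" and b: "b \<in> p" for a b c
  proof -
    have "\<tau> (br a b) = trace (\<lambda>v. T (br a (br b v))) - trace (\<lambda>v. T (br b (br a v)))"
      unfolding \<tau>_def br_br lin_diff[OF T(1)] by (rule trace_diff)
    also have "trace (\<lambda>v. T (br b (br a v))) = trace (\<lambda>v. br a (T (br b v)))"
      by (rule trace_commute[OF lin_comp[OF T(1) lin_br] lin_br])
    also have "trace (\<lambda>v. T (br a (br b v))) = cnj c * killing a b + trace (\<lambda>v. br a (T (br b v)))"
      unfolding der[OF a(1)] trace_add trace_scale killing_def ..
    finally have *: "\<tau> (br a b) = cnj c * killing a b" by simp
    show ?thesis
    proof (cases "c = 0")
      case False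
      have "\<exists>w\<in>geig (br x) c \<inter> p. shift (br x) 0 w = a"
        using shift_other_surj[OF L subspace_p ideal_p _ a(1,2), of 0] False by auto
      then obtain w where "br x w = a" by (auto simp: shift_0)
      then have "a \<in> J" using ideal_J'[OF x] by blast
      then show ?thesis using * b by (simp add: J_def)
    qed (simp add: *)
  qed
  have \<tau>_p: "\<tau> (br a b) = 0" if a: "a \<in> p" and b: "b \<in> p" for a b
  proof (rule linform_eq_on_span[of a "\<Union>c. geig (br x) c \<inter> p" "\<lambda>a. \<tau> (br a b)" "\<lambda>_. 0"])
    show "a \<in> span (\<Union>c. geig (br x) c \<inter> p)"
      by (rule geig_decomposition[OF L subspace_p ideal_p a])
    show "linform (\<lambda>a. \<tau> (br a b))"
      by (intro linformI) (simp_all add: br_add br_scale linform_add[OF \<tau>] linform_scale[OF \<tau>])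
  qed (use \<tau>_geig b in \<open>auto intro: linformI\<close>)
  have "x \<in> span {br a b | a b. a \<in> p \<and> b \<in> p}" using x J_p perfect_p by blast
  then have "\<tau> x = 0"
    by (rule linform_eq_on_span[of x _ \<tau> "\<lambda>_. 0"]) (use \<tau>_p \<tau> in \<open>auto intro: linformI\<close>)
  then show ?thesis
    unfolding \<tau>_def using nilpotent_if_trace_conjugate_0[OF L T] by blast
qed

text \<open>Perfectness keeps the series from descending, so the conclusion of \<open>engel\<close>
  for \<open>p\<close> acting on itself modulo \<open>U\<close> would force \<open>p\<close> into
  \<open>U\<close>.\<close>

lemma p_subset_tower: "p \<subseteq> tower p U p n"
proof (induction n)
  case (Suc n)
  have "p \<subseteq> span {br a b | a b. a \<in> p \<and> b \<in> p}" by (rule perfect_p)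
  also have "\<dots> \<subseteq> tower p U p (Suc n)"
    unfolding tower.simps(2) using Suc by (intro span_mono) blast
  finally show ?case .
qed simp

lemma J_neq_p: "\<not> p \<subseteq> J"
proof
  assume pJ: "p \<subseteq> J"
  have "\<exists>n. tower p {0} p n \<subseteq> {0}"
  proof (rule engel)
    show "\<exists>n. (br x ^^ n) t \<in> {0}" if "x \<in> p" for x t
      using nilpotent_J pJ that by blast
  qed (use subspace_p ideal_p in \<open>auto simp: subspace_0\<close>)
  then have "p \<subseteq> {0}" using p_subset_tower by blast
  then show False using nontrivial_p subspace_0[OF subspace_p] by blast
qed

text \<open>By \<open>engel\<close> some \<open>x\<close> does not act nilpotently modulo
  \<open>J\<close>. Then some generalized eigenvector \<open>e\<close> of \<open>br x\<close> in
  \<open>p\<close> is never brought into \<open>J\<close>; its eigenvalue is nonzero, so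
  \<open>nilpotent_geig\<close> applies.\<close>

lemma nilpotent_outside_J:
  obtains e where "e \<in> p" "e \<notin> J" "\<exists>n. \<forall>v. (br e ^^ n) v = 0"
proof -
  have "\<exists>x\<in>p. \<exists>t\<in>p. \<forall>n. (br x ^^ n) t \<notin> J"
  proof (rule ccontr)
    assume no: "\<not> ?thesis"
    have "\<exists>n. tower p J p n \<subseteq> J"
    proof (rule engel)
      show "\<exists>n. (br x ^^ n) t \<in> J" if "x \<in> p" "t \<in> p" for x t
        using no that by blast
    qed (use subspace_p subspace_J ideal_p ideal_J J_p in auto)
    then show False using p_subset_tower J_neq_p by blast
  qed
  then obtain x t where x: "x \<in> p" "t \<in> p" "\<And>n. (br x ^^ n) t \<notin> J" by blast
  note L = lin_br[of x]
  have sub: "subspace {v. \<exists>k. (br x ^^ k) v \<in> J}"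
    by (rule subspace_eventually_in[OF L subspace_J ideal_J])
  have "t \<notin> {v. \<exists>k. (br x ^^ k) v \<in> J}" using x(3) by blast
  then have "\<not> (\<Union>c. geig (br x) c \<inter> p) \<subseteq> {v. \<exists>k. (br x ^^ k) v \<in> J}"
    using geig_decomposition[OF L subspace_p ideal_p x(2)] sub span_in by blast
  then obtain c e where e: "e \<in> geig (br x) c" "e \<in> p" "\<And>k. (br x ^^ k) e \<notin> J" by blast
  have "c \<noteq> 0"
  proof
    assume "c = 0"
    then obtain k where "(br x ^^ k) e = 0" using e(1) by (auto simp: geig_def shift_0)
    then show False using e(3)[of k] subspace_0[OF subspace_J] by simp
  qed
  moreover have "e \<notin> J" using e(3)[of 0] by simp
  ultimately show thesis using that e(2) nilpotent_geig[OF e(1)] by blast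
qed

text \<open>The whole space is put on top of the lower central series of \<open>J\<close>, so that
  \<open>J\<close> lowers every term, the first included.\<close>

primrec filt :: "nat \<Rightarrow> 'b set" where
  "filt 0 = UNIV"
| "filt (Suc i) = tower J {0} J i"

lemma filt_properties:
  "subspace (filt i)" "filt (Suc i) \<subseteq> filt i" "v \<in> filt i \<Longrightarrow> br g v \<in> filt i"
  "x \<in> J \<Longrightarrow> v \<in> filt i \<Longrightarrow> br x v \<in> filt (Suc i)" "filt (Suc i) \<subseteq> J"
proof -
  have 0: "{0} \<subseteq> J" using subspace_0[OF subspace_J] by simp
  show "subspace (filt i)" by (cases i) (simp_all add: subspace_tower subspace_J)
  show "filt (Suc i) \<subseteq> filt i"
    using tower_dec[OF subspace_J 0 ideal_J, of J] by (cases i) simp_all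
  show "br g v \<in> filt i" if "v \<in> filt i"
    using tower_invariant[OF subspace_J 0 ideal_J ideal_J, of g v] that by (cases i) simp_all
  show "br x v \<in> filt (Suc i)" if "x \<in> J" "v \<in> filt i"
    using that br_in_tower[of x J v "{0}" J "i - 1"] ideal_J'[of x v] by (cases i) simp_all
  show "filt (Suc i) \<subseteq> J"
    using tower_subset[OF subspace_J 0 ideal_J, of J i] by simp
qed

lemma filt_trivial: "\<exists>n. filt n = {0}"
proof -
  have "\<exists>n. tower J {0} J n \<subseteq> {0}"
  proof (rule engel)
    show "\<exists>n. (br x ^^ n) t \<in> {0}" if "x \<in> J" for x t
      using nilpotent_J[OF that] by blast
  qed (use subspace_J ideal_J in \<open>auto simp: subspace_0\<close>)
  then obtain n where "filt (Suc n) \<subseteq> {0}" by auto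
  then have "filt (Suc n) = {0}" using subspace_0[OF filt_properties(1)] by blast
  then show ?thesis by blast
qed

text \<open>
  The associated graded of \<open>filt\<close> is a representation with \<open>J\<close> in its kernel and trace form
  \<open>killing\<close>. A nilpotent element outside \<open>J\<close> completes to an sl2 triple there (Jacobson--Morozov),
  and the first two members of the triple are then corrected within \<open>J\<close>, one step of the
  filtration at a time, until \<open>br h e = 2 \<cdot> e\<close> holds exactly.
\<close>

theorem sl2_pair:
  "\<exists>e h. e \<noteq> 0 \<and> br h e = 2 \<cdot> e \<and> (\<forall>z. br e z = 0 \<longrightarrow> br h z = (-2) \<cdot> z \<longrightarrow> z = 0)"
proof -
  obtain N where N: "filt N = {0}" using filt_trivial by blast
  define stab where "stab = filtered_ops filt"
  obtain G where
    G1: "\<And>T. T \<in> stab \<Longrightarrow> lin (G T)" "\<And>T. T \<in> stab \<Longrightarrow> trace (G T) = trace T" and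
    Gmult: "\<And>S T. S \<in> stab \<Longrightarrow> T \<in> stab \<Longrightarrow> G (\<lambda>x. S (T x)) = (\<lambda>x. G S (G T x))" and
    Gadd: "\<And>S T. G (\<lambda>x. S x + T x) = (\<lambda>x. G S x + G T x)" and
    Gscale: "\<And>c T. G (\<lambda>x. c \<cdot> T x) = (\<lambda>x. c \<cdot> G T x)" and
    Gid: "G (\<lambda>x. x) = (\<lambda>x. x)" and
    Gstrict: "\<And>T. \<forall>i. \<forall>v\<in>filt i. T v \<in> filt (Suc i) \<Longrightarrow> G T = (\<lambda>x. 0)" and
    Geig: "\<And>z. z \<noteq> 0 \<Longrightarrow> \<exists>y. y \<noteq> 0 \<and> (\<forall>T\<in>stab. \<forall>c. T z = c \<cdot> z \<longrightarrow> G T y = c \<cdot> y)" and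
    Gsurj: "\<And>A B i w. A \<in> stab \<Longrightarrow> B \<in> stab \<Longrightarrow> \<forall>v. \<exists>a b. v = G A a + G B b \<Longrightarrow> w \<in> filt i \<Longrightarrow>
      \<exists>a\<in>filt i. \<exists>b\<in>filt i. w - A a - B b \<in> filt (Suc i)"
    by (rule graded_operators[OF filt_properties(1,2) N filt.simps(1), folded stab_def]) (rule that)
  have stab_br: "br x \<in> stab" for x
    unfolding stab_def filtered_ops_def using lin_br filt_properties(3) by auto
  have stab_id: "(\<lambda>x. x) \<in> stab" by (simp add: stab_def filtered_ops_def lin_ident)
  have stab_scale: "(\<lambda>x. c \<cdot> T x) \<in> stab" if "T \<in> stab" for c T
    using that filt_properties(1) by (auto simp: stab_def filtered_ops_def lin_smult subspace_scale)
  have stab_comp: "(\<lambda>x. S (T x)) \<in> stab" if "S \<in> stab" "T \<in> stab" for S T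
    using that by (auto simp: stab_def filtered_ops_def intro: lin_comp)
  have stab_add: "(\<lambda>x. S x + T x) \<in> stab" if "S \<in> stab" "T \<in> stab" for S T
    using that filt_properties(1) by (auto simp: stab_def filtered_ops_def intro: lin_plus subspace_add)
  define \<rho> where "\<rho> x = G (br x)" for x
  have lin_\<rho>: "lin (\<rho> x)" for x unfolding \<rho>_def by (rule G1(1)[OF stab_br])
  have \<rho>_add: "\<rho> (x + y) v = \<rho> x v + \<rho> y v" for x y v
    using Gadd[of "br x" "br y"] by (simp add: \<rho>_def br_add[abs_def])
  have \<rho>_scale: "\<rho> (c \<cdot> x) v = c \<cdot> \<rho> x v" for c x v
    using Gscale[of c "br x"] by (simp add: \<rho>_def br_scale[abs_def])
  have \<rho>_diff: "\<rho> (x - y) v = \<rho> x v - \<rho> y v" for x y v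
    using \<rho>_add[of "x - y" y v] by simp
  have \<rho>_J: "\<rho> j v = 0" if "j \<in> J" for j v
    unfolding \<rho>_def using Gstrict[of "br j"] filt_properties(4)[OF that] by simp
  have \<rho>_cong: "\<rho> x v = \<rho> y v" if "x - y \<in> J" for x y v
    using \<rho>_J[OF that, of v] by (simp add: \<rho>_diff)
  have \<rho>_br: "\<rho> (br x y) v = \<rho> x (\<rho> y v) - \<rho> y (\<rho> x v)" for x y v
  proof -
    have "\<rho> (br x y) = G (\<lambda>v. br x (br y v) + (-1) \<cdot> br y (br x v))"
      unfolding \<rho>_def by (rule arg_cong[of _ _ G]) (simp add: fun_eq_iff br_br)
    also have "\<dots> = (\<lambda>v. \<rho> x (\<rho> y v) + (-1) \<cdot> \<rho> y (\<rho> x v))"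
      unfolding \<rho>_def
      by (simp only: Gadd Gscale Gmult[OF stab_br stab_br])
    finally show ?thesis by simp
  qed
  have trace_\<rho>: "trace (\<lambda>v. \<rho> x (\<rho> y v)) = killing x y" for x y
    unfolding \<rho>_def killing_def
    using G1(2)[OF stab_comp[OF stab_br stab_br], of x y] by (simp add: Gmult[OF stab_br stab_br])

  obtain e n where e: "e \<in> p" "e \<notin> J" and n: "\<And>v. (br e ^^ n) v = 0"
    using nilpotent_outside_J by metis
  have nil: "(\<rho> e ^^ n) v = 0" for v
  proof -
    have "br e ^^ k \<in> stab \<and> G (br e ^^ k) = \<rho> e ^^ k" for k
    proof (induction k)
      case 0
      then show ?case using Gid stab_id by (simp add: id_def)
    next
      case (Suc k)
      then show ?case
        using stab_comp[OF stab_br, of "br e ^^ k" e] Gmult[OF stab_br, of "br e ^^ k" e]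
        by (simp add: o_def \<rho>_def)
    qed
    moreover have "br e ^^ n = (\<lambda>v. 0)" using n by blast
    ultimately have "G (\<lambda>v. 0) = \<rho> e ^^ n" by metis
    moreover have "G (\<lambda>v. 0) = (\<lambda>v. 0)"
      by (rule Gstrict) (simp add: subspace_0[OF filt_properties(1)] del: filt.simps)
    ultimately show ?thesis by metis
  qed

  \<comment> \<open>Otherwise a functional is 1 at \<open>e\<close> and 0 on \<open>J\<close> and on
    the image of \<open>p\<close> under \<open>br e\<close> applied twice. Represented by
    \<open>z\<close> through the Killing form, it gives \<open>br e (br e z) \<in> J\<close>, so
    that \<open>\<rho> e\<close> commutes with \<open>\<rho> (br e z)\<close>. Then
    \<open>trace_product_0\<close> yields \<open>killing z e = 0\<close>, a contradiction.\<close>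
  have "\<exists>f\<in>p. e - br e (br e f) \<in> J"
  proof (rule ccontr)
    assume no: "\<not> ?thesis"
    define W where "W = {x. \<exists>f\<in>p. x - br e (br e f) \<in> J}"
    have "subspace W"
    proof (rule subspaceI)
      show "0 \<in> W"
        using subspace_0[OF subspace_p] subspace_0[OF subspace_J] by (auto simp: W_def intro!: bexI[of _ 0])
    next
      fix x y assume "x \<in> W" "y \<in> W"
      then obtain f g where "f \<in> p" "x - br e (br e f) \<in> J" "g \<in> p" "y - br e (br e g) \<in> J"
        by (auto simp: W_def)
      then have "f + g \<in> p" "(x - br e (br e f)) + (y - br e (br e g)) \<in> J"
        using subspace_p subspace_J by (auto intro: subspace_add)
      then show "x + y \<in> W" by (auto simp: W_def br_add algebra_simps intro!: bexI[of _ "f + g"])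
    next
      fix c x assume "x \<in> W"
      then obtain f where "f \<in> p" "x - br e (br e f) \<in> J" by (auto simp: W_def)
      then have "c \<cdot> f \<in> p" "c \<cdot> (x - br e (br e f)) \<in> J"
        using subspace_p subspace_J by (auto intro: subspace_scale)
      then show "c \<cdot> x \<in> W" by (auto simp: W_def br_scale scale_right_diff_distrib intro!: bexI[of _ "c \<cdot> f"])
    qed
    moreover have "e \<notin> W" using no by (auto simp: W_def)
    ultimately obtain \<phi> where \<phi>: "linform \<phi>" "\<phi> e = 1" "\<And>w. w \<in> W \<Longrightarrow> \<phi> w = 0"
      using linform_separating by blast
    have JW: "J \<subseteq> W" using subspace_0[OF subspace_p] by (auto simp: W_def intro!: bexI[of _ 0])
    have eeW: "br e (br e f) \<in> W" if "f \<in> p" for f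
      using that subspace_0[OF subspace_J] by (auto simp: W_def intro!: bexI[of _ f])
    \<comment> \<open>The form degenerates on \<open>p\<close> exactly along \<open>J\<close>, so
      the functional is represented on a complement of \<open>J\<close>.\<close>
    obtain C where C: "subspace C" "C \<subseteq> p" "C \<inter> J = {0}" "\<forall>y\<in>p. \<exists>j\<in>J. y - j \<in> C"
      using subspace_complement[OF subspace_J subspace_p J_p] by (elim exE conjE) (rule that)
    have KJ: "killing z j = 0" if "j \<in> J" "z \<in> p" for z j
      using that by (simp add: killing_sym[of z] J_def)
    have "\<exists>z\<in>C. \<forall>y\<in>C. killing z y = \<phi> y"
    proof (rule form_represents[OF linform_killing_left linform_killing C(1) _ \<phi>(1)])
      fix z assume z: "z \<in> C" "\<And>y. y \<in> C \<Longrightarrow> killing z y = 0"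
      have "killing z y = 0" if y: "y \<in> p" for y
      proof -
        obtain j where j: "j \<in> J" "y - j \<in> C" using C(4) y by blast
        have "killing z y = killing z (y - j) + killing z j"
          using linform_add[OF linform_killing, of z "y - j" j] by simp
        then show ?thesis using z j KJ C(2) by auto
      qed
      then show "z = 0" using z(1) C(2,3) by (auto simp: J_def)
    qed
    then obtain z where z: "z \<in> C" "\<And>y. y \<in> C \<Longrightarrow> killing z y = \<phi> y" by blast
    have zp: "z \<in> p" using z C by blast
    have K\<phi>: "killing z y = \<phi> y" if y: "y \<in> p" for y
    proof -
      obtain j where j: "j \<in> J" "y - j \<in> C" using C(4) y by blast
      have "killing z y = killing z (y - j) + killing z j" "\<phi> y = \<phi> (y - j) + \<phi> j"
        using linform_add[OF linform_killing, of z "y - j" j] linform_add[OF \<phi>(1), of "y - j" j] by simp_all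
      then show ?thesis using z j KJ zp \<phi>(3) JW by auto
    qed
    have Ke: "killing (br e u) y = - killing u (br e y)" for u y
    proof -
      have "killing (br e u) y = - killing (br u e) y"
        using linform_scale[OF linform_killing_left, of "-1" "br u e" y] br_anti[of e u] by simp
      then show ?thesis by (simp add: killing_br)
    qed
    have "killing (br e (br e z)) y = 0" if y: "y \<in> p" for y
    proof -
      have "killing (br e (br e z)) y = killing z (br e (br e y))" by (simp add: Ke)
      also have "\<dots> = 0" using K\<phi> \<phi>(3) eeW y ideal_p by simp
      finally show ?thesis .
    qed
    moreover have "br e (br e z) \<in> p" using zp by (intro ideal_p)
    ultimately have eez: "br e (br e z) \<in> J" by (simp add: J_def)
    have "trace (\<lambda>x. \<rho> e (\<rho> z x)) = 0"
    proof (rule trace_product_0[OF lin_\<rho> lin_\<rho> nil, where D = "\<rho> (br e z)"])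
      show "\<rho> e (\<rho> (br e z) x) = \<rho> (br e z) (\<rho> e x)" for x
        using \<rho>_J[OF eez, of x] by (simp add: \<rho>_br[of e "br e z"])
    qed (rule \<rho>_br)
    then have "killing z e = 0" by (simp add: trace_\<rho> killing_sym[of z])
    then show False using K\<phi>[OF e(1)] \<phi>(2) by simp
  qed
  then obtain f0 where f0: "f0 \<in> p" "e - br e (br e f0) \<in> J" by blast
  \<comment> \<open>The factor makes \<open>br (br e f) e\<close> equal to
    \<open>2 \<cdot> br e (br e f0)\<close>, which is \<open>2 \<cdot> e\<close> modulo
    \<open>J\<close>.\<close>
  define f where "f = (-2) \<cdot> f0"
  define h0 where "h0 = br e f"
  have "br h0 e - 2 \<cdot> e = (-2) \<cdot> (e - br e (br e f0))"
    using br_anti[of "br e f0" e]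
    by (simp add: h0_def f_def br_scale br_neg scale_right_diff_distrib)
  then have h0e: "br h0 e - 2 \<cdot> e \<in> J" using f0(2) subspace_J subspace_scale by metis
  have HE: "\<rho> h0 (\<rho> e v) - \<rho> e (\<rho> h0 v) = 2 \<cdot> \<rho> e v" for v
    using \<rho>_cong[OF h0e, of v] by (simp add: \<rho>_br \<rho>_scale)
  have EF: "\<rho> e (\<rho> f v) - \<rho> f (\<rho> e v) = \<rho> h0 v" for v
    by (simp add: h0_def \<rho>_br)
  have "\<exists>h e'. h - h0 \<in> J \<and> e' - e \<in> J \<and> br h e' - 2 \<cdot> e' \<in> filt (Suc i)" for i
  proof (induction i)
    case 0
    then show ?case
      using h0e subspace_0[OF subspace_J] by (intro exI[of _ h0] exI[of _ e]) simp
  next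
    case (Suc i)
    then obtain h e' where he: "h - h0 \<in> J" "e' - e \<in> J" "br h e' - 2 \<cdot> e' \<in> filt (Suc i)" by blast
    define A where "A v = br h v + (-2) \<cdot> v" for v
    have A: "A \<in> stab" unfolding A_def by (rule stab_add[OF stab_br stab_scale[OF stab_id]])
    have GA: "G A v = \<rho> h0 v - 2 \<cdot> v" for v
    proof -
      have "G A v = \<rho> h v + (-2) \<cdot> v"
        unfolding A_def \<rho>_def
        by (simp only: Gadd Gscale Gid)
      then show ?thesis using \<rho>_cong[OF he(1)] by simp
    qed
    have GB: "G (br e') v = \<rho> e v" for v
      using \<rho>_cong[OF he(2)] by (simp add: \<rho>_def)
    have "\<forall>v. \<exists>a b. v = G A a + G (br e') b"
      unfolding GA GB by (intro allI) (rule sl2_cokernel[OF lin_\<rho> lin_\<rho> lin_\<rho> nil EF HE])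
    then obtain a b where ab: "a \<in> filt (Suc i)" "b \<in> filt (Suc i)"
      "(br h e' - 2 \<cdot> e') - A a - br e' b \<in> filt (Suc (Suc i))"
      using Gsurj[OF A stab_br _ he(3)] by blast
    have abJ: "a \<in> J" "b \<in> J" using ab filt_properties(5) by blast+
    \<comment> \<open>The terms linear in \<open>a\<close> and \<open>b\<close> cancel the error up
      to the next level; the quadratic term \<open>br b a\<close> lies there because
      \<open>b \<in> J\<close>.\<close>
    have "br (h + b) (e' - a) - 2 \<cdot> (e' - a) = ((br h e' - 2 \<cdot> e') - A a - br e' b) - br b a"
      using br_anti[of b e'] by (simp add: A_def br_add br_diff algebra_simps)
    also have "\<dots> \<in> filt (Suc (Suc i))"
      using ab(3) filt_properties(4)[OF abJ(2) ab(1)] filt_properties(1) subspace_diff by blast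
    finally have "br (h + b) (e' - a) - 2 \<cdot> (e' - a) \<in> filt (Suc (Suc i))" .
    moreover have "(h + b) - h0 \<in> J" "(e' - a) - e \<in> J"
      using subspace_add[OF subspace_J he(1) abJ(2)] subspace_diff[OF subspace_J he(2) abJ(1)]
      by (simp_all add: algebra_simps)
    ultimately show ?case by blast
  qed
  then obtain h e' where he: "h - h0 \<in> J" "e' - e \<in> J" "br h e' - 2 \<cdot> e' \<in> filt (Suc N)" by blast
  then have "br h e' - 2 \<cdot> e' = 0" using N filt_properties(2)[of N] by blast
  moreover have "e' \<noteq> 0" using he(2) e(2) subspace_neg[OF subspace_J, of "- e"] by auto
  \<comment> \<open>The corrected pair differs from \<open>e\<close>, \<open>h0\<close> by elements
    of \<open>J\<close> and has the same graded operators. \<open>Geig\<close> turns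
    \<open>z\<close> into a nonzero common eigenvector of these, against
    \<open>sl2_kernel\<close>.\<close>
  moreover have "z = 0" if z: "br e' z = 0" "br h z = (-2) \<cdot> z" for z
  proof (rule ccontr)
    assume "z \<noteq> 0"
    then obtain y where y: "y \<noteq> 0" "\<And>T c. T \<in> stab \<Longrightarrow> T z = c \<cdot> z \<Longrightarrow> G T y = c \<cdot> y"
      using Geig by blast
    have "\<rho> e y = 0"
      using y(2)[OF stab_br, of e' 0] z(1) \<rho>_cong[OF he(2), of y] by (simp add: \<rho>_def)
    moreover have "\<rho> h0 y = (-2) \<cdot> y"
      using y(2)[OF stab_br, of h "-2"] z(2) \<rho>_cong[OF he(1), of y] by (simp add: \<rho>_def)
    ultimately have "y = 0" by (rule sl2_kernel[OF lin_\<rho> lin_\<rho> lin_\<rho> nil EF HE])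
    then show False using y(1) by blast
  qed
  ultimately show ?thesis by (intro exI[of _ e'] exI[of _ h]) simp
qed

end

section \<open>Symplectic Lie algebras\<close>

context fin_dim_space
begin

lemma trace_ad_0:
  assumes lin: "\<And>x. lin (br x)" "\<And>y. lin (\<lambda>x. br x y)"
    and anti: "\<And>x y. br x y = - br y x"
    and rep: "\<And>x y z. br (br x y) z = br x (br y z) - br y (br x z)"
    and form: "\<And>y. linform (\<lambda>x. \<omega> x y)" "\<And>x. linform (\<omega> x)"
    and skew: "\<And>x y. \<omega> x y = - \<omega> y x"
    and nd: "\<And>z. (\<And>y. \<omega> z y = 0) \<Longrightarrow> z = 0"
    and closed: "\<And>x y z. \<omega> (br x y) z + \<omega> (br y z) x + \<omega> (br z x) y = 0"
    and D: "span {br x y | x y. True} \<inter> {x. \<forall>y\<in>span {br x y | x y. True}. \<omega> x y = 0} = {0}"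
    and two: "(2::'a) \<noteq> 0"
  shows "trace (br x) = 0"
proof -
  let ?D = "span {br x y | x y. True}"
  define \<tau> where "\<tau> x = trace (br x)" for x
  have \<tau>: "linform \<tau>"
  proof (rule linformI)
    have "br (x + y) = (\<lambda>z. br x z + br y z)" "br (c \<cdot> x) = (\<lambda>z. c \<cdot> br x z)" for x y c
      by (simp_all add: fun_eq_iff lin_add[OF lin(2)] lin_scale[OF lin(2)])
    then show "\<tau> (x + y) = \<tau> x + \<tau> y" "\<tau> (c \<cdot> x) = c * \<tau> x" for x y c
      by (simp_all add: \<tau>_def trace_add trace_scale)
  qed
  have represent: "\<exists>c. \<forall>y. \<omega> c y = \<phi> y" if "linform \<phi>" for \<phi>
    using form_represents[OF form subspace_UNIV _ that] nd by auto
  obtain c where c: "\<And>y. \<omega> c y = \<tau> y" using represent[OF \<tau>] by blast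
  have "\<tau> (br x y) = 0" for x y
    unfolding \<tau>_def rep trace_diff using trace_commute[OF lin(1) lin(1), of x y] by simp
  then have \<tau>D: "\<tau> y = 0" if "y \<in> ?D" for y
    by (intro linform_eq_on_span[OF that, of \<tau> "\<lambda>_. 0"]) (use \<tau> in \<open>auto intro: linformI\<close>)
  have \<tau>_orth: "\<tau> a = 0" if a: "\<And>y. y \<in> ?D \<Longrightarrow> \<omega> a y = 0" for a
  proof -
    have "\<omega> (br a y) z = \<omega> y (- br a z)" for y z
    proof -
      have "\<omega> (br y z) a = 0"
      proof -
        have "br y z \<in> ?D" by (rule span_base) blast
        then show ?thesis using a skew[of "br y z" a] by simp
      qed
      moreover have "\<omega> (br z a) y = \<omega> y (br a z)" "\<omega> y (- br a z) = - \<omega> y (br a z)"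
        using skew[of "br z a" y] anti[of z a] linform_scale[OF form(2), of y "-1" "br a z"]
        by simp_all
      ultimately show ?thesis using closed[of a y z] by (simp add: add_eq_0_iff2)
    qed
    then have "trace (br a) = trace (\<lambda>z. - br a z)"
      using trace_adjoint[OF form nd, of "\<lambda>z. - br a z" "br a"] lin_smult[OF lin(1), of "-1" a] lin(1)
      by simp
    then have "2 * \<tau> a = 0"
      using trace_scale[of "-1" "br a"] by (simp add: \<tau>_def)
    then show ?thesis using two by simp
  qed
  \<comment> \<open>Double orthogonality: a functional that is 1 at \<open>c\<close> and 0 on
    \<open>?D\<close> is \<open>\<omega> y\<close> with \<open>y\<close> orthogonal to
    \<open>?D\<close>, hence \<open>\<tau> y = 0\<close>. But
    \<open>\<tau> y = \<omega> c y = -1\<close>.\<close>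
  have "c \<in> ?D"
  proof (rule ccontr)
    assume "c \<notin> ?D"
    then obtain \<phi> where \<phi>: "linform \<phi>" "\<phi> c = 1" "\<And>w. w \<in> ?D \<Longrightarrow> \<phi> w = 0"
      using linform_separating[of ?D c] by auto
    obtain y where y: "\<And>x. \<omega> y x = \<phi> x" using represent[OF \<phi>(1)] by blast
    have "\<tau> y = 0" using \<tau>_orth y \<phi>(3) by simp
    then show False using c[of y] skew[of c y] y[of c] \<phi>(2) by simp
  qed
  then have "c = 0" using D c \<tau>D by auto
  then have "\<tau> x = 0" using c[of x] linform_0[OF form(1)] by simp
  then show ?thesis by (simp add: \<tau>_def)
qed

end

context complex_lie
begin

section \<open>The derived series of the complex algebra\<close>

primrec derived :: "nat \<Rightarrow> 'b set" where
  "derived 0 = UNIV"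
| "derived (Suc k) = span {br x y | x y. x \<in> derived k \<and> y \<in> derived k}"

lemma subspace_derived: "subspace (derived k)"
  by (cases k) simp_all

lemma derived_ideal: "y \<in> derived k \<Longrightarrow> br x y \<in> derived k"
proof (induction k arbitrary: y)
  case (Suc k)
  show ?case
  proof (rule span_lin_image[OF Suc.prems[unfolded derived.simps] lin_br _ subspace_derived])
    fix z assume "z \<in> {br x y | x y. x \<in> derived k \<and> y \<in> derived k}"
    then obtain a b where ab: "a \<in> derived k" "b \<in> derived k" "z = br a b" by blast
    have in_span: "br u v \<in> derived (Suc k)" if "u \<in> derived k" "v \<in> derived k" for u v
      unfolding derived.simps using that by (intro span_base) blast
    have "br (br x a) b \<in> derived (Suc k)" "br a (br x b) \<in> derived (Suc k)"
      using in_span Suc.IH ab by blast+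
    then show "br x z \<in> derived (Suc k)"
      unfolding ab(3) br_derivation[of x a b] using subspace_derived subspace_add by blast
  qed
qed simp

lemma derived_dec: "derived (Suc k) \<subseteq> derived k"
  unfolding derived.simps using subspace_derived derived_ideal by (intro span_minimal) auto

lemma derived_stable: "\<exists>k. derived (Suc k) = derived k"
proof (rule ccontr)
  assume no: "\<nexists>k. derived (Suc k) = derived k"
  have "dim (derived k) + k \<le> dimension" for k
  proof (induction k)
    case (Suc k)
    have "\<not> dim (derived k) \<le> dim (derived (Suc k))"
      using no derived_dec subspace_dim_equal[OF subspace_derived subspace_derived] by blast
    then show ?case using Suc by simp
  qed (simp add: dimension_def)
  from this[of "Suc dimension"] show False by simp
qed

end

locale complex_symplectic = complex_lie scale Basis br
  for scale :: "complex \<Rightarrow> 'b::ab_group_add \<Rightarrow> 'b" (infixr \<open>\<cdot>\<close> 75) and Basis br +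
  fixes \<omega> :: "'b \<Rightarrow> 'b \<Rightarrow> complex"
  assumes form_left: "linform (\<lambda>x. \<omega> x y)" and form_right: "linform (\<omega> x)"
    and skew: "\<omega> x y = - \<omega> y x"
    and nondeg: "(\<And>y. \<omega> z y = 0) \<Longrightarrow> z = 0"
    and closed: "\<omega> (br x y) z + \<omega> (br y z) x + \<omega> (br z x) y = 0"
    and unimodular: "trace (br x) = 0"
begin

lemma represent: "linform \<phi> \<Longrightarrow> \<exists>v. \<forall>y. \<omega> v y = \<phi> y"
  using form_represents[OF form_left form_right subspace_UNIV] nondeg by auto

lemma form_diff: "\<omega> (x - y) z = \<omega> x z - \<omega> y z"
  using linform_add[OF form_left, of "x - y" y z] by simp

lemma form_eqI: "(\<And>z. \<omega> u z = \<omega> v z) \<Longrightarrow> u = v"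
  using nondeg[of "u - v"] by (simp add: form_diff)

lemmas form_simps = linform_add[OF form_left] linform_add[OF form_right]
  linform_scale[OF form_left] linform_scale[OF form_right] form_diff

lemma form_neg: "\<omega> x (- y) = - \<omega> x y" "\<omega> (- x) y = - \<omega> x y"
  using linform_scale[OF form_right, of x "-1" y] linform_scale[OF form_left, of "-1" x y] by simp_all

lemma form_diff_right: "\<omega> z (x - y) = \<omega> z x - \<omega> z y"
  using linform_add[OF form_right, of z "x - y" y] by simp

section \<open>The left-symmetric product and its right multiplications\<close>

definition lsp :: "'b \<Rightarrow> 'b \<Rightarrow> 'b" where
  "lsp x y = (SOME u. \<forall>z. \<omega> u z = - \<omega> y (br x z))"

lemma form_lsp: "\<omega> (lsp x y) z = - \<omega> y (br x z)"
proof -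
  have "linform (\<lambda>z. - \<omega> y (br x z))"
    by (intro linformI) (simp_all add: br_add br_scale form_simps)
  then have "\<exists>u. \<forall>z. \<omega> u z = - \<omega> y (br x z)" by (rule represent)
  then have "\<forall>z. \<omega> (lsp x y) z = - \<omega> y (br x z)" unfolding lsp_def by (rule someI_ex)
  then show ?thesis by blast
qed

lemma lin_lsp: "lin (lsp x)" and lin_lsp_left: "lin (\<lambda>x. lsp x y)"
  by (auto intro!: linI form_eqI simp: form_simps form_lsp br_add br_scale)

text \<open>Closedness of \<open>\<omega>\<close> in other words.\<close>

lemma lsp_commutator: "lsp x y - lsp y x = br x y"
proof (rule form_eqI)
  fix z
  have "\<omega> (br z x) y = \<omega> y (br x z)" "\<omega> (br y z) x = - \<omega> x (br y z)"
    using skew[of "br z x" y] skew[of "br y z" x] br_anti[of z x] by (simp_all add: form_neg)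
  then have "\<omega> (br x y) z + - \<omega> x (br y z) + \<omega> y (br x z) = 0"
    using closed[of x y z] by (simp only:)
  then have "\<omega> (br x y) z = - \<omega> y (br x z) - - \<omega> x (br y z)" by algebra
  then show "\<omega> (lsp x y - lsp y x) z = \<omega> (br x y) z" by (simp add: form_diff form_lsp)
qed

text \<open>\<open>lsp\<close> is the coadjoint representation carried over to the algebra by
  \<open>\<omega>\<close>.\<close>

lemma lsp_br: "lsp (br x y) u = lsp x (lsp y u) - lsp y (lsp x u)"
  by (rule form_eqI) (simp add: form_diff form_lsp br_br form_diff_right)

lemma lsp_left_symmetric: "lsp x (lsp w v) = lsp w (lsp x v) + lsp (lsp x w) v - lsp (lsp w x) v"
proof -
  have "lsp x (lsp w v) = lsp (br x w) v + lsp w (lsp x v)"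
    by (simp add: lsp_br)
  moreover have "lsp (lsp x w) v = lsp (br x w) v + lsp (lsp w x) v"
    by (simp add: lin_diff[OF lin_lsp_left, of "lsp x w" "lsp w x" v, unfolded lsp_commutator])
  ultimately show ?thesis by simp
qed

definition rmul :: "'b \<Rightarrow> 'b \<Rightarrow> 'b" where
  "rmul v x = lsp x v"

lemma lin_rmul: "lin (rmul v)"
  unfolding rmul_def by (rule lin_lsp_left)

text \<open>\<open>lsp w\<close> is adjoint to \<open>- br w\<close>, and \<open>rmul w\<close> is
  \<open>lsp w\<close> minus \<open>br w\<close>; all these traces vanish by unimodularity.\<close>

lemma trace_rmul: "trace (rmul w) = 0"
proof -
  have "trace (lsp w) = trace (\<lambda>z. - br w z)"
    by (rule trace_adjoint[OF form_left form_right nondeg])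
      (use lin_smult[OF lin_br, of "-1" w] in \<open>simp_all add: lin_lsp form_lsp form_neg\<close>)
  then have "trace (lsp w) = 0"
    using trace_scale[of "-1" "br w"] by (simp add: unimodular)
  moreover have "rmul w = (\<lambda>x. lsp w x - br w x)"
    using lsp_commutator[of w] by (auto simp: rmul_def algebra_simps fun_eq_iff)
  ultimately show ?thesis by (simp add: trace_diff unimodular)
qed

text \<open>Left symmetry gives \<open>rmul (rmul v w)\<close> as \<open>rmul v\<close> after
  \<open>rmul w\<close> plus the commutator of \<open>lsp w\<close> with \<open>rmul v\<close>. The
  commutator contributes trace zero, since a power of \<open>rmul v\<close> commutes with
  \<open>rmul v\<close>.\<close>

lemma trace_rmul_step:
  "trace (\<lambda>x. (rmul v ^^ m) (rmul (rmul v w) x)) = trace (\<lambda>x. (rmul v ^^ Suc m) (rmul w x))"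
proof -
  let ?P = "rmul v ^^ m"
  have P: "lin ?P" by (rule lin_funpow[OF lin_rmul])
  have "?P (rmul (rmul v w) x) = ?P (lsp w (rmul v x)) + ?P (rmul v (rmul w x)) - ?P (rmul v (lsp w x))" for x
    using lsp_left_symmetric[of x w v] by (simp add: rmul_def lin_add[OF P] lin_diff[OF P])
  then have "trace (\<lambda>x. ?P (rmul (rmul v w) x))
    = trace (\<lambda>x. ?P (lsp w (rmul v x))) + trace (\<lambda>x. ?P (rmul v (rmul w x))) - trace (\<lambda>x. ?P (rmul v (lsp w x)))"
    by (simp add: trace_add trace_diff)
  moreover have "trace (\<lambda>x. ?P (lsp w (rmul v x))) = trace (\<lambda>x. rmul v (?P (lsp w x)))"
    by (rule trace_commute[OF lin_comp[OF P lin_lsp] lin_rmul])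
  ultimately show ?thesis by (simp add: funpow_swap1)
qed

lemma nilpotent_rmul: "\<exists>n. \<forall>x. (rmul v ^^ n) x = 0"
proof (rule nilpotent_if_power_traces_0[OF lin_rmul])
  \<comment> \<open>General \<open>w\<close> is essential: the case \<open>Suc m\<close> at
    \<open>w\<close> is the case \<open>m\<close> at \<open>rmul v w\<close>.\<close>
  have "trace (\<lambda>x. (rmul v ^^ m) (rmul w x)) = 0" for m w
  proof (induction m arbitrary: w)
    case 0
    have "(\<lambda>x. (rmul v ^^ 0) (rmul w x)) = rmul w" by simp
    then show ?case by (simp only: trace_rmul)
  next
    case (Suc m)
    then show ?case using trace_rmul_step[where v = v and m = m and w = w] by (simp only:)
  qed
  from this[of _ v] show "trace (rmul v ^^ Suc k) = 0" for k
    by (simp only: funpow_Suc_right o_def)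
qed

text \<open>
  If \<open>\<omega> e\<close> vanishes on the centralizer of \<open>e\<close> then it factors through \<open>br e\<close>, which yields \<open>v\<close> with
  \<open>rmul v e = - e\<close>; this contradicts the nilpotency of \<open>rmul v\<close>.
\<close>

lemma no_sl2_pair:
  assumes "br h e = 2 \<cdot> e" and inj: "\<And>z. br e z = 0 \<Longrightarrow> br h z = (-2) \<cdot> z \<Longrightarrow> z = 0"
  shows "e = 0"
proof -
  let ?C = "{z. br e z = 0}"
  define f where "f z = br h z + 2 \<cdot> z" for z
  have f: "lin f" unfolding f_def by (intro lin_plus lin_br lin_smult lin_ident)
  have fC: "f z \<in> ?C" if "z \<in> ?C" for z
  proof -
    have "br e (br h z) = br (br e h) z + br h (br e z)" by (rule br_derivation)
    also have "br e h = - (2 \<cdot> e)" using br_anti[of e h] assms(1) by simp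
    finally show ?thesis using that by (simp add: f_def br_add br_neg br_scale)
  qed
  have "f ` ?C = ?C"
  proof (rule inj_on_subspace_surj[OF f subspace_ker[OF lin_br] fC])
    show "z = 0" if "z \<in> ?C" "f z = 0" for z
      using inj[of z] that by (simp add: f_def add_eq_0_iff2)
  qed
  \<comment> \<open>Closedness at \<open>h\<close>, \<open>e\<close>, \<open>w\<close> says that
    \<open>\<omega> e\<close> vanishes at \<open>f w\<close>, and every element of the centralizer
    is of this form.\<close>
  then have C0: "\<omega> e z = 0" if z: "br e z = 0" for z
  proof -
    obtain w where w: "br e w = 0" "z = f w" using \<open>f ` ?C = ?C\<close> z by blast
    have "\<omega> (br w h) e = \<omega> e (br h w)"
      using skew[of "br w h" e] br_anti[of w h] by (simp add: form_neg)
    then have "2 * \<omega> e w + \<omega> e (br h w) = 0"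
      using closed[of h e w] assms(1) w(1) linform_0[OF form_left] by (simp add: form_simps)
    then show ?thesis by (simp add: w(2) f_def form_simps algebra_simps)
  qed
  obtain \<psi> where \<psi>: "linform \<psi>" "\<And>z. \<psi> (br e z) = \<omega> e z"
    using linform_factor[OF lin_br form_right C0] by metis
  obtain v where v: "\<And>y. \<omega> v y = \<psi> y" using represent[OF \<psi>(1)] by blast
  \<comment> \<open>Both sides pair with \<open>z\<close> to \<open>- \<omega> e z\<close>, by the
    choice of \<open>\<psi>\<close> and \<open>v\<close>.\<close>
  have "rmul v e = - e"
    unfolding rmul_def by (rule form_eqI) (simp add: form_lsp v \<psi>(2) form_neg)
  then have "(rmul v ^^ n) e = (-1) ^ n \<cdot> e" for n
    by (induction n) (simp_all add: lin_scale[OF lin_rmul])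
  moreover obtain n where "(rmul v ^^ n) e = 0" using nilpotent_rmul by blast
  ultimately show "e = 0" by simp
qed

theorem solvable: "\<exists>k. derived k = {0}"
proof (rule ccontr)
  assume no: "\<nexists>k. derived k = {0}"
  obtain k where k: "derived (Suc k) = derived k" using derived_stable by blast
  interpret perfect_ideal scale Basis br "derived k"
    by unfold_locales
      (use subspace_derived derived_ideal k no in \<open>auto simp: derived.simps(2)[symmetric] simp del: derived.simps\<close>)
  obtain e h where "e \<noteq> 0" "br h e = 2 \<cdot> e" "\<And>z. br e z = 0 \<Longrightarrow> br h z = (-2) \<cdot> z \<Longrightarrow> z = 0"
    using sl2_pair by blast
  then show False using no_sl2_pair by blast
qed

end

section \<open>Complexification\<close>

lemma fin_dim_space_real:
  fixes C :: "'a::real_vector set"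
  assumes "finite C" "independent C" "span C = UNIV"
  shows "fin_dim_space ((*\<^sub>R) :: real \<Rightarrow> 'a \<Rightarrow> 'a) C"
  using assms
  by (simp add: fin_dim_space_def finite_dimensional_vector_space_def finite_dimensional_vector_space_axioms_def
      real_vector.vector_space_axioms dependent_raw_def span_raw_def)

lemma lin_real: "Vector_Spaces.linear (*\<^sub>R) (*\<^sub>R) f \<longleftrightarrow> linear f"
  by (simp add: linear_def)

lemma linform_real: "Vector_Spaces.linear (*\<^sub>R) (*) f \<longleftrightarrow> linear (f :: 'a::real_vector \<Rightarrow> real)"
  by (simp add: linear_def real_scaleR_def[abs_def])

text \<open>\<open>(a, b)\<close> stands for \<open>a + \<i> b\<close>.\<close>

definition cscale :: "complex \<Rightarrow> 'a \<times> 'a \<Rightarrow> 'a \<times> 'a::real_vector" where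
  "cscale c x = (Re c *\<^sub>R fst x - Im c *\<^sub>R snd x, Re c *\<^sub>R snd x + Im c *\<^sub>R fst x)"

definition cbracket :: "('a \<Rightarrow> 'a \<Rightarrow> 'a) \<Rightarrow> 'a \<times> 'a \<Rightarrow> 'a \<times> 'a \<Rightarrow> 'a \<times> 'a::real_vector" where
  "cbracket br x y = (br (fst x) (fst y) - br (snd x) (snd y), br (fst x) (snd y) + br (snd x) (fst y))"

definition cform :: "('a::real_vector \<Rightarrow> 'a \<Rightarrow> real) \<Rightarrow> 'a \<times> 'a \<Rightarrow> 'a \<times> 'a \<Rightarrow> complex" where
  "cform \<omega> x y = Complex (\<omega> (fst x) (fst y) - \<omega> (snd x) (snd y)) (\<omega> (fst x) (snd y) + \<omega> (snd x) (fst y))"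

lemma vector_space_cscale: "vector_space (cscale :: complex \<Rightarrow> 'a::real_vector \<times> 'a \<Rightarrow> 'a \<times> 'a)"
  by unfold_locales (auto simp: cscale_def prod_eq_iff algebra_simps)

context real_lie_algebra
begin

lemmas br_add = bilinear_ladd[OF bilinear_bracket] bilinear_radd[OF bilinear_bracket]
lemmas br_diff = bilinear_lsub[OF bilinear_bracket] bilinear_rsub[OF bilinear_bracket]
lemmas br_scale = bilinear_lmul[OF bilinear_bracket] bilinear_rmul[OF bilinear_bracket]
lemmas br_zero [simp] = bilinear_lzero[OF bilinear_bracket] bilinear_rzero[OF bilinear_bracket]
lemmas br_neg = bilinear_lneg[OF bilinear_bracket] bilinear_rneg[OF bilinear_bracket]

lemma br_anti: "br x y = - br y x"
proof -
  have "br (x + y) (x + y) = 0" by (rule alternating)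
  then have "br x x + br x y + (br y x + br y y) = 0" by (simp only: br_add add_ac)
  then show ?thesis by (simp add: alternating eq_neg_iff_add_eq_0)
qed

lemma br_br: "br (br x y) z = br x (br y z) - br y (br x z)"
proof -
  have "br z (br x y) = - br (br x y) z" "br y (br z x) = - br y (br x z)"
    using br_anti[of z "br x y"] br_anti[of z x] by (simp_all add: br_neg)
  then show ?thesis using jacobi[of x y z] by (simp add: algebra_simps)
qed

lemma linear_br: "linear (br x)" "linear (\<lambda>x. br x y)"
  using bilinear_bracket by (auto simp: bilinear_def)

lemma real_basis:
  obtains C :: "'a set" where "finite C" "independent C" "span C = UNIV"
proof -
  obtain B :: "'a set" where B: "finite B" "span B = UNIV" using finite_dimensional by blast
  obtain C where C: "C \<subseteq> B" "independent C" "B \<subseteq> span C"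
    using real_vector.maximal_independent_subset[of B] by blast
  have "span C = UNIV"
    using B(2) C(3) real_vector.span_mono[of B "span C"] by (auto simp: real_vector.span_span)
  then show thesis using that C B finite_subset by blast
qed

lemma derived_series_subspace: "subspace (derived_series br k)"
  by (cases k) (simp_all add: bracket_space_def)

end

lemma cscale_sum: "(\<Sum>b\<in>A. cscale (u b) (b, 0 :: 'a::real_vector)) = ((\<Sum>b\<in>A. Re (u b) *\<^sub>R b), (\<Sum>b\<in>A. Im (u b) *\<^sub>R b))"
  by (induction A rule: infinite_finite_induct) (simp_all add: cscale_def zero_prod_def)

lemma complexified_basis:
  fixes C :: "'a::real_vector set"
  assumes C: "finite C" "independent C" "span C = UNIV"
  shows "complex_space cscale ((\<lambda>b. (b, 0 :: 'a)) ` C)"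
proof -
  interpret cs: vector_space "cscale :: complex \<Rightarrow> 'a \<times> 'a \<Rightarrow> 'a \<times> 'a"
    by (rule vector_space_cscale)
  let ?B = "(\<lambda>b. (b, 0 :: 'a)) ` C"
  have inj: "inj_on (\<lambda>b. (b, 0 :: 'a)) C" by (auto intro: inj_onI)
  have "\<not> cs.dependent ?B"
  proof (rule cs.independent_if_scalars_zero)
    fix f x assume 0: "(\<Sum>x\<in>?B. cscale (f x) x) = 0" and x: "x \<in> ?B"
    then obtain b where b: "b \<in> C" "x = (b, 0)" by blast
    have "(\<Sum>b\<in>C. Re (f (b, 0)) *\<^sub>R b) = 0" "(\<Sum>b\<in>C. Im (f (b, 0)) *\<^sub>R b) = 0"
      using 0 cscale_sum[of "\<lambda>b. f (b, 0)" C] by (simp_all add: sum.reindex[OF inj] zero_prod_def)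
    then have "Re (f (b, 0)) = 0" "Im (f (b, 0)) = 0"
      using real_vector.independentD[OF C(2) C(1) subset_refl _ b(1), of "\<lambda>b. Re (f (b, 0))"]
        real_vector.independentD[OF C(2) C(1) subset_refl _ b(1), of "\<lambda>b. Im (f (b, 0))"] by auto
    then show "f x = 0" by (simp add: b complex_eq_iff)
  qed (use C in simp)
  moreover have "cs.span ?B = UNIV"
  proof -
    have re: "(x, 0) \<in> cs.span ?B" for x
    proof -
      have "x \<in> span C" using C by simp
      then show ?thesis
      proof (induction rule: real_vector.span_induct_alt)
        case base
        then show ?case using cs.span_zero[of ?B] by (simp add: zero_prod_def)
      next
        case (step c x y)
        then have "cscale (of_real c) (x, 0) + (y, 0) \<in> cs.span ?B"
          by (intro cs.span_add cs.span_scale) (auto intro: cs.span_base)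
        moreover have "cscale (of_real c) (x, 0) + (y, 0) = (c *\<^sub>R x + y, 0)"
          by (simp add: cscale_def)
        ultimately show ?case by metis
      qed
    qed
    have "(x, y) \<in> cs.span ?B" for x y
    proof -
      have "(x, 0) + cscale \<i> (y, 0) \<in> cs.span ?B"
        using re by (intro cs.span_add cs.span_scale)
      moreover have "(x, 0) + cscale \<i> (y, 0) = (x, y)" by (simp add: cscale_def)
      ultimately show ?thesis by metis
    qed
    then show ?thesis by auto
  qed
  ultimately show ?thesis
    using C(1) by (intro complex_space.intro fin_dim_space.intro) (unfold_locales, auto)
qed

context symplectic_lie_algebra
begin

section \<open>The conclusions for the real algebra\<close>

lemmas form_add = bilinear_ladd[OF bilinear_form] bilinear_radd[OF bilinear_form]
lemmas form_diff = bilinear_lsub[OF bilinear_form] bilinear_rsub[OF bilinear_form]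
lemmas form_scale = bilinear_lmul[OF bilinear_form] bilinear_rmul[OF bilinear_form]

lemma unimodular_if_nondegenerate:
  assumes "nondegenerate_subspace \<omega> (bracket_space br UNIV UNIV)"
  shows "lie_unimodular br"
proof -
  obtain C :: "'a set" where C: "finite C" "independent C" "span C = UNIV" by (rule real_basis)
  interpret R: fin_dim_space "(*\<^sub>R) :: real \<Rightarrow> 'a \<Rightarrow> 'a" C by (rule fin_dim_space_real[OF C])
  have "R.trace (br x) = 0" for x
  proof (rule R.trace_ad_0[where \<omega> = \<omega>])
    show "R.lin (br x)" "R.lin (\<lambda>x. br x y)" for x y by (simp_all add: lin_real linear_br)
    show "R.linform (\<lambda>x. \<omega> x y)" "R.linform (\<omega> x)" for x y
      using bilinear_form by (simp_all add: linform_real bilinear_def)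
    show "\<omega> (br x y) z + \<omega> (br y z) x + \<omega> (br z x) y = 0" for x y z by (rule closed_form)
    show "module.span (*\<^sub>R) {br x y | x y. True} \<inter> {x. \<forall>y\<in>module.span (*\<^sub>R) {br x y | x y. True}. \<omega> x y = 0} = {0}"
      using assms by (simp add: nondegenerate_subspace_def bracket_space_def symp_orth_def span_raw_def)
    show "br x y = - br y x" for x y by (rule br_anti)
    show "br (br x y) z = br x (br y z) - br y (br x z)" for x y z by (rule br_br)
    show "\<omega> x y = - \<omega> y x" for x y by (rule skew_symmetric)
    show "z = 0" if "\<And>y. \<omega> z y = 0" for z using that by (rule nondegenerate)
  qed simp
  moreover have "endo_trace (br x) = R.trace (br x)" for x
    unfolding R.trace_def using endo_trace_eq[OF linear_br(1) C] by (simp add: representation_raw_def)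
  ultimately show ?thesis by (simp add: lie_unimodular_def)
qed

lemma solvable_if_unimodular:
  assumes unimodular: "lie_unimodular br"
  shows "lie_solvable br"
proof -
  obtain C :: "'a set" where C: "finite C" "independent C" "span C = UNIV" by (rule real_basis)
  let ?B = "(\<lambda>b. (b, 0 :: 'a)) ` C"
  interpret V: complex_space cscale ?B by (rule complexified_basis[OF C])
  interpret V: complex_lie cscale ?B "cbracket br"
  proof (intro complex_lie.intro complex_lie_axioms.intro)
    show "complex_space cscale ?B" by (rule complexified_basis[OF C])
    show "V.lin (cbracket br x)" "V.lin (\<lambda>x. cbracket br x y)" for x y
      by (auto intro!: V.linI simp: cbracket_def cscale_def br_add br_diff br_scale algebra_simps)
    show "cbracket br x x = 0" for x
      using br_anti[of "fst x" "snd x"] by (simp add: cbracket_def alternating zero_prod_def)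
    show "cbracket br x (cbracket br y z) + cbracket br y (cbracket br z x) + cbracket br z (cbracket br x y) = 0"
      for x y z
    proof -
      obtain x1 x2 y1 y2 z1 z2 where xyz: "x = (x1, x2)" "y = (y1, y2)" "z = (z1, z2)" by (metis surj_pair)
      \<comment> \<open>One of the three cyclic terms is expressed by the others. Fixing the outer
        argument to \<open>z1\<close> or \<open>z2\<close> turns this into a terminating rewrite
        rule.\<close>
      have J: "br z (br x y) = - br x (br y z) - br y (br z x)" for x y z
        using jacobi[of x y z] by (simp add: eq_neg_iff_add_eq_0 algebra_simps)
      show ?thesis
        unfolding xyz
        by (simp add: cbracket_def br_add br_diff zero_prod_def J[of z1] J[of z2])
    qed
  qed
  \<comment> \<open>Real vectors have the same coordinates in the complexified basis, so traces
    agree. General elements follow by splitting into real and imaginary parts.\<close>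
  have trace_real: "V.trace (cbracket br (a, 0)) = 0" for a
  proof -
    have "V.representation ?B (x, 0) (b, 0) = of_real (representation C x b)" if b: "b \<in> C" for x b
    proof -
      have inj: "inj_on (\<lambda>b. (b, 0 :: 'a)) C" by (auto intro: inj_onI)
      have indB: "V.independent ?B" "V.span ?B = UNIV" using V.independent_Basis V.span_Basis by auto
      have "(\<Sum>b\<in>C. representation C x b *\<^sub>R b) = x"
        by (rule real_vector.sum_representation_eq) (use C in auto)
      then have "(x, 0) = (\<Sum>b\<in>C. cscale (of_real (representation C x b)) (b, 0 :: 'a))"
        by (simp add: cscale_sum)
      then have "V.representation ?B (x, 0) (b, 0)
        = (\<Sum>c\<in>C. of_real (representation C x c) * V.representation ?B (c, 0) (b, 0))"
        using indB by (simp add: V.representation_sum V.representation_scale)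
      also have "\<dots> = (\<Sum>c\<in>C. if c = b then of_real (representation C x b) else 0)"
        using indB b by (intro sum.cong refl) (auto simp: V.representation_basis)
      also have "\<dots> = of_real (representation C x b)" using b C(1) by simp
      finally show ?thesis .
    qed
    then have "V.trace (cbracket br (a, 0)) = of_real (\<Sum>b\<in>C. representation C (br a b) b)"
      by (simp add: V.trace_def sum.reindex inj_on_def cbracket_def)
    also have "(\<Sum>b\<in>C. representation C (br a b) b) = endo_trace (br a)"
      by (rule endo_trace_eq[OF linear_br(1) C, symmetric])
    finally show ?thesis using unimodular by (simp add: lie_unimodular_def)
  qed
  interpret V: complex_symplectic cscale ?B "cbracket br" "cform \<omega>"
  proof (intro complex_symplectic.intro complex_symplectic_axioms.intro)
    show "complex_lie cscale ?B (cbracket br)" by unfold_locales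
    show "V.linform (\<lambda>x. cform \<omega> x y)" "V.linform (cform \<omega> x)" for x y
      by (auto intro!: V.linformI simp: cform_def cscale_def form_add form_diff form_scale complex_eq_iff algebra_simps)
    show "cform \<omega> x y = - cform \<omega> y x" for x y
      using skew_symmetric[of "fst x" "fst y"] skew_symmetric[of "snd x" "snd y"]
        skew_symmetric[of "fst x" "snd y"] skew_symmetric[of "snd x" "fst y"]
      by (simp add: cform_def complex_eq_iff)
    show "z = 0" if 0: "\<And>y. cform \<omega> z y = 0" for z
    proof -
      have "\<omega> (fst z) y = 0 \<and> \<omega> (snd z) y = 0" for y
        using 0[of "(y, 0)"] by (simp add: cform_def complex_eq_iff bilinear_rzero[OF bilinear_form])
      then show ?thesis using nondegenerate by (simp add: prod_eq_iff)
    qed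
    show "cform \<omega> (cbracket br x y) z + cform \<omega> (cbracket br y z) x + cform \<omega> (cbracket br z x) y = 0" for x y z
    proof -
      obtain x1 x2 y1 y2 z1 z2 where xyz: "x = (x1, x2)" "y = (y1, y2)" "z = (z1, z2)" by (metis surj_pair)
      have cl: "\<omega> (br z x) y = - \<omega> (br x y) z - \<omega> (br y z) x" for x y z
        using closed_form[of x y z] by simp
      show ?thesis
        unfolding xyz
        by (simp add: cform_def cbracket_def form_add form_diff complex_eq_iff cl[of z1] cl[of z2])
    qed
    show "V.trace (cbracket br x) = 0" for x
    proof -
      obtain a b where x: "x = (a, b)" by (cases x)
      have "cbracket br x = (\<lambda>y. cbracket br (a, 0) y + cscale \<i> (cbracket br (b, 0) y))"
        by (auto simp: x fun_eq_iff cbracket_def cscale_def)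
      then show ?thesis by (simp add: V.trace_add V.trace_scale trace_real)
    qed
  qed
  \<comment> \<open>The real series embeds in the complex one, so it vanishes as soon as the latter
    does.\<close>
  have "(x, 0) \<in> V.derived k" if "x \<in> derived_series br k" for x k
    using that
  proof (induction k arbitrary: x)
    case (Suc k)
    from Suc.prems have "x \<in> span {br x y | x y. x \<in> derived_series br k \<and> y \<in> derived_series br k}"
      by (simp add: bracket_space_def)
    then show ?case
    proof (induction rule: real_vector.span_induct_alt)
      case base
      show ?case using V.subspace_0[OF V.subspace_derived, of "Suc k"] by (simp add: zero_prod_def)
    next
      case (step c x y)
      then obtain a b where ab: "a \<in> derived_series br k" "b \<in> derived_series br k" "x = br a b" by blast
      have "(x, 0) = cbracket br (a, 0) (b, 0)" by (simp add: cbracket_def ab)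
      moreover have "cbracket br (a, 0) (b, 0) \<in> V.derived (Suc k)"
        using Suc.IH ab unfolding V.derived.simps by (intro V.span_base) blast
      ultimately have "cscale (of_real c) (x, 0) + (y, 0) \<in> V.derived (Suc k)"
        using V.subspace_add V.subspace_scale V.subspace_derived step.IH by metis
      moreover have "cscale (of_real c) (x, 0) + (y, 0) = (c *\<^sub>R x + y, 0)"
        by (simp add: cscale_def)
      ultimately show ?case by metis
    qed
  qed simp
  note real_derived = this
  obtain k where k: "V.derived k = {0}" using V.solvable by blast
  have "x = 0" if "x \<in> derived_series br k" for x
    using real_derived[OF that] k by (simp add: zero_prod_def)
  then have "derived_series br k \<subseteq> {0}" by blast
  then have "derived_series br k = {0}"
    using real_vector.subspace_0[OF derived_series_subspace] by blast
  then show ?thesis unfolding lie_solvable_def by blast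
qed

text \<open>The last nonzero term of the lower central series is central, hence orthogonal to all brackets.\<close>

lemma abelian_if_nilpotent:
  assumes nd: "nondegenerate_subspace \<omega> (bracket_space br UNIV UNIV)" and nilp: "lie_nilpotent br"
  shows "lie_abelian br"
proof -
  let ?D = "bracket_space br UNIV UNIV" and ?L = "lower_central_series br"
  have LD: "?L (Suc k) \<subseteq> ?D" for k
    unfolding lower_central_series.simps bracket_space_def by (intro real_vector.span_mono) blast
  have triv: "?L (Suc k) = {0}" if k: "?L (Suc (Suc k)) = {0}" for k
  proof -
    have "c = 0" if c: "c \<in> ?L (Suc k)" for c
    proof -
      have central: "br x c = 0" for x
      proof -
        have "br x c \<in> ?L (Suc (Suc k))"
          unfolding lower_central_series.simps(2)[of br "Suc k"] bracket_space_def
          using c by (intro real_vector.span_base) blast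
        then show ?thesis using k by blast
      qed
      have orth: "\<omega> c (br y z) = 0" for y z
      proof -
        have "\<omega> (br y z) c + \<omega> (br z c) y + \<omega> (br c y) z = 0" by (rule closed_form)
        moreover have "br c y = 0" using br_anti[of c y] central by simp
        ultimately show ?thesis
          using skew_symmetric[of c "br y z"] central bilinear_lzero[OF bilinear_form] by simp
      qed
      have "\<omega> c w = 0" if "w \<in> ?D" for w
        using that unfolding bracket_space_def
        by (induction rule: real_vector.span_induct_alt)
          (auto simp: bilinear_rzero[OF bilinear_form] form_add form_scale orth)
      then have "c \<in> ?D \<inter> symp_orth \<omega> ?D" using c LD by (auto simp: symp_orth_def)
      then show ?thesis using nd unfolding nondegenerate_subspace_def by blast
    qed
    moreover have "0 \<in> ?L (Suc k)" by (simp add: bracket_space_def real_vector.span_zero)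
    ultimately show ?thesis by blast
  qed
  obtain k where "?L k = {0}" using nilp unfolding lie_nilpotent_def by blast
  \<comment> \<open>Passing to the next term covers \<open>k = 0\<close>, the zero algebra, and lets
    the descent start at a successor index, where terms lie in \<open>?D\<close>.\<close>
  then have "{br x y | x y. x \<in> UNIV \<and> y \<in> ?L k} = {0}" by auto
  then have "?L (Suc k) = {0}" by (simp add: bracket_space_def)
  then have "?L (Suc 0) = {0}"
  proof (induction k)
    case (Suc k)
    then show ?case using triv[of k] by simp
  qed
  moreover have "br x y \<in> ?L (Suc 0)" for x y
    unfolding lower_central_series.simps bracket_space_def by (intro real_vector.span_base) blast
  ultimately show ?thesis unfolding lie_abelian_def by blast
qed

end

theorem theorem5p3:
  fixes br :: "'a::real_vector \<Rightarrow> 'a \<Rightarrow> 'a" and \<omega> :: "'a \<Rightarrow> 'a \<Rightarrow> real"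
  assumes "symplectic_lie_algebra br \<omega>"
    and "nondegenerate_subspace \<omega> (bracket_space br UNIV UNIV)"
  shows "lie_unimodular br \<and> lie_solvable br \<and> (\<not> lie_abelian br \<longrightarrow> \<not> lie_nilpotent br)"
proof -
  interpret symplectic_lie_algebra br \<omega> by fact
  have "lie_unimodular br" by (rule unimodular_if_nondegenerate) fact
  then show ?thesis
    using solvable_if_unimodular abelian_if_nilpotent assms(2) by blast
qed

end
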